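(* Let $\mathbf{T}:\mathbb{Z}^d\curvearrowright(X,\mu)$ be a Følner rank one action, with stacking towers $\{\mathcal{T}_n\}$ of shapes $\{F_n\}$ ($\{F_n\}$ a Følner sequence) fixed and descendant sets $I_{m,n}$ defined from these towers. Let $\sigma_{\mathfrak{G}}:\mathbb{Z}^d\curvearrowright(X_{\mathfrak{G}},\mu_{\mathfrak{G}})$ be the $\mathbb{Z}^d$-odometer corresponding to a decreasing sequence $\mathfrak{G}=\{G_1,G_2,G_3,\ldots\}$ of finite-index subgroups of $\mathbb{Z}^d$. The following are equivalent: (1) $(X,\mathbf{T})$ is conjugate to $(X_{\mathfrak{G}},\sigma_{\mathfrak{G}})$. (2) Both of the following statements hold: (a) For all $l\in\mathbb{N}$ and all $\epsilon>0$, there exist $k\in\mathbb{N}$ and $N\in\mathbb{N}$ such that for all $m\ge N$ there is $D\subseteq\mathbb{Z}^d/G_k$ such that $$\frac{\#\left(I_{l,m}\,\triangle\,\{\mathbf{i}\in F_m:\mathbf{i}+G_k\in D\}\right)}{\#(I_{l,m})}<\epsilon.$$ (b) For each $j$ and every $\epsilon>0$, there exists $N\in\mathbb{N}$ such that for all $n\ge m\ge N$ there is $\mathbf{g}\in\mathbb{Z}^d$ such that $$\frac{\#(\{\mathbf{i}\in I_{m,n}:\mathbf{i}\not\equiv\mathbf{g}\bmod G_j\})}{\#(I_{m,n})}<\epsilon.$$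
   Context: Measure-preserving $\mathbb{Z}^d$-action $\mathbf{T}:\mathbb{Z}^d\curvearrowright(X,\mu)$: $(X,\mathcal{X},\mu)$ is a (non-atomic) Lebesgue probability space, or a finite set with normalized counting measure; for each $\mathbf{v}\in\mathbb{Z}^d$, $\mathbf{T}^{\mathbf{v}}:X\to X$ is an invertible measurable measure-preserving map, with $\mathbf{T}^{\mathbf{v}+\mathbf{w}}=\mathbf{T}^{\mathbf{v}}\circ\mathbf{T}^{\mathbf{w}}$ and $\mathbf{T}^{\mathbf{0}}=\mathrm{id}$. A factor map from $(X,\mu,\mathbf{T})$ to $(Y,\nu,\mathbf{S})$ is a measurable $\phi:X\to Y$ whose push-forward of $\mu$ is $\nu$ and with $\phi(\mathbf{T}^{\mathbf{v}}(x))=\mathbf{S}^{\mathbf{v}}(\phi(x))$ for a.e. $x$ and every $\mathbf{v}$. Two actions are conjugate if there is a factor map from one to the other that is almost surely one-to-one. Odometers: for a decreasing sequence $\mathfrak{G}=\{G_j\}_{j\ge1}$ of finite-index subgroups of $\mathbb{Z}^d$, with quotient maps $q_j:\mathbb{Z}^d/G_{j+1}\to\mathbb{Z}^d/G_j$, $X_{\mathfrak{G}}=\{(\mathbf{x}_1,\mathbf{x}_2,\ldots):\mathbf{x}_j\in\mathbb{Z}^d/G_j,\ q_j(\mathbf{x}_{j+1})=\mathbf{x}_j\text{ for all }j\}$ (inverse limit, a compact topological group), $\sigma_{\mathfrak{G}}^{\mathbf{v}}(\mathbf{x}_1,\mathbf{x}_2,\ldots)=(\mathbf{x}_1+\mathbf{v}+G_1,\mathbf{x}_2+\mathbf{v}+G_2,\ldots)$,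 and $\mu_{\mathfrak{G}}$ is Haar probability measure (the unique invariant Borel probability measure). A shape is a nonempty finite subset of $\mathbb{Z}^d$. A sequence of shapes $\{F_n\}$ is a Følner sequence if $\#(F_n\triangle(F_n+\mathbf{v}))/\#(F_n)\to0$ for every $\mathbf{v}\in\mathbb{Z}^d$. A $\mathbf{T}$-tower of shape $R$ with base $B$ (measurable, $\mu(B)>0$) consists of the pairwise disjoint sets $\mathbf{T}^{\mathbf{v}}(B)$, $\mathbf{v}\in R$ (the levels), together with the error set $E=X\setminus\bigcup_{\mathbf{v}\in R}\mathbf{T}^{\mathbf{v}}(B)$. $\mathbf{T}$ is rank one for $\{F_n\}$ if there are $\mathbf{T}$-towers $\mathcal{T}_n$ of shape $F_n$ such that for every measurable $A$ there are sets $L_n$, each a union of levels of $\mathcal{T}_n$, with $\mu(L_n\triangle A)\to0$. $\mathbf{T}$ is Følner rank one if it is rank one for some Følner sequence $\{F_n\}$. The towers are stacking if for every $n$ each level of $\mathcal{T}_n$ is a union of levels of $\mathcal{T}_{n+1}$ and the error sets satisfy $E_{n+1}\subseteq E_n$. It is known that for a Følner rank one action (with $\mathbf{0}\in F_n$ for all $n$) the towers, of shapes $F_n$, can be chosen to be stacking and still such that for every measurable $A$ there are sets $L_n$, each a union of levels of $\mathcal{T}_n$, with $\mu(L_n\triangle A)\to0$; throughout, such towers $\mathcal{T}_n$, with bases $B_n$ and shapes $F_n\ni\mathbf{0}$, are fixed. For $n\ge m$, the descendant set is $I_{m,n}=\{\mathbf{i}\in F_n:\mathbf{T}^{\mathbf{i}}(B_n)\subseteq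 B_m\}$; it is defined only for $n\ge m$, so in (a) one considers $m\ge l$ only. *)

theory Defs
  imports "HOL-Probability.Probability" "HOL-Algebra.Algebra"
begin

definition Zgrp :: "(int ^ 'd::finite) monoid" where
  "Zgrp = \<lparr>carrier = UNIV, mult = (+), one = 0\<rparr>"

definition finite_index_subgroup :: "(int ^ 'd::finite) set \<Rightarrow> bool" where
  "finite_index_subgroup H \<longleftrightarrow> subgroup H Zgrp \<and> finite (rcosets\<^bsub>Zgrp\<^esub> H)"


section \<open>Lebesgue spaces and measure-preserving actions\<close>

definition isomorphic_mod_0 :: "'a measure \<Rightarrow> 'b measure \<Rightarrow> bool" where
  "isomorphic_mod_0 M N \<longleftrightarrow>
    (\<exists>A \<in> null_sets M. \<exists>B \<in> null_sets N. \<exists>f g.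
      let M' = restrict_space M (space M - A); N' = restrict_space N (space N - B) in
        f \<in> measurable M' N' \<and> g \<in> measurable N' M' \<and>
        (\<forall>x \<in> space M'. g (f x) = x) \<and> (\<forall>y \<in> space N'. f (g y) = y) \<and>
        distr M' N' f = N')"

(* The literature uses "Lebesgue probability space" both for complete spaces (modelled on the
   Lebesgue sets of the unit interval) and for standard Borel ones (modelled on its Borel sets).
   Both are admitted. *)
definition nonatomic_lebesgue_space :: "'a measure \<Rightarrow> bool" where
  "nonatomic_lebesgue_space M \<longleftrightarrow> prob_space M \<and>
    (isomorphic_mod_0 M (lebesgue_on {0..1::real}) \<or>
     isomorphic_mod_0 M (restrict_space lborel {0..1::real}))"

definition finite_uniform_space :: "'a measure \<Rightarrow> bool" where
  "finite_uniform_space M \<longleftrightarrow>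
    finite (space M) \<and> space M \<noteq> {} \<and> M = uniform_count_measure (space M)"

definition mp_action :: "'a measure \<Rightarrow> (int ^ 'd::finite \<Rightarrow> 'a \<Rightarrow> 'a) \<Rightarrow> bool" where
  "mp_action M T \<longleftrightarrow>
    (nonatomic_lebesgue_space M \<or> finite_uniform_space M) \<and>
    (\<forall>v. T v \<in> measurable M M \<and> bij_betw (T v) (space M) (space M) \<and> distr M M (T v) = M) \<and>
    (\<forall>v w. \<forall>x \<in> space M. T (v + w) x = T v (T w x)) \<and>
    (\<forall>x \<in> space M. T 0 x = x)"

definition factor_map ::
  "'a measure \<Rightarrow> (int ^ 'd::finite \<Rightarrow> 'a \<Rightarrow> 'a) \<Rightarrow>
   'b measure \<Rightarrow> (int ^ 'd \<Rightarrow> 'b \<Rightarrow> 'b) \<Rightarrow> ('a \<Rightarrow> 'b) \<Rightarrow> bool" where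
  "factor_map M T N S \<phi> \<longleftrightarrow>
    \<phi> \<in> measurable M N \<and> distr M N \<phi> = N \<and>
    (AE x in M. \<forall>v. \<phi> (T v x) = S v (\<phi> x))"

definition almost_surely_inj :: "'a measure \<Rightarrow> ('a \<Rightarrow> 'b) \<Rightarrow> bool" where
  "almost_surely_inj M \<phi> \<longleftrightarrow> (\<exists>A \<in> null_sets M. inj_on \<phi> (space M - A))"

definition conjugate ::
  "'a measure \<Rightarrow> (int ^ 'd::finite \<Rightarrow> 'a \<Rightarrow> 'a) \<Rightarrow>
   'b measure \<Rightarrow> (int ^ 'd \<Rightarrow> 'b \<Rightarrow> 'b) \<Rightarrow> bool" where
  "conjugate M T N S \<longleftrightarrow>
    (\<exists>\<phi>. factor_map M T N S \<phi> \<and> almost_surely_inj M \<phi>) \<or>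
    (\<exists>\<psi>. factor_map N S M T \<psi> \<and> almost_surely_inj N \<psi>)"


section \<open>Odometers\<close>

(* For H <= K the set product of a coset v + H with K is v + K. *)
definition quotient_map ::
  "(int ^ 'd::finite) set \<Rightarrow> (int ^ 'd) set \<Rightarrow> (int ^ 'd) set" where
  "quotient_map K C = C <#>\<^bsub>Zgrp\<^esub> K"

definition odometer_space ::
  "(nat \<Rightarrow> (int ^ 'd::finite) set) \<Rightarrow> (nat \<Rightarrow> (int ^ 'd) set) set" where
  "odometer_space G =
    {x. (\<forall>j. x j \<in> carrier (Zgrp Mod G j)) \<and> (\<forall>j. quotient_map (G j) (x (Suc j)) = x j)}"

definition odometer_topology ::
  "(nat \<Rightarrow> (int ^ 'd::finite) set) \<Rightarrow> (nat \<Rightarrow> (int ^ 'd) set) topology" where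
  "odometer_topology G =
    subtopology (product_topology (\<lambda>j. discrete_topology (carrier (Zgrp Mod G j))) UNIV)
      (odometer_space G)"

definition odometer_action ::
  "(nat \<Rightarrow> (int ^ 'd::finite) set) \<Rightarrow> int ^ 'd \<Rightarrow>
   (nat \<Rightarrow> (int ^ 'd) set) \<Rightarrow> (nat \<Rightarrow> (int ^ 'd) set)" where
  "odometer_action G v x = (\<lambda>j. x j \<otimes>\<^bsub>Zgrp Mod G j\<^esub> (G j #>\<^bsub>Zgrp\<^esub> v))"

(* Haar measure, characterised as the unique Borel probability measure on the odometer that is
   invariant under the action. *)
definition odometer_haar_measure ::
  "(nat \<Rightarrow> (int ^ 'd::finite) set) \<Rightarrow> (nat \<Rightarrow> (int ^ 'd) set) measure \<Rightarrow> bool" where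
  "odometer_haar_measure G \<mu> \<longleftrightarrow>
    prob_space \<mu> \<and>
    sets \<mu> = sets (sigma (odometer_space G) {U. openin (odometer_topology G) U}) \<and>
    (\<forall>v. distr \<mu> \<mu> (odometer_action G v) = \<mu>)"


section \<open>Towers and rank one\<close>

definition folner_sequence :: "(nat \<Rightarrow> (int ^ 'd::finite) set) \<Rightarrow> bool" where
  "folner_sequence F \<longleftrightarrow>
    (\<forall>n. finite (F n) \<and> F n \<noteq> {}) \<and>
    (\<forall>v. (\<lambda>n. real (card (sym_diff (F n) ((\<lambda>i. i + v) ` F n))) / real (card (F n)))
            \<longlonglongrightarrow> 0)"

definition tower ::
  "'a measure \<Rightarrow> (int ^ 'd::finite \<Rightarrow> 'a \<Rightarrow> 'a) \<Rightarrow> (int ^ 'd) set \<Rightarrow> 'a set \<Rightarrow> bool" where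
  "tower M T R B \<longleftrightarrow>
    finite R \<and> R \<noteq> {} \<and> B \<in> sets M \<and> measure M B > 0 \<and>
    disjoint_family_on (\<lambda>v. T v ` B) R"

definition tower_error ::
  "'a measure \<Rightarrow> (int ^ 'd::finite \<Rightarrow> 'a \<Rightarrow> 'a) \<Rightarrow> (int ^ 'd) set \<Rightarrow> 'a set \<Rightarrow> 'a set" where
  "tower_error M T R B = space M - (\<Union>v\<in>R. T v ` B)"

definition union_of_levels ::
  "(int ^ 'd::finite \<Rightarrow> 'a \<Rightarrow> 'a) \<Rightarrow> (int ^ 'd) set \<Rightarrow> 'a set \<Rightarrow> 'a set \<Rightarrow> bool" where
  "union_of_levels T R B L \<longleftrightarrow> (\<exists>V \<subseteq> R. L = (\<Union>v\<in>V. T v ` B))"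

definition rank_one_towers ::
  "'a measure \<Rightarrow> (int ^ 'd::finite \<Rightarrow> 'a \<Rightarrow> 'a) \<Rightarrow>
   (nat \<Rightarrow> (int ^ 'd) set) \<Rightarrow> (nat \<Rightarrow> 'a set) \<Rightarrow> bool" where
  "rank_one_towers M T F B \<longleftrightarrow>
    (\<forall>n. tower M T (F n) (B n)) \<and>
    (\<forall>A \<in> sets M. \<exists>L. (\<forall>n. union_of_levels T (F n) (B n) (L n)) \<and>
        (\<lambda>n. measure M (sym_diff (L n) A)) \<longlonglongrightarrow> 0)"

definition rank_one_for ::
  "'a measure \<Rightarrow> (int ^ 'd::finite \<Rightarrow> 'a \<Rightarrow> 'a) \<Rightarrow> (nat \<Rightarrow> (int ^ 'd) set) \<Rightarrow> bool" where
  "rank_one_for M T F \<longleftrightarrow> (\<exists>B. rank_one_towers M T F B)"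

definition folner_rank_one ::
  "'a measure \<Rightarrow> (int ^ 'd::finite \<Rightarrow> 'a \<Rightarrow> 'a) \<Rightarrow> bool" where
  "folner_rank_one M T \<longleftrightarrow> (\<exists>F. folner_sequence F \<and> rank_one_for M T F)"

definition stacking ::
  "'a measure \<Rightarrow> (int ^ 'd::finite \<Rightarrow> 'a \<Rightarrow> 'a) \<Rightarrow>
   (nat \<Rightarrow> (int ^ 'd) set) \<Rightarrow> (nat \<Rightarrow> 'a set) \<Rightarrow> bool" where
  "stacking M T F B \<longleftrightarrow>
    (\<forall>n. (\<forall>v \<in> F n. union_of_levels T (F (Suc n)) (B (Suc n)) (T v ` B n)) \<and>
         tower_error M T (F (Suc n)) (B (Suc n)) \<subseteq> tower_error M T (F n) (B n))"

definition descendants ::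
  "(int ^ 'd::finite \<Rightarrow> 'a \<Rightarrow> 'a) \<Rightarrow> (nat \<Rightarrow> (int ^ 'd) set) \<Rightarrow> (nat \<Rightarrow> 'a set) \<Rightarrow>
   nat \<Rightarrow> nat \<Rightarrow> (int ^ 'd) set" where
  "descendants T F B m n = {i \<in> F n. T i ` B n \<subseteq> B m}"

end

theory Submission
  imports Defs
begin

text \<open>
  A factor map onto the odometer is a compatible family of labels in the quotients of
  \<open>\<int>\<^sup>d\<close> by \<open>G j\<close>, such that translating a point by \<open>v\<close> adds \<open>v\<close> to its label. Hence a label
  that is nearly constant on the base \<open>B m\<close>, with value \<open>u\<close>, is nearly constant on every level of
  the tower, with value \<open>u + i\<close> on level \<open>i\<close>, and both conditions of the theorem compare this
  arithmetic of labels with the positions of descendants.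

  \<^emph>\<open>A conjugacy implies the conditions.\<close> The set of points with a given label is approximated by
  unions of levels, so some level carries a nearly constant label, and by equivariance so does
  the base (\<open>base_concentrated\<close>). A level \<open>i\<close> of the \<open>n\<close>-th tower that lies in \<open>B m\<close> is mostly
  labelled \<open>w + i\<close>, while \<open>B m\<close> is mostly labelled \<open>u\<close>. Counting measure, all but a few \<open>i\<close> are
  congruent to \<open>u - w\<close>, which is the second condition (\<open>descendants_in_one_coset\<close>). If \<open>B l\<close> is
  nearly the set of points with label in \<open>D\<close>, then level \<open>i\<close> lies in \<open>B l\<close> when \<open>u + i\<close> lies in \<open>D\<close>,
  up to few exceptions, which is the first one (\<open>descendants_nearly_union_of_cosets\<close>). These
  arguments use that label sets are approximated by sets coming from \<open>M\<close> and that sets coming from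
  \<open>M\<close> are approximated by label sets. For the nontrivial one of the two, in each direction of the
  conjugacy, injectivity has to be turned into generation of the whole sigma-algebra modulo null
  sets. A compactness argument (\<open>approx_by_separating_partitions\<close>) does this without the theorem
  that injective Borel images of Borel sets are Borel.

  \<^emph>\<open>The conditions imply a conjugacy.\<close> Along a sparse sequence of towers, give level \<open>i\<close> of the
  \<open>s\<close>-th one the label \<open>i + c s\<close>. By the second condition the shifts \<open>c s\<close> can be chosen so that
  consecutive labels agree modulo \<open>G s\<close> outside a set of measure at most \<open>3 / 2^s\<close>, the Folner
  property taking care of levels that are translated out of the tower. By Borel and Cantelli the
  labels stabilise modulo every \<open>G j\<close> and define a point \<open>coord x\<close> of the odometer. The map
  \<open>coord\<close> is equivariant, again by the Folner property, and equivariance alone makes all cosets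
  equally likely, so \<open>M\<close> is mapped to the Haar measure. The first condition says that each \<open>B l\<close> is,
  up to small error, a preimage under \<open>coord\<close>. Since unions of levels approximate all measurable
  sets, every measurable set is such a preimage modulo a null set (\<open>determined_all\<close>), and a
  countable family of sets that separates points makes \<open>coord\<close> injective almost everywhere.
\<close>

section \<open>Approximation by separating partitions\<close>

text \<open>
  The sigma-algebra need not be the Borel one, so that Lebesgue measurable sets are admitted
  together with Borel sets.
\<close>

definition inner_compact :: "'b::metric_space measure \<Rightarrow> bool" where
  "inner_compact Y \<longleftrightarrow> prob_space Y \<and>
    (\<forall>A\<in>sets Y. \<forall>e>0. \<exists>K. compact K \<and> K \<subseteq> A \<and> K \<in> sets Y \<and> measure Y (A - K) < e)"

lemma inner_compactE:
  assumes "inner_compact Y" "A \<in> sets Y" "e > 0"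
  obtains K where "compact K" "K \<subseteq> A" "K \<in> sets Y" "measure Y (A - K) < e"
  using assms unfolding inner_compact_def by blast

text \<open>
  Lusin's theorem for finite-valued functions: once every fibre has been shrunk to a compact
  subset, the fibres in the union of these subsets are compact.
\<close>

lemma inner_compact_finite_partition:
  fixes h :: "'b::metric_space \<Rightarrow> 'c"
  assumes Y: "inner_compact Y" and fin: "finite (h ` space Y)"
    and meas: "\<And>c. {x \<in> space Y. h x = c} \<in> sets Y" and e: "e > 0"
  shows "\<exists>K. compact K \<and> K \<in> sets Y \<and> measure Y (space Y - K) < e \<and>
             (\<forall>c. compact (K \<inter> {x \<in> space Y. h x = c}))"
proof -
  interpret prob_space Y using Y by (simp add: inner_compact_def)
  define r where "r = card (h ` space Y)"
  have e': "e / (r + 1) > 0" using e by simp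
  have "\<forall>c. \<exists>K. compact K \<and> K \<subseteq> {x \<in> space Y. h x = c} \<and> K \<in> sets Y \<and>
      measure Y ({x \<in> space Y. h x = c} - K) < e / (r + 1)"
    by (intro allI, rule inner_compactE[OF Y meas e']) blast
  from choice[OF this] obtain Kc where Kc0: "\<forall>c. compact (Kc c) \<and>
      Kc c \<subseteq> {x \<in> space Y. h x = c} \<and> Kc c \<in> sets Y \<and>
      measure Y ({x \<in> space Y. h x = c} - Kc c) < e / (r + 1)" ..
  have Kc: "compact (Kc c)" "Kc c \<subseteq> {x \<in> space Y. h x = c}" "Kc c \<in> sets Y"
    "measure Y ({x \<in> space Y. h x = c} - Kc c) < e / (r + 1)" for c
    using Kc0[rule_format, of c] by simp_all
  define K where "K = (\<Union>c\<in>h ` space Y. Kc c)"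
  have KS: "K \<in> sets Y" unfolding K_def using fin Kc(3) by (intro sets.finite_UN) auto
  have "measure Y (space Y - K) \<le> measure Y (\<Union>c\<in>h ` space Y. {x \<in> space Y. h x = c} - Kc c)"
    using fin Kc(3) meas by (intro finite_measure_mono sets.finite_UN) (auto simp: K_def)
  also have "\<dots> \<le> (\<Sum>c\<in>h ` space Y. measure Y ({x \<in> space Y. h x = c} - Kc c))"
    using fin Kc(3) meas by (intro finite_measure_subadditive_finite) auto
  also have "\<dots> \<le> (\<Sum>c\<in>h ` space Y. e / (r + 1))"
    using Kc(4) by (intro sum_mono less_imp_le) auto
  also have "\<dots> = r * (e / (r + 1))" by (simp add: r_def)
  also have "\<dots> < e" using e by (simp add: field_simps)
  finally have "measure Y (space Y - K) < e" .
  moreover have "K \<inter> {x \<in> space Y. h x = c} = (if c \<in> h ` space Y then Kc c else {})" for c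
  proof -
    have "h y = d" "y \<in> space Y" if "y \<in> Kc d" for y d using Kc(2)[of d] that by auto
    then show ?thesis unfolding K_def by auto
  qed
  then have "compact (K \<inter> {x \<in> space Y. h x = c})" for c using Kc(1) by simp
  moreover have "compact K" unfolding K_def using fin Kc(1) by (intro compact_UN) auto
  ultimately show ?thesis using KS by blast
qed

lemma decseq_compact_nonempty_Inter:
  fixes C :: "nat \<Rightarrow> 'b::metric_space set"
  assumes "\<And>n. compact (C n)" "\<And>n. C n \<noteq> {}" "decseq C"
  shows "\<exists>x. \<forall>n. x \<in> C n"
proof -
  have "C 0 \<inter> (\<Inter>n\<in>UNIV. C n) \<noteq> {}"
  proof (rule compact_imp_fip_image)
    show "closed (C n)" for n using assms(1) compact_imp_closed by blast
    fix I :: "nat set" assume I: "finite I" "I \<subseteq> UNIV"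
    have "C (Max (insert 0 I)) \<subseteq> C 0 \<inter> (\<Inter>n\<in>I. C n)"
    proof (intro Int_greatest INT_greatest)
      show "C (Max (insert 0 I)) \<subseteq> C 0" by (rule decseqD[OF assms(3)]) simp
      show "C (Max (insert 0 I)) \<subseteq> C n" if "n \<in> I" for n
        by (rule decseqD[OF assms(3)], rule Max_ge) (use I(1) that in auto)
    qed
    then show "C 0 \<inter> (\<Inter>n\<in>I. C n) \<noteq> {}" using assms(2)[of "Max (insert 0 I)"] by fast
  qed (use assms in auto)
  then show ?thesis by auto
qed

text \<open>
  All maps \<open>h n\<close> have compact fibres on one compact set \<open>L\<close> of nearly full measure. Take compact
  parts \<open>K1\<close> of \<open>A\<close> and \<open>K2\<close> of its complement, both of nearly full measure there. If no \<open>h n\<close> had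
  disjoint images on \<open>K1 \<inter> L\<close> and \<open>K2 \<inter> L\<close>, the compact sets of pairs in their product that \<open>h n\<close>
  does not separate would decrease with \<open>n\<close> and have a common point, a pair that is separated by
  no \<open>h n\<close> and lies off \<open>Z\<close>, although its first member is in \<open>A\<close> and its second is not.
\<close>

lemma approx_by_separating_partitions:
  fixes Y :: "'b::metric_space measure" and h :: "nat \<Rightarrow> 'b \<Rightarrow> 'c"
  assumes Y: "inner_compact Y" and A: "A \<in> sets Y"
    and fin: "\<And>n. finite (h n ` space Y)"
    and meas: "\<And>n c. {x \<in> space Y. h n x = c} \<in> sets Y"
    and refine: "\<And>n x y. \<lbrakk>x \<in> space Y; y \<in> space Y; h (Suc n) x = h (Suc n) y\<rbrakk> \<Longrightarrow> h n x = h n y"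
    and Z: "Z \<in> null_sets Y"
    and sep: "\<And>x y. \<lbrakk>x \<in> space Y - Z; y \<in> space Y - Z; \<And>n. h n x = h n y; x \<in> A\<rbrakk> \<Longrightarrow> y \<in> A"
    and e: "e > (0::real)"
  shows "\<exists>n D. measure Y (sym_diff A {x \<in> space Y. h n x \<in> D}) < e"
proof -
  interpret prob_space Y using Y by (simp add: inner_compact_def)
  have Zs: "Z \<in> sets Y" and Z0: "measure Y Z = 0" using Z by (auto simp: null_sets_def measure_def)
  have AY: "A \<subseteq> space Y" using A by (rule sets.sets_into_space)
  have e4: "e / 4 > 0" using e by simp
  obtain K1 where K1: "compact K1" "K1 \<subseteq> A - Z" "K1 \<in> sets Y" "measure Y (A - Z - K1) < e / 4"
    by (rule inner_compactE[OF Y _ e4, of "A - Z"]) (use A Zs in auto)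
  obtain K2 where K2: "compact K2" "K2 \<subseteq> space Y - A - Z" "K2 \<in> sets Y"
      "measure Y (space Y - A - Z - K2) < e / 4"
    by (rule inner_compactE[OF Y _ e4, of "space Y - A - Z"]) (use A Zs in auto)
  have "\<forall>n. \<exists>K. compact K \<and> K \<in> sets Y \<and> measure Y (space Y - K) < e / 8 * (1/2)^n \<and>
             (\<forall>c. compact (K \<inter> {x \<in> space Y. h n x = c}))"
    by (intro allI inner_compact_finite_partition[OF Y fin meas]) (use e in auto)
  from choice[OF this] obtain K where K0: "\<forall>n. compact (K n) \<and> K n \<in> sets Y \<and>
     measure Y (space Y - K n) < e / 8 * (1/2)^n \<and> (\<forall>c. compact (K n \<inter> {x \<in> space Y. h n x = c}))" ..
  have K: "compact (K n)" "K n \<in> sets Y" "measure Y (space Y - K n) < e / 8 * (1/2)^n"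
     "\<And>c. compact (K n \<inter> {x \<in> space Y. h n x = c})" for n
    using K0[rule_format, of n] by simp_all
  define L where "L = (\<Inter>n. K n)"
  have LS: "L \<in> sets Y" unfolding L_def using K(2) by auto
  have "measure Y (space Y - L) = measure Y (\<Union>n. space Y - K n)"
    by (rule arg_cong[of _ _ "measure Y"]) (auto simp: L_def)
  also have "\<dots> \<le> suminf (\<lambda>n. measure Y (space Y - K n))"
  proof (rule finite_measure_subadditive_countably)
    show "summable (\<lambda>n. measure Y (space Y - K n))"
      by (rule summable_comparison_test'[where g = "\<lambda>n. e / 8 * (1/2)^n" and N = 0])
         (use less_imp_le[OF K(3)] in \<open>auto intro!: summable_mult summable_geometric\<close>)
  qed (use K(2) in auto)
  also have "\<dots> \<le> suminf (\<lambda>n. e / 8 * (1/2)^n)"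
  proof (rule suminf_le)
    show s: "summable (\<lambda>n. e / 8 * (1/2::real)^n)" by (intro summable_mult summable_geometric) simp
    show "summable (\<lambda>n. measure Y (space Y - K n))"
      by (rule summable_comparison_test'[OF s, of 0]) (use less_imp_le[OF K(3)] in auto)
  qed (use less_imp_le[OF K(3)] in auto)
  also have "\<dots> = e / 4" by (subst suminf_mult) (simp_all add: suminf_geometric)
  finally have Lloss: "measure Y (space Y - L) \<le> e / 4" .
  define C where "C n = {(x, y). x \<in> K1 \<inter> L \<and> y \<in> K2 \<inter> L \<and> h n x = h n y}" for n
  have KY: "K n \<subseteq> space Y" for n using K(2) by (rule sets.sets_into_space)
  have LK: "L \<subseteq> K n" for n by (auto simp: L_def)
  have "closed L" unfolding L_def using K(1) compact_imp_closed by (intro closed_INT) auto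
  from compact_Int_closed[OF K(1)[of 0] this] have compL: "compact L" using LK[of 0] by (simp add: Int_absorb1)
  have C_eq: "C n = (\<Union>c\<in>h n ` space Y. ((K n \<inter> {x \<in> space Y. h n x = c}) \<inter> K1 \<inter> L) \<times>
                                     ((K n \<inter> {x \<in> space Y. h n x = c}) \<inter> K2 \<inter> L))" for n
    using LK[of n] KY[of n] by (auto simp: C_def)
  have Cc: "compact (C n)" for n unfolding C_eq
    by (intro compact_UN fin compact_Times compact_Int K1(1) K2(1) compL K(4))
  have Cdec: "decseq C"
    by (rule decseq_SucI) (use LK KY refine in \<open>fastforce simp: C_def\<close>)
  have "\<exists>n. C n = {}"
  proof (rule ccontr)
    assume "\<not> ?thesis"
    then obtain p where p: "\<And>n. p \<in> C n" using decseq_compact_nonempty_Inter[OF Cc _ Cdec] by blast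
    have "fst p \<in> K1" "snd p \<in> K2" and eq: "\<And>n. h n (fst p) = h n (snd p)"
      using p by (auto simp: C_def case_prod_beta)
    then have "snd p \<in> A" using sep[of "fst p" "snd p"] K1(2) K2(2) AY by blast
    then show False using \<open>snd p \<in> K2\<close> K2(2) by blast
  qed
  then obtain n where n: "C n = {}" by blast
  define D where "D = h n ` (K1 \<inter> L)"
  have DS: "{x \<in> space Y. h n x \<in> D} \<in> sets Y"
  proof -
    have "{x \<in> space Y. h n x \<in> D} = (\<Union>c\<in>D \<inter> h n ` space Y. {x \<in> space Y. h n x = c})" by auto
    then show ?thesis using fin meas by (auto intro!: sets.finite_UN)
  qed
  have "sym_diff A {x \<in> space Y. h n x \<in> D} \<subseteq>
      Z \<union> ((A - Z - K1) \<union> ((space Y - A - Z - K2) \<union> (space Y - L)))"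
    using n AY by (fastforce simp: D_def C_def)
  then have "measure Y (sym_diff A {x \<in> space Y. h n x \<in> D}) \<le>
      measure Y (Z \<union> ((A - Z - K1) \<union> ((space Y - A - Z - K2) \<union> (space Y - L))))"
    using A Zs K1 K2 LS by (intro finite_measure_mono) auto
  also have "\<dots> \<le> measure Y Z + (measure Y (A - Z - K1) + (measure Y (space Y - A - Z - K2) + measure Y (space Y - L)))"
    using A Zs K1 K2 LS
    by (intro order_trans[OF measure_Un_le] add_mono order_refl) auto
  also have "\<dots> < e" using Z0 K1(4) K2(4) Lloss e by linarith
  finally show ?thesis by blast
qed

text \<open>
  Gives access to compactness on a measure space whose points carry no topology.
\<close>

definition compact_model :: "'p measure \<Rightarrow> 'b::metric_space measure \<Rightarrow> ('b \<Rightarrow> 'p) \<Rightarrow> bool" where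
  "compact_model P Y g \<longleftrightarrow> inner_compact Y \<and> g \<in> measurable Y P \<and> distr Y P g = P"

lemma approx_by_separating_partitions_model:
  fixes Y :: "'b::metric_space measure" and h :: "nat \<Rightarrow> 'p \<Rightarrow> 'c"
  assumes Y: "compact_model P Y g" and A: "A \<in> sets P"
    and fin: "\<And>n. finite (h n ` space P)"
    and meas: "\<And>n c. {x \<in> space P. h n x = c} \<in> sets P"
    and refine: "\<And>n x y. \<lbrakk>x \<in> space P; y \<in> space P; h (Suc n) x = h (Suc n) y\<rbrakk> \<Longrightarrow> h n x = h n y"
    and Z: "Z \<in> null_sets P"
    and sep: "\<And>x y. \<lbrakk>x \<in> space P - Z; y \<in> space P - Z; \<And>n. h n x = h n y; x \<in> A\<rbrakk> \<Longrightarrow> y \<in> A"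
    and e: "e > (0::real)"
  shows "\<exists>n D. measure P (sym_diff A {x \<in> space P. h n x \<in> D}) < e"
proof -
  have g: "g \<in> measurable Y P" and d: "distr Y P g = P" and ic: "inner_compact Y"
    using Y by (auto simp: compact_model_def)
  have gs: "g x \<in> space P" if "x \<in> space Y" for x using measurable_space[OF g that] .
  have pre: "measure Y (g -` S \<inter> space Y) = measure P S" if "S \<in> sets P" for S
    using measure_distr[OF g that] d by simp
  have pre_in: "g -` S \<inter> space Y \<in> sets Y" if "S \<in> sets P" for S
    using measurable_sets[OF g that] .
  have hm: "{x \<in> space Y. h n (g x) = c} \<in> sets Y" for n c
  proof -
    have "{x \<in> space Y. h n (g x) = c} = g -` {x \<in> space P. h n x = c} \<inter> space Y" using gs by auto
    then show ?thesis using pre_in[OF meas] by simp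
  qed
  have "\<exists>n D. measure Y (sym_diff (g -` A \<inter> space Y) {x \<in> space Y. (\<lambda>n. h n \<circ> g) n x \<in> D}) < e"
  proof (rule approx_by_separating_partitions[OF ic pre_in[OF A], of _ "g -` Z \<inter> space Y"])
    show "finite ((\<lambda>n. h n \<circ> g) n ` space Y)" for n
      by (rule finite_subset[OF _ fin[of n]]) (use gs in auto)
    show "g -` Z \<inter> space Y \<in> null_sets Y"
      using Z d null_sets_distr_iff[OF g, of Z] by auto
    show "(h n \<circ> g) x = (h n \<circ> g) y" if "x \<in> space Y" "y \<in> space Y" "(h (Suc n) \<circ> g) x = (h (Suc n) \<circ> g) y" for n x y
      using refine gs that by auto
    show "y \<in> g -` A \<inter> space Y" if "x \<in> space Y - (g -` Z \<inter> space Y)" "y \<in> space Y - (g -` Z \<inter> space Y)"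
      "\<And>n. (h n \<circ> g) x = (h n \<circ> g) y" "x \<in> g -` A \<inter> space Y" for x y
      using sep[of "g x" "g y"] that gs by auto
  qed (use hm e in auto)
  then obtain n D where nD: "measure Y (sym_diff (g -` A \<inter> space Y) {x \<in> space Y. h n (g x) \<in> D}) < e"
    by auto
  have DS: "{x \<in> space P. h n x \<in> D} \<in> sets P"
  proof -
    have "{x \<in> space P. h n x \<in> D} = (\<Union>c\<in>D \<inter> h n ` space P. {x \<in> space P. h n x = c})" by auto
    then show ?thesis using fin meas by (auto intro!: sets.finite_UN)
  qed
  have "g -` sym_diff A {x \<in> space P. h n x \<in> D} \<inter> space Y = sym_diff (g -` A \<inter> space Y) {x \<in> space Y. h n (g x) \<in> D}"
    using gs by auto
  then have "measure P (sym_diff A {x \<in> space P. h n x \<in> D}) < e"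
    using nD pre[of "sym_diff A {x \<in> space P. h n x \<in> D}"] A DS by auto
  then show ?thesis by blast
qed

section \<open>Cosets and the odometer\<close>

abbreviation zcoset :: "(int ^ 'd::finite) set \<Rightarrow> int ^ 'd \<Rightarrow> (int ^ 'd) set" where
  "zcoset H v \<equiv> H #>\<^bsub>Zgrp\<^esub> v"

lemma group_Zgrp: "group (Zgrp :: (int ^ 'd::finite) monoid)"
proof (rule groupI)
  show "\<exists>y\<in>carrier Zgrp. y \<otimes>\<^bsub>Zgrp\<^esub> x = \<one>\<^bsub>Zgrp\<^esub>" if "x \<in> carrier Zgrp" for x :: "int ^ 'd"
    by (intro bexI[of _ "- x"]) (simp_all add: Zgrp_def)
qed (auto simp: Zgrp_def algebra_simps)

lemma inv_Zgrp: "inv\<^bsub>Zgrp\<^esub> x = - x"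
  by (rule group.inv_equality[OF group_Zgrp]) (auto simp: Zgrp_def)

lemma subgroup_Zgrp_zero: "subgroup H Zgrp \<Longrightarrow> 0 \<in> H"
  using subgroup.one_closed[of H Zgrp] by (simp add: Zgrp_def)

lemma subgroup_Zgrp_add: "subgroup H Zgrp \<Longrightarrow> x \<in> H \<Longrightarrow> y \<in> H \<Longrightarrow> x + y \<in> H"
  using subgroup.m_closed[of H Zgrp x y] by (simp add: Zgrp_def)

lemma subgroup_Zgrp_minus: "subgroup H Zgrp \<Longrightarrow> x \<in> H \<Longrightarrow> - x \<in> H"
  using subgroup.m_inv_closed[of H Zgrp x] by (simp add: inv_Zgrp)

lemma subgroup_Zgrp_diff: "subgroup H Zgrp \<Longrightarrow> x \<in> H \<Longrightarrow> y \<in> H \<Longrightarrow> x - y \<in> H"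
  using subgroup_Zgrp_add[of H x "- y"] subgroup_Zgrp_minus[of H y] by simp

lemma mem_zcoset: "x \<in> zcoset H v \<longleftrightarrow> x - v \<in> H"
  by (auto simp: r_coset_def Zgrp_def) (metis diff_add_cancel)

lemma zcoset_eq_iff:
  assumes "subgroup H Zgrp"
  shows "zcoset H v = zcoset H w \<longleftrightarrow> v - w \<in> H"
proof
  assume "zcoset H v = zcoset H w"
  moreover have "v \<in> zcoset H v" using subgroup_Zgrp_zero[OF assms] by (simp add: mem_zcoset)
  ultimately show "v - w \<in> H" by (simp add: mem_zcoset)
next
  assume vw: "v - w \<in> H"
  show "zcoset H v = zcoset H w"
  proof (rule Set.set_eqI)
    fix x
    have "x - v \<in> H \<longleftrightarrow> x - w \<in> H"
      using subgroup_Zgrp_add[OF assms _ vw, of "x - v"] subgroup_Zgrp_diff[OF assms _ vw, of "x - w"] by auto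
    then show "x \<in> zcoset H v \<longleftrightarrow> x \<in> zcoset H w" by (simp add: mem_zcoset)
  qed
qed

lemma carrier_Zgrp_Mod: "carrier (Zgrp Mod H) = range (zcoset H)"
  by (auto simp: FactGroup_def RCOSETS_def Zgrp_def)

lemma zcoset_mult:
  assumes "subgroup H Zgrp"
  shows "zcoset H u \<otimes>\<^bsub>Zgrp Mod H\<^esub> zcoset H v = zcoset H (u + v)"
proof -
  have "H \<lhd> Zgrp"
    by (rule comm_group.subgroup_imp_normal[OF _ assms], rule group.group_comm_groupI[OF group_Zgrp])
       (auto simp: Zgrp_def)
  then show ?thesis
    using normal.rcos_sum[of H Zgrp u v] by (simp add: FactGroup_def) (simp add: Zgrp_def)
qed

lemma quotient_map_zcoset:
  assumes "subgroup H Zgrp" "subgroup K Zgrp" "H \<subseteq> K"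
  shows "quotient_map K (zcoset H v) = zcoset K v"
proof (intro Set.set_eqI iffI)
  fix x assume "x \<in> quotient_map K (zcoset H v)"
  then obtain h k where "h - v \<in> H" "k \<in> K" "x = h + k"
    by (auto simp: quotient_map_def set_mult_def mem_zcoset) (auto simp: Zgrp_def)
  moreover have "h + k - v = (h - v) + k" by simp
  ultimately show "x \<in> zcoset K v"
    using assms(3) subgroup_Zgrp_add[OF assms(2), of "h - v" k] by (auto simp: mem_zcoset algebra_simps)
next
  fix x assume "x \<in> zcoset K v"
  then have "x - v \<in> K" by (simp add: mem_zcoset)
  moreover have "v \<in> zcoset H v" using subgroup_Zgrp_zero[OF assms(1)] by (simp add: mem_zcoset)
  moreover have "x = v \<otimes>\<^bsub>Zgrp\<^esub> (x - v)" by (simp add: Zgrp_def)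
  ultimately show "x \<in> quotient_map K (zcoset H v)"
    unfolding quotient_map_def set_mult_def by blast
qed

locale subgroup_chain =
  fixes G :: "nat \<Rightarrow> (int ^ 'd::finite) set"
  assumes finite_index: "\<And>j. finite_index_subgroup (G j)" and decG: "decseq G"
begin

lemma subG: "subgroup (G j) Zgrp"
  using finite_index by (simp add: finite_index_subgroup_def)

lemma finite_cosets: "finite (range (zcoset (G j)))"
  using finite_index[of j] carrier_Zgrp_Mod[of "G j"]
  by (simp add: finite_index_subgroup_def FactGroup_def)

lemma zcoset_G_eq_iff: "zcoset (G j) v = zcoset (G j) w \<longleftrightarrow> v - w \<in> G j"
  by (rule zcoset_eq_iff[OF subG])

text \<open>
  Compatibility means that neighbouring coordinates have a common representative, which is the
  form used below instead of the quotient maps.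
\<close>

lemma odometer_space_iff:
  "x \<in> odometer_space G \<longleftrightarrow>
     (\<forall>j. \<exists>v. x j = zcoset (G j) v \<and> x (Suc j) = zcoset (G (Suc j)) v)"
proof -
  have q: "quotient_map (G j) (zcoset (G (Suc j)) v) = zcoset (G j) v" for j v
    using decseq_SucD[OF decG] by (intro quotient_map_zcoset subG) auto
  have "(\<forall>j. x j \<in> range (zcoset (G j))) \<and> (\<forall>j. quotient_map (G j) (x (Suc j)) = x j) \<longleftrightarrow>
     (\<forall>j. \<exists>v. x j = zcoset (G j) v \<and> x (Suc j) = zcoset (G (Suc j)) v)" (is "?L \<longleftrightarrow> ?R")
  proof
    assume L: ?L
    show ?R
    proof
      fix j
      obtain v where "x (Suc j) = zcoset (G (Suc j)) v" using L by blast
      moreover from this have "x j = zcoset (G j) v" using L q[of j v] by metis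
      ultimately show "\<exists>v. x j = zcoset (G j) v \<and> x (Suc j) = zcoset (G (Suc j)) v" by blast
    qed
  next
    assume R: ?R
    show ?L
    proof (intro conjI allI)
      fix j
      show "x j \<in> range (zcoset (G j))" using R by blast
      obtain v where "x j = zcoset (G j) v" "x (Suc j) = zcoset (G (Suc j)) v" using R by blast
      then show "quotient_map (G j) (x (Suc j)) = x j" using q by simp
    qed
  qed
  then show ?thesis unfolding odometer_space_def carrier_Zgrp_Mod by simp
qed

lemma odometer_coord: "x \<in> odometer_space G \<Longrightarrow> \<exists>v. x j = zcoset (G j) v"
  unfolding odometer_space_iff by blast

lemma odometer_coord_le:
  assumes x: "x \<in> odometer_space G" and "i \<le> j" "x j = zcoset (G j) v"
  shows "x i = zcoset (G i) v"
  using assms(2,3)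
proof (induction j arbitrary: v rule: dec_induct)
  case (step j)
  obtain w where w: "x j = zcoset (G j) w" "x (Suc j) = zcoset (G (Suc j)) w"
    using x unfolding odometer_space_iff by blast
  then have "w - v \<in> G (Suc j)" using step.prems zcoset_G_eq_iff by metis
  then have "w - v \<in> G j" using decseq_SucD[OF decG] by blast
  then have "x j = zcoset (G j) v" using w(1) zcoset_G_eq_iff by simp
  then show ?case by (rule step.IH)
qed

lemma odometer_action_coord:
  "x j = zcoset (G j) u \<Longrightarrow> odometer_action G v x j = zcoset (G j) (u + v)"
  by (simp only: odometer_action_def zcoset_mult[OF subG])

lemma odometer_action_in: "x \<in> odometer_space G \<Longrightarrow> odometer_action G v x \<in> odometer_space G"
  unfolding odometer_space_iff using odometer_action_coord by metis

lemma diagonal_in_odometer_space: "(\<lambda>j. zcoset (G j) v) \<in> odometer_space G"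
  unfolding odometer_space_iff by blast

definition cyl :: "nat \<Rightarrow> (int ^ 'd) set \<Rightarrow> (nat \<Rightarrow> (int ^ 'd) set) set" where
  "cyl j c = {x \<in> odometer_space G. x j = c}"

lemma cyl_nonempty_coset: "x \<in> cyl j c \<Longrightarrow> c \<in> range (zcoset (G j))"
  using odometer_coord[of x j] by (auto simp: cyl_def)

lemma openin_cyl: "openin (odometer_topology G) (cyl j c)"
proof -
  have "openin (product_topology (\<lambda>j. discrete_topology (carrier (Zgrp Mod G j))) UNIV)
     {x. x j \<in> {c} \<inter> carrier (Zgrp Mod G j) \<and> (\<forall>i. x i \<in> carrier (Zgrp Mod G i))}"
  proof -
    have eq: "{x. x j \<in> {c} \<inter> carrier (Zgrp Mod G j) \<and> (\<forall>i. x i \<in> carrier (Zgrp Mod G i))} =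
       PiE UNIV (\<lambda>i. if i = j then {c} \<inter> carrier (Zgrp Mod G j) else carrier (Zgrp Mod G i))"
      by (auto simp: PiE_def Pi_def split: if_splits)
    show ?thesis unfolding eq openin_PiE_gen
      by (auto intro!: disjI2 finite_subset[of _ "{j}"] split: if_splits)
  qed
  moreover have "cyl j c = {x. x j \<in> {c} \<inter> carrier (Zgrp Mod G j) \<and> (\<forall>i. x i \<in> carrier (Zgrp Mod G i))} \<inter> odometer_space G"
    by (auto simp: cyl_def odometer_space_def)
  ultimately show ?thesis unfolding odometer_topology_def openin_subtopology by blast
qed

text \<open>
  A basic open set restricts finitely many coordinates, and the last of these determines the
  others.
\<close>

lemma open_contains_cyl:
  assumes U: "openin (odometer_topology G) U" and x: "x \<in> U"
  shows "\<exists>j. cyl j (x j) \<subseteq> U"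
proof -
  obtain V where V: "openin (product_topology (\<lambda>j. discrete_topology (carrier (Zgrp Mod G j))) UNIV) V"
    and UV: "U = V \<inter> odometer_space G"
    using U unfolding odometer_topology_def openin_subtopology by blast
  have xV: "x \<in> V" and xO: "x \<in> odometer_space G" using x UV by auto
  obtain W where fin: "finite {i. W i \<noteq> carrier (Zgrp Mod G i)}"
     and xW: "x \<in> PiE UNIV W" and WV: "PiE UNIV W \<subseteq> V"
    using V xV unfolding openin_product_topology_alt by (auto simp: topspace_discrete_topology)
  define j where "j = Max (insert 0 {i. W i \<noteq> carrier (Zgrp Mod G i)})"
  have le: "i \<le> j" if "W i \<noteq> carrier (Zgrp Mod G i)" for i
    unfolding j_def using fin that by (intro Max_ge) auto
  have "y \<in> V" if y: "y \<in> cyl j (x j)" for y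
  proof -
    have yO: "y \<in> odometer_space G" and yj: "y j = x j" using y by (auto simp: cyl_def)
    obtain v where v: "x j = zcoset (G j) v" using odometer_coord[OF xO] by blast
    have "y i \<in> W i" for i
    proof (cases "W i = carrier (Zgrp Mod G i)")
      case True
      then show ?thesis using yO by (simp add: odometer_space_def)
    next
      case False
      then have "y i = x i"
        using odometer_coord_le[OF xO le v] odometer_coord_le[OF yO le, of i v] yj v by simp
      then show ?thesis using xW by (auto simp: PiE_def)
    qed
    then show ?thesis using WV by (auto simp: PiE_def)
  qed
  then have "cyl j (x j) \<subseteq> U" using UV by (auto simp: cyl_def)
  then show ?thesis by blast
qed

end

locale odometer_haar = subgroup_chain G for G :: "nat \<Rightarrow> (int ^ 'd::finite) set" +
  fixes \<mu> :: "(nat \<Rightarrow> (int ^ 'd) set) measure"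
  assumes haar: "odometer_haar_measure G \<mu>"
begin

sublocale mu: prob_space \<mu> using haar by (simp add: odometer_haar_measure_def)

lemma openin_subset_odometer: "openin (odometer_topology G) U \<Longrightarrow> U \<subseteq> odometer_space G"
  unfolding odometer_topology_def openin_subtopology by blast

lemma sets_mu_open: "sets \<mu> = sigma_sets (odometer_space G) {U. openin (odometer_topology G) U}"
  using haar openin_subset_odometer unfolding odometer_haar_measure_def
  by (subst (asm) sets_measure_of) auto

lemma space_mu: "space \<mu> = odometer_space G"
proof -
  have "sets \<mu> = sets (sigma (odometer_space G) {U. openin (odometer_topology G) U})"
    using haar by (simp add: odometer_haar_measure_def)
  then have "space \<mu> = space (sigma (odometer_space G) {U. openin (odometer_topology G) U})"
    by (rule sets_eq_imp_space_eq)
  then show ?thesis by (simp add: space_measure_of_conv)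
qed

lemma cyl_sets [measurable]: "cyl j c \<in> sets \<mu>"
  unfolding sets_mu_open using openin_cyl by (intro sigma_sets.Basic) auto

text \<open>
  There are only countably many cylinders, so every open set is a countable union of cylinders.
\<close>

lemma sets_mu: "sets \<mu> = sigma_sets (odometer_space G) {cyl j c | j c. True}"
proof
  show "sets \<mu> \<subseteq> sigma_sets (odometer_space G) {cyl j c | j c. True}"
    unfolding sets_mu_open
  proof (rule sigma_sets_mono, rule subsetI)
    fix U assume "U \<in> {U. openin (odometer_topology G) U}"
    then have U: "openin (odometer_topology G) U" by simp
    define I where "I = {(j, c). c \<in> range (zcoset (G j)) \<and> cyl j c \<subseteq> U}"
    have "countable I"
      by (rule countable_subset[of _ "Sigma UNIV (\<lambda>j. range (zcoset (G j)))"])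
         (use finite_cosets in \<open>auto simp: I_def intro!: countable_SIGMA countable_finite\<close>)
    moreover have "U = (\<Union>p\<in>I. cyl (fst p) (snd p))"
    proof (intro Set.set_eqI iffI)
      fix x assume x: "x \<in> U"
      obtain j where j: "cyl j (x j) \<subseteq> U" using open_contains_cyl[OF U x] by blast
      have xO: "x \<in> odometer_space G" using x openin_subset_odometer[OF U] by blast
      then have "(j, x j) \<in> I" using j odometer_coord[OF xO, of j] by (auto simp: I_def)
      moreover have "x \<in> cyl j (x j)" using xO by (simp add: cyl_def)
      ultimately show "x \<in> (\<Union>p\<in>I. cyl (fst p) (snd p))" by force
    qed (auto simp: I_def)
    ultimately show "U \<in> sigma_sets (odometer_space G) {cyl j c | j c. True}"
      using sigma_sets_UNION[of "(\<lambda>p. cyl (fst p) (snd p)) ` I" "odometer_space G" "{cyl j c | j c. True}"]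
      by (fastforce intro: sigma_sets.Basic)
  qed
  show "sigma_sets (odometer_space G) {cyl j c | j c. True} \<subseteq> sets \<mu>"
  proof -
    have "{cyl j c | j c. True} \<subseteq> sets \<mu>" by auto
    from sets.sigma_sets_subset[OF this] show ?thesis by (simp add: space_mu)
  qed
qed

lemma measurable_into_mu:
  assumes "\<And>x. x \<in> space P \<Longrightarrow> f x \<in> odometer_space G"
    and "\<And>j c. {x \<in> space P. f x j = c} \<in> sets P"
  shows "f \<in> measurable P \<mu>"
proof (rule measurable_sigma_sets[OF sets_mu])
  show "f -` A \<inter> space P \<in> sets P" if cylA: "A \<in> {cyl j c | j c. True}" for A
  proof -
    obtain j c where A: "A = cyl j c" using cylA by auto
    have "f -` A \<inter> space P = {x \<in> space P. f x j = c}" using assms(1) by (auto simp: A cyl_def)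
    then show ?thesis using assms(2) by simp
  qed
qed (use assms(1) in \<open>auto simp: cyl_def\<close>)

lemma measurable_odometer_action: "odometer_action G v \<in> measurable \<mu> \<mu>"
proof (rule measurable_into_mu)
  fix j c
  have "{x \<in> space \<mu>. odometer_action G v x j = c} =
     (\<Union>d\<in>{zcoset (G j) u |u. zcoset (G j) (u + v) = c}. cyl j d)"
  proof (intro Set.set_eqI iffI)
    fix x assume x: "x \<in> {x \<in> space \<mu>. odometer_action G v x j = c}"
    then obtain u where "x j = zcoset (G j) u" using odometer_coord[of x j] by (auto simp: space_mu)
    then show "x \<in> (\<Union>d\<in>{zcoset (G j) u |u. zcoset (G j) (u + v) = c}. cyl j d)"
      using x odometer_action_coord[of x j u v] by (auto simp: cyl_def space_mu)
  qed (auto simp: cyl_def space_mu odometer_action_coord)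
  moreover have "finite {zcoset (G j) u |u. zcoset (G j) (u + v) = c}"
    by (rule finite_subset[OF _ finite_cosets[of j]]) auto
  ultimately show "{x \<in> space \<mu>. odometer_action G v x j = c} \<in> sets \<mu>"
    by (auto intro!: sets.finite_UN)
qed (simp add: space_mu odometer_action_in)

lemma distr_odometer_action: "distr \<mu> \<mu> (odometer_action G v) = \<mu>"
  using haar by (simp add: odometer_haar_measure_def)

end

text \<open>
  Translations permute the cosets transitively.
\<close>

lemma (in prob_space) uniform_on_cosets:
  fixes p :: "'a \<Rightarrow> (int ^ 'd::finite) set"
  assumes fin: "finite (range (zcoset H))"
    and p: "AE x in M. p x \<in> range (zcoset H)"
    and meas: "\<And>c. {x \<in> space M. p x = c} \<in> sets M"
    and inv: "\<And>u v. measure M {x \<in> space M. p x = zcoset H (u + v)} = measure M {x \<in> space M. p x = zcoset H u}"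
  shows "measure M {x \<in> space M. p x = zcoset H u} = 1 / card (range (zcoset H))"
proof -
  have all: "measure M {x \<in> space M. p x = c} = measure M {x \<in> space M. p x = zcoset H u}"
    if "c \<in> range (zcoset H)" for c
  proof -
    obtain w where "c = zcoset H w" using \<open>c \<in> range (zcoset H)\<close> by blast
    then show ?thesis using inv[of u "w - u"] by simp
  qed
  have un: "{x \<in> space M. p x \<in> range (zcoset H)} = (\<Union>c\<in>range (zcoset H). {x \<in> space M. p x = c})" by auto
  have "1 = measure M {x \<in> space M. p x \<in> range (zcoset H)}"
    by (rule sym, subst prob_eq_1) (use p un fin meas in \<open>auto\<close>)
  also have "\<dots> = (\<Sum>c\<in>range (zcoset H). measure M {x \<in> space M. p x = c})"
    unfolding un using fin meas
    by (intro finite_measure_finite_Union) (auto simp: disjoint_family_on_def)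
  also have "\<dots> = (\<Sum>c\<in>range (zcoset H). measure M {x \<in> space M. p x = zcoset H u})"
    by (intro sum.cong refl all)
  finally have eq: "card (range (zcoset H)) * measure M {x \<in> space M. p x = zcoset H u} = 1" by simp
  then have "real (card (range (zcoset H))) \<noteq> 0" by (metis mult_zero_left zero_neq_one)
  then show ?thesis using eq by (simp add: field_simps)
qed

context odometer_haar
begin

lemma measure_cyl: "measure \<mu> (cyl j (zcoset (G j) u)) = 1 / card (range (zcoset (G j)))"
proof -
  have cy: "cyl j c = {x \<in> space \<mu>. x j = c}" for c by (simp add: cyl_def space_mu)
  have "measure \<mu> {x \<in> space \<mu>. x j = zcoset (G j) u} = 1 / card (range (zcoset (G j)))"
  proof (rule mu.uniform_on_cosets[OF finite_cosets])
    show "AE x in \<mu>. x j \<in> range (zcoset (G j))"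
      by (rule AE_I2) (use odometer_coord in \<open>auto simp: space_mu image_iff\<close>)
    show "{x \<in> space \<mu>. x j = c} \<in> sets \<mu>" for c using cyl_sets[of j c] by (simp add: cy)
    fix u v
    have "measure \<mu> (cyl j (zcoset (G j) (u + v))) =
       measure \<mu> (odometer_action G v -` cyl j (zcoset (G j) (u + v)) \<inter> space \<mu>)"
      using measure_distr[OF measurable_odometer_action cyl_sets, of v j "zcoset (G j) (u + v)"]
      by (simp add: distr_odometer_action)
    also have "odometer_action G v -` cyl j (zcoset (G j) (u + v)) \<inter> space \<mu> = cyl j (zcoset (G j) u)"
    proof (intro Set.set_eqI)
      fix x
      show "x \<in> odometer_action G v -` cyl j (zcoset (G j) (u + v)) \<inter> space \<mu> \<longleftrightarrow> x \<in> cyl j (zcoset (G j) u)"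
      proof (cases "x \<in> odometer_space G")
        case True
        then obtain w where w: "x j = zcoset (G j) w" using odometer_coord by blast
        show ?thesis
          using True odometer_action_in[OF True, of v] odometer_action_coord[of x j w v, OF w] w
          by (simp add: cyl_def space_mu zcoset_G_eq_iff)
      qed (simp add: cyl_def space_mu)
    qed
    finally show "measure \<mu> {x \<in> space \<mu>. x j = zcoset (G j) (u + v)} = measure \<mu> {x \<in> space \<mu>. x j = zcoset (G j) u}"
      by (simp add: cy)
  qed
  then show ?thesis by (simp add: cy)
qed

text \<open>
  Any two cylinders are disjoint or nested, so the cylinders are a generator closed under
  intersection, and equivariance determines the measure of each cylinder. This is unique
  ergodicity of the odometer in the form needed for labels.
\<close>

lemma distr_eq_mu:
  assumes P: "prob_space P" and f: "f \<in> measurable P \<mu>"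
    and inv: "\<And>j u v. measure P {x \<in> space P. f x j = zcoset (G j) (u + v)} =
                measure P {x \<in> space P. f x j = zcoset (G j) u}"
  shows "distr P \<mu> f = \<mu>"
proof (rule measure_eqI_generator_eq[where E = "{{}, odometer_space G} \<union> {cyl j c | j c. True}"
        and \<Omega> = "odometer_space G" and A = "\<lambda>_. odometer_space G"])
  interpret P: prob_space P by (rule P)
  interpret D: prob_space "distr P \<mu> f" by (rule P.prob_space_distr[OF f])
  have fO: "f x \<in> odometer_space G" if "x \<in> space P" for x
    using measurable_space[OF f that] by (simp add: space_mu)
  have pre: "f -` cyl j c \<inter> space P = {x \<in> space P. f x j = c}" for j c
    using fO by (auto simp: cyl_def)
  have meas: "{x \<in> space P. f x j = c} \<in> sets P" for j c
    using measurable_sets[OF f cyl_sets[of j c]] by (simp add: pre)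
  have fcoset: "f x j \<in> range (zcoset (G j))" if "x \<in> space P" for x j
    using odometer_coord[OF fO[OF that], of j] by auto
  have cyl_subset_or_disjoint: "cyl j c \<inter> cyl k d = {} \<or> cyl j c \<inter> cyl k d = cyl k d" if "j \<le> k" for j k c d
  proof (cases "cyl j c \<inter> cyl k d = {}")
    case False
    then obtain x where x: "x \<in> odometer_space G" "x j = c" "x k = d" by (auto simp: cyl_def)
    obtain v where v: "x k = zcoset (G k) v" using odometer_coord[OF x(1)] by blast
    have "y j = c" if "y \<in> odometer_space G" "y k = d" for y
      using odometer_coord_le[OF x(1) \<open>j \<le> k\<close> v] odometer_coord_le[OF that(1) \<open>j \<le> k\<close>, of v] that x v by simp
    then show ?thesis by (auto simp: cyl_def)
  qed simp
  show "Int_stable ({{}, odometer_space G} \<union> {cyl j c | j c. True})"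
  proof (rule Int_stableI)
    fix a b assume ab: "a \<in> {{}, odometer_space G} \<union> {cyl j c | j c. True}"
      "b \<in> {{}, odometer_space G} \<union> {cyl j c | j c. True}"
    have sub: "cyl j c \<subseteq> odometer_space G" for j c by (auto simp: cyl_def)
    have cc: "cyl j c \<inter> cyl k d \<in> {{}, odometer_space G} \<union> {cyl j c | j c. True}" for j c k d
    proof (cases "j \<le> k")
      case True
      then show ?thesis using cyl_subset_or_disjoint[OF True, of c d] by auto
    next
      case False
      then show ?thesis using cyl_subset_or_disjoint[of k j d c] by (auto simp: Int_commute)
    qed
    consider "a = {} \<or> b = {}" | "a = odometer_space G" | "b = odometer_space G" | j c k d where "a = cyl j c" "b = cyl k d"
      using ab by blast
    then show "a \<inter> b \<in> {{}, odometer_space G} \<union> {cyl j c | j c. True}"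
    proof cases
      case 2
      have "b \<subseteq> odometer_space G" using ab(2) sub by auto
      then have "a \<inter> b = b" using 2 by blast
      then show ?thesis using ab(2) by simp
    next
      case 3
      have "a \<subseteq> odometer_space G" using ab(1) sub by auto
      then have "a \<inter> b = a" using 3 by blast
      then show ?thesis using ab(1) by simp
    next
      case 4 then show ?thesis using cc by simp
    qed auto
  qed
  have gen: "sigma_sets (odometer_space G) ({{}, odometer_space G} \<union> {cyl j c | j c. True}) = sets \<mu>"
  proof
    show "sigma_sets (odometer_space G) ({{}, odometer_space G} \<union> {cyl j c | j c. True}) \<subseteq> sets \<mu>"
    proof -
      have "{{}, odometer_space G} \<union> {cyl j c | j c. True} \<subseteq> sets \<mu>"
        using sets.top[of \<mu>] by (auto simp: space_mu)
      from sets.sigma_sets_subset[OF this] show ?thesis by (simp add: space_mu)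
    qed
    show "sets \<mu> \<subseteq> sigma_sets (odometer_space G) ({{}, odometer_space G} \<union> {cyl j c | j c. True})"
      unfolding sets_mu by (rule sigma_sets_mono') auto
  qed
  show "sets (distr P \<mu> f) = sigma_sets (odometer_space G) ({{}, odometer_space G} \<union> {cyl j c | j c. True})"
    by (rule trans[OF sets_distr gen[symmetric]])
  show "sets \<mu> = sigma_sets (odometer_space G) ({{}, odometer_space G} \<union> {cyl j c | j c. True})"
    by (rule gen[symmetric])
  fix W assume "W \<in> {{}, odometer_space G} \<union> {cyl j c | j c. True}"
  then consider "W = {}" | "W = odometer_space G" | j c where "W = cyl j c" by blast
  then show "emeasure (distr P \<mu> f) W = emeasure \<mu> W"
  proof cases
    case 2
    then show ?thesis using D.emeasure_space_1 mu.emeasure_space_1 by (simp add: space_mu)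
  next
    case 3
    show ?thesis
    proof (cases "c \<in> range (zcoset (G j))")
      case True
      then obtain u where u: "c = zcoset (G j) u" by blast
      have "measure P {x \<in> space P. f x j = zcoset (G j) u} = 1 / card (range (zcoset (G j)))"
        by (rule P.uniform_on_cosets[OF finite_cosets _ meas inv]) (use fcoset in auto)
      then have "measure (distr P \<mu> f) W = measure \<mu> W"
        using measure_distr[OF f cyl_sets, of j c] measure_cyl[of j u] by (simp add: pre u 3)
      then show ?thesis by (simp add: D.emeasure_eq_measure mu.emeasure_eq_measure)
    next
      case False
      then have "cyl j c = {}" using cyl_nonempty_coset by blast
      then show ?thesis by (simp add: 3)
    qed
  qed simp
qed (auto simp: cyl_def space_mu prob_space.emeasure_space_1 range_subsetD
      mu.emeasure_space_1[unfolded space_mu]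
      prob_space.emeasure_space_1[OF prob_space.prob_space_distr[OF P f], unfolded space_distr space_mu])

end

section \<open>Lebesgue spaces and odometers as images of compact-regular measures\<close>

lemma inner_compact_restrict:
  assumes N: "inner_compact N" and O: "\<Omega> \<in> sets N" "measure N \<Omega> = 1"
  shows "inner_compact (restrict_space N \<Omega>)"
proof -
  interpret prob_space N using N by (simp add: inner_compact_def)
  have OS: "\<Omega> \<inter> space N \<in> sets N" using O(1) by simp
  have sub: "\<Omega> \<subseteq> space N" using O(1) by (rule sets.sets_into_space)
  have "prob_space (restrict_space N \<Omega>)"
    by (rule prob_spaceI)
       (use O sub emeasure_restrict_space[OF OS, of \<Omega>] emeasure_eq_measure in \<open>simp add: space_restrict_space Int_absorb2\<close>)
  moreover have "\<exists>K. compact K \<and> K \<subseteq> A \<and> K \<in> sets (restrict_space N \<Omega>) \<and> measure (restrict_space N \<Omega>) (A - K) < e"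
    if A: "A \<in> sets (restrict_space N \<Omega>)" and e: "e > 0" for A e
  proof -
    have A': "A \<subseteq> \<Omega>" "A \<in> sets N" using A sets_restrict_space_iff[OF OS] by auto
    obtain K where K: "compact K" "K \<subseteq> A" "K \<in> sets N" "measure N (A - K) < e"
      by (rule inner_compactE[OF N A'(2) e])
    moreover have "measure (restrict_space N \<Omega>) (A - K) = measure N (A - K)"
      by (rule measure_restrict_space[OF OS]) (use A'(1) in auto)
    ultimately show ?thesis
      using A'
      by (intro exI[of _ K]) (auto simp: sets_restrict_space_iff[OF OS])
  qed
  ultimately show ?thesis unfolding inner_compact_def by blast
qed

lemma inner_compact_polish:
  fixes Y :: "'b::polish_space measure"
  assumes "prob_space Y" and sb: "sets Y = sets borel"
  shows "inner_compact Y"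
proof -
  interpret prob_space Y by fact
  have "\<exists>K. compact K \<and> K \<subseteq> A \<and> K \<in> sets Y \<and> measure Y (A - K) < e"
    if A: "A \<in> sets Y" and e: "e > 0" for A e
  proof (cases "measure Y A < e")
    case True
    then show ?thesis by (intro exI[of _ "{}"]) simp
  next
    case False
    then have "ennreal (measure Y A - e) < emeasure Y A"
      using e by (simp add: emeasure_eq_measure ennreal_less_iff)
    also have "emeasure Y A = (SUP K \<in> {K. K \<subseteq> A \<and> compact K}. emeasure Y K)"
      by (rule inner_regular[OF sb]) (use A sb in auto)
    finally obtain K where K: "K \<subseteq> A" "compact K" "ennreal (measure Y A - e) < emeasure Y K"
      unfolding less_SUP_iff by blast
    have KS: "K \<in> sets Y" using borel_compact[OF K(2)] sb by simp
    have "measure Y A - e < measure Y K"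
      using K(3) False by (simp add: emeasure_eq_measure ennreal_less_iff)
    then have "measure Y (A - K) < e" using finite_measure_Diff[OF A KS K(1)] by simp
    then show ?thesis using K KS by blast
  qed
  then show ?thesis unfolding inner_compact_def using assms(1) by blast
qed

lemma inner_compact_lebesgue_unit: "inner_compact (lebesgue_on {0..1::real})"
proof -
  have OS: "{0..1::real} \<inter> space lebesgue \<in> sets lebesgue" by simp
  have "prob_space (lebesgue_on {0..1::real})"
    by (rule prob_spaceI) (simp add: emeasure_restrict_space)
  moreover have "\<exists>K. compact K \<and> K \<subseteq> A \<and> K \<in> sets (lebesgue_on {0..1}) \<and> measure (lebesgue_on {0..1}) (A - K) < e"
    if A: "A \<in> sets (lebesgue_on {0..1::real})" and e: "e > 0" for A e
  proof -
    have A': "A \<subseteq> {0..1}" "A \<in> sets lebesgue" using A sets_restrict_space_iff[OF OS] by auto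
    obtain K where K: "closed K" "K \<subseteq> A" "A - K \<in> lmeasurable" "emeasure lebesgue (A - K) < ennreal e"
      by (rule sets_lebesgue_inner_closed[OF A'(2) e])
    have "bounded K" using K(2) A'(1) bounded_subset[of "{0..1}" K] by auto
    then have "compact K" using K(1) by (simp add: compact_eq_bounded_closed)
    moreover have "K \<in> sets lebesgue" using K(1) by (simp add: borel_closed)
    moreover have "measure lebesgue (A - K) < e"
      using K(3,4) e by (simp add: emeasure_eq_measure2 ennreal_less_iff)
    moreover have "measure (lebesgue_on {0..1}) (A - K) = measure lebesgue (A - K)"
      by (rule measure_restrict_space[OF OS]) (use A'(1) in auto)
    ultimately show ?thesis
      using A' K(2)
      by (intro exI[of _ K]) (auto simp: sets_restrict_space_iff[OF OS])
  qed
  ultimately show ?thesis unfolding inner_compact_def by blast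
qed

text \<open>
  The compact sets found for Lebesgue measure are Borel sets.
\<close>

lemma inner_compact_borel_unit: "inner_compact (restrict_space lborel {0..1::real})"
proof -
  have OS: "{0..1::real} \<inter> space lborel \<in> sets lborel" by simp
  have "prob_space (restrict_space lborel {0..1::real})"
    by (rule prob_spaceI) (simp add: emeasure_restrict_space)
  moreover have "\<exists>K. compact K \<and> K \<subseteq> A \<and> K \<in> sets (restrict_space lborel {0..1}) \<and> measure (restrict_space lborel {0..1}) (A - K) < e"
    if A: "A \<in> sets (restrict_space lborel {0..1::real})" and e: "e > 0" for A e
  proof -
    have A': "A \<subseteq> {0..1}" "A \<in> sets lborel" using A sets_restrict_space_iff[OF OS] by auto
    have "A \<in> sets (lebesgue_on {0..1})"
      using A' by (auto simp: sets_restrict_space_iff)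
    then obtain K where K: "compact K" "K \<subseteq> A" "measure (lebesgue_on {0..1}) (A - K) < e"
      by (rule inner_compactE[OF inner_compact_lebesgue_unit _ e])
    have KS: "K \<in> sets lborel" using K(1) by (simp add: borel_compact)
    have "measure (restrict_space lborel {0..1}) (A - K) = measure lborel (A - K)"
      by (rule measure_restrict_space[OF OS]) (use A'(1) in auto)
    also have "\<dots> = measure lebesgue (A - K)" using A' KS by (intro measure_completion[symmetric]) auto
    also have "\<dots> = measure (lebesgue_on {0..1}) (A - K)"
      by (rule measure_restrict_space[symmetric]) (use A'(1) in auto)
    finally show ?thesis
      using A' K KS by (intro exI[of _ K]) (auto simp: sets_restrict_space_iff[OF OS])
  qed
  ultimately show ?thesis unfolding inner_compact_def by blast
qed

text \<open>
  This is what passes from statements about sets, modulo null sets, to injectivity at points.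
\<close>

definition countably_separated :: "'p measure \<Rightarrow> bool" where
  "countably_separated P \<longleftrightarrow> (\<exists>S :: nat \<Rightarrow> 'p set. \<exists>Z\<in>null_sets P. range S \<subseteq> sets P \<and>
     (\<forall>x\<in>space P - Z. \<forall>y\<in>space P - Z. (\<forall>n. x \<in> S n \<longleftrightarrow> y \<in> S n) \<longrightarrow> x = y))"

text \<open>
  The inverse isomorphism parametrises \<open>M\<close>, and the preimages of half-lines with rational end
  points separate its points.
\<close>

lemma isomorphic_mod_0_model:
  fixes N :: "real measure"
  assumes iso: "isomorphic_mod_0 M N" and N: "inner_compact N"
    and half: "\<And>q. {x \<in> space N. x < q} \<in> sets N"
  shows "(\<exists>Y (g :: real \<Rightarrow> _). compact_model M Y g) \<and> countably_separated M"
proof -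
  obtain A B f g where A: "A \<in> null_sets M" and B: "B \<in> null_sets N" and
    fg: "let M' = restrict_space M (space M - A); N' = restrict_space N (space N - B) in
        f \<in> measurable M' N' \<and> g \<in> measurable N' M' \<and>
        (\<forall>x \<in> space M'. g (f x) = x) \<and> (\<forall>y \<in> space N'. f (g y) = y) \<and>
        distr M' N' f = N'"
    using iso unfolding isomorphic_mod_0_def by blast
  define M' where "M' = restrict_space M (space M - A)"
  define N' where "N' = restrict_space N (space N - B)"
  have f: "f \<in> measurable M' N'" and g: "g \<in> measurable N' M'"
    and gf: "\<And>x. x \<in> space M' \<Longrightarrow> g (f x) = x" and d: "distr M' N' f = N'"
    using fg unfolding M'_def N'_def Let_def by auto
  interpret N: prob_space N using N by (simp add: inner_compact_def)
  have MS: "(space M - A) \<inter> space M \<in> sets M" using A by auto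
  have spM': "space M' = space M - A" by (auto simp: M'_def space_restrict_space)
  have "measure N (space N - B) = 1"
    using B N.prob_compl[of B] by (auto simp: null_sets_def measure_def)
  then have icN': "inner_compact N'" unfolding N'_def
    by (intro inner_compact_restrict[OF N]) (use B in auto)
  have gM: "g \<in> measurable N' M"
    using g unfolding M'_def by (simp add: measurable_restrict_space2_iff)
  have "distr N' M g = M"
  proof (rule measure_eqI)
    fix S assume "S \<in> sets (distr N' M g)"
    then have S: "S \<in> sets M" by simp
    have "emeasure (distr N' M g) S = emeasure N' (g -` S \<inter> space N')" by (rule emeasure_distr[OF gM S])
    also have "\<dots> = emeasure (distr M' N' f) (g -` S \<inter> space N')" by (simp add: d)
    also have "\<dots> = emeasure M' (f -` (g -` S \<inter> space N') \<inter> space M')"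
      by (rule emeasure_distr[OF f]) (rule measurable_sets[OF gM S])
    also have "f -` (g -` S \<inter> space N') \<inter> space M' = S - A"
      using gf measurable_space[OF f] sets.sets_into_space[OF S] by (auto simp: spM')
    also have "emeasure M' (S - A) = emeasure M (S - A)" unfolding M'_def
      by (rule emeasure_restrict_space[OF MS]) (use sets.sets_into_space[OF S] in auto)
    also have "\<dots> = emeasure M S" by (rule emeasure_Diff_null_set[OF A S])
    finally show "emeasure (distr N' M g) S = emeasure M S" .
  qed simp
  then have model: "compact_model M N' g" using icN' gM by (simp add: compact_model_def)
  obtain q :: "nat \<Rightarrow> rat" where q: "surj q" using surj_from_nat by blast
  define S where "S n = f -` {x \<in> space N'. x < of_rat (q n)} \<inter> space M'" for n
  have "{x \<in> space N'. x < r} \<in> sets N'" for r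
    unfolding N'_def sets_restrict_space space_restrict_space
    by (rule image_eqI[OF _ half[of r]]) auto
  then have "S n \<in> sets M'" for n unfolding S_def by (intro measurable_sets[OF f])
  then have SM: "S n \<in> sets M" for n unfolding M'_def sets_restrict_space_iff[OF MS] by blast
  have "x = y" if xy: "x \<in> space M - A" "y \<in> space M - A" "\<forall>n. x \<in> S n \<longleftrightarrow> y \<in> S n" for x y
  proof -
    have *: "f x < of_rat r \<longleftrightarrow> f y < of_rat r" for r
    proof -
      obtain n where "q n = r" using q by (metis surjD)
      then show ?thesis using xy measurable_space[OF f, of x] measurable_space[OF f, of y]
        by (auto simp: S_def spM')
    qed
    have "f x = f y"
    proof (rule ccontr)
      assume "f x \<noteq> f y"
      then have "min (f x) (f y) < max (f x) (f y)" by linarith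
      then obtain r where r: "min (f x) (f y) < of_rat r" "of_rat r < max (f x) (f y)"
        using of_rat_dense by blast
      then show False using *[of r] by linarith
    qed
    then have "g (f x) = g (f y)" by simp
    then show "x = y" using gf[of x] gf[of y] xy(1,2) by (simp add: spM')
  qed
  then have "countably_separated M"
    unfolding countably_separated_def using A SM by (intro exI[of _ S] bexI[of _ A]) auto
  then show ?thesis using model by blast
qed

lemma finite_uniform_space_model:
  assumes "finite_uniform_space M"
  shows "(\<exists>Y (g :: real \<Rightarrow> _). compact_model M Y g) \<and> countably_separated M"
proof -
  define S where "S = space M"
  have S: "finite S" "S \<noteq> {}" and M: "M = uniform_count_measure S"
    using assms by (auto simp: finite_uniform_space_def S_def)
  define t where "t x = real (to_nat_on S x)" for x
  have inj: "inj_on t S"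
    using inj_on_to_nat_on[OF countable_finite[OF S(1)]] by (auto simp: inj_on_def t_def)
  define Y where "Y = uniform_count_measure (t ` S)"
  define g where "g = inv_into S t"
  have setsY: "sets Y = Pow (t ` S)" and spY: "space Y = t ` S"
    by (auto simp: Y_def sets_uniform_count_measure space_uniform_count_measure)
  have setsM: "sets M = Pow S" and spM: "space M = S"
    by (auto simp: M sets_uniform_count_measure space_uniform_count_measure)
  have "prob_space Y" unfolding Y_def by (rule prob_space_uniform_count_measure) (use S in auto)
  then have "inner_compact Y"
    unfolding inner_compact_def setsY
  proof (intro conjI ballI allI impI)
    fix A and e :: real assume "A \<in> Pow (t ` S)" "e > 0"
    then show "\<exists>K. compact K \<and> K \<subseteq> A \<and> K \<in> Pow (t ` S) \<and> measure Y (A - K) < e"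
      using finite_subset[OF _ finite_imageI[OF S(1)], of A]
      by (intro exI[of _ A]) (simp add: finite_imp_compact)
  qed
  moreover have g: "g \<in> measurable Y M"
    by (rule measurableI) (auto simp: setsM spM setsY spY g_def inj)
  moreover have "distr Y M g = M"
  proof (rule measure_eqI)
    fix W assume "W \<in> sets (distr Y M g)"
    then have W: "W \<in> sets M" "W \<subseteq> S" by (auto simp: setsM)
    have "emeasure (distr Y M g) W = emeasure Y (g -` W \<inter> space Y)" by (rule emeasure_distr[OF g W(1)])
    also have "g -` W \<inter> space Y = t ` W" using W(2) inj by (auto simp: spY g_def)
    also have "emeasure Y (t ` W) = card (t ` W) / card (t ` S)"
      unfolding Y_def by (rule emeasure_uniform_count_measure) (use S W in auto)
    also have "\<dots> = card W / card S" using W(2) inj by (simp add: card_image inj_on_subset)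
    also have "\<dots> = emeasure M W"
      unfolding M by (rule emeasure_uniform_count_measure[symmetric]) (use S W in auto)
    finally show "emeasure (distr Y M g) W = emeasure M W" .
  qed simp
  ultimately have "compact_model M Y g" by (simp add: compact_model_def)
  moreover have "countably_separated M"
    unfolding countably_separated_def
  proof (intro exI bexI conjI ballI impI)
    show "range (\<lambda>n. {x \<in> S. to_nat_on S x = n}) \<subseteq> sets M" by (auto simp: setsM)
    show "{} \<in> null_sets M" by simp
    fix x y assume "x \<in> space M - {}" "y \<in> space M - {}"
      "\<forall>n. x \<in> {x \<in> S. to_nat_on S x = n} \<longleftrightarrow> y \<in> {x \<in> S. to_nat_on S x = n}"
    then show "x = y" using inj by (auto simp: spM inj_on_def t_def)
  qed
  ultimately show ?thesis by blast
qed

lemma lebesgue_or_finite_model: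
  assumes "nonatomic_lebesgue_space M \<or> finite_uniform_space M"
  shows "\<exists>Y (g :: real \<Rightarrow> _). compact_model M Y g" and "countably_separated M"
proof -
  have "(\<exists>Y (g :: real \<Rightarrow> _). compact_model M Y g) \<and> countably_separated M"
    using assms
  proof
    assume "nonatomic_lebesgue_space M"
    then consider "isomorphic_mod_0 M (lebesgue_on {0..1::real})" | "isomorphic_mod_0 M (restrict_space lborel {0..1::real})"
      unfolding nonatomic_lebesgue_space_def by blast
    then show ?thesis
    proof cases
      case 1
      have "{x \<in> space (lebesgue_on {0..1::real}). x < q} \<in> sets (lebesgue_on {0..1::real})" for q
        unfolding sets_restrict_space by (rule image_eqI[of _ _ "{..<q}"]) auto
      then show ?thesis by (rule isomorphic_mod_0_model[OF 1 inner_compact_lebesgue_unit])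
    next
      case 2
      have "{x \<in> space (restrict_space lborel {0..1::real}). x < q} \<in> sets (restrict_space lborel {0..1::real})" for q
        unfolding sets_restrict_space by (rule image_eqI[of _ _ "{..<q}"]) (auto simp: space_restrict_space)
      then show ?thesis by (rule isomorphic_mod_0_model[OF 2 inner_compact_borel_unit])
    qed
  next
    assume "finite_uniform_space M"
    then show ?thesis by (rule finite_uniform_space_model)
  qed
  then show "\<exists>Y (g :: real \<Rightarrow> _). compact_model M Y g" and "countably_separated M" by simp_all
qed

context odometer_haar
begin

text \<open>
  Coding cosets by numbers embeds the odometer in a Polish space of sequences, where finite Borel
  measures are inner regular. The image is closed, because membership is decided by the finite
  sets \<open>R j\<close> of admissible pairs of neighbouring codes.
\<close>

lemma mu_model: "\<exists>Y (g :: (nat \<Rightarrow> real) \<Rightarrow> _). compact_model \<mu> Y g"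
proof -
  define code where "code j c = real (to_nat_on (range (zcoset (G j))) c)" for j c
  have inj: "inj_on (code j) (range (zcoset (G j)))" for j
    using inj_on_to_nat_on[OF countable_finite[OF finite_cosets[of j]]] by (auto simp: inj_on_def code_def)
  define e where "e x j = code j (x j)" for x :: "nat \<Rightarrow> (int ^ 'd) set" and j
  have inje: "inj_on e (odometer_space G)"
  proof (rule inj_onI, rule ext)
    fix x y j assume xy: "x \<in> odometer_space G" "y \<in> odometer_space G" "e x = e y"
    then have "code j (x j) = code j (y j)" by (metis e_def)
    then show "x j = y j"
      using inj_onD[OF inj[of j]] odometer_coord[OF xy(1), of j] odometer_coord[OF xy(2), of j] by auto
  qed
  have em: "e \<in> borel_measurable \<mu>"
  proof (rule measurable_coordinatewise_then_product)
    fix j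
    have "(\<lambda>x. \<Sum>c\<in>range (zcoset (G j)). code j c * indicator (cyl j c) x) \<in> borel_measurable \<mu>"
      by (intro borel_measurable_sum borel_measurable_times borel_measurable_const borel_measurable_indicator cyl_sets)
    also have "?this \<longleftrightarrow> (\<lambda>x. e x j) \<in> borel_measurable \<mu>"
    proof (rule measurable_cong)
      fix x assume "x \<in> space \<mu>"
      then have x: "x \<in> odometer_space G" "x j \<in> range (zcoset (G j))"
        using odometer_coord[of x j] by (auto simp: space_mu)
      have "(\<Sum>c\<in>range (zcoset (G j)). code j c * indicator (cyl j c) x) =
            (\<Sum>c\<in>{x j}. code j c * indicator (cyl j c) x)"
        by (rule sum.mono_neutral_right) (use finite_cosets x in \<open>auto simp: cyl_def indicator_def split: if_splits\<close>)
      then show "(\<Sum>c\<in>range (zcoset (G j)). code j c * indicator (cyl j c) x) = e x j"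
        using x(1) by (simp add: cyl_def e_def)
    qed
    finally show "(\<lambda>x. e x j) \<in> borel_measurable \<mu>" .
  qed
  define R where "R j = (\<lambda>v. (code j (zcoset (G j) v), code (Suc j) (zcoset (G (Suc j)) v))) ` UNIV" for j
  have finR: "finite (R j)" for j
  proof (rule finite_subset)
    show "R j \<subseteq> code j ` range (zcoset (G j)) \<times> code (Suc j) ` range (zcoset (G (Suc j)))"
      by (auto simp: R_def)
    show "finite (code j ` range (zcoset (G j)) \<times> code (Suc j) ` range (zcoset (G (Suc j))))"
      using finite_cosets by blast
  qed
  have image_e: "e ` odometer_space G = {y. \<forall>j. (y j, y (Suc j)) \<in> R j}"
  proof (intro equalityI subsetI)
    fix y assume "y \<in> e ` odometer_space G"
    then obtain x where x: "x \<in> odometer_space G" "y = e x" by blast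
    show "y \<in> {y. \<forall>j. (y j, y (Suc j)) \<in> R j}"
    proof (rule CollectI, rule allI)
      fix j
      obtain v where "x j = zcoset (G j) v" "x (Suc j) = zcoset (G (Suc j)) v"
        using x(1) unfolding odometer_space_iff by blast
      then show "(y j, y (Suc j)) \<in> R j" unfolding x(2) R_def e_def by (intro image_eqI[of _ _ v]) auto
    qed
  next
    fix y assume y: "y \<in> {y. \<forall>j. (y j, y (Suc j)) \<in> R j}"
    define x where "x j = inv_into (range (zcoset (G j))) (code j) (y j)" for j
    have xv: "\<exists>v. x j = zcoset (G j) v \<and> x (Suc j) = zcoset (G (Suc j)) v \<and> y j = code j (x j)" for j
    proof -
      obtain v where "y j = code j (zcoset (G j) v)" "y (Suc j) = code (Suc j) (zcoset (G (Suc j)) v)"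
        using y by (auto simp: R_def)
      then show ?thesis using inv_into_f_f[OF inj] by (intro exI[of _ v]) (auto simp: x_def)
    qed
    then have "x \<in> odometer_space G" unfolding odometer_space_iff by blast
    moreover have "y j = e x j" for j using xv[of j] by (auto simp: e_def)
    then have "y = e x" by (rule ext)
    ultimately show "y \<in> e ` odometer_space G" by blast
  qed
  have cl: "closed {y :: nat \<Rightarrow> real. y i = a \<and> y j = b}" for i j a b
  proof -
    have "{y :: nat \<Rightarrow> real. y i = a \<and> y j = b} = {y. y i = a} \<inter> {y. y j = b}" by auto
    then show ?thesis
      by (auto intro!: closed_Int closed_Collect_eq continuous_intros continuous_on_product_coordinates)
  qed
  have im_borel: "e ` odometer_space G \<in> sets borel"
  proof -
    have "e ` odometer_space G = (\<Inter>j. \<Union>p\<in>R j. {y. y j = fst p \<and> y (Suc j) = snd p})"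
      unfolding image_e by force
    moreover have "closed (\<Inter>j. \<Union>p\<in>R j. {y :: nat \<Rightarrow> real. y j = fst p \<and> y (Suc j) = snd p})"
      by (intro closed_INT ballI closed_UN finR cl)
    ultimately show ?thesis by simp
  qed
  define Y0 where "Y0 = distr \<mu> borel e"
  have pre_im: "e -` (e ` odometer_space G) \<inter> space \<mu> = space \<mu>" by (auto simp: space_mu)
  have "measure Y0 (e ` odometer_space G) = 1"
    unfolding Y0_def using measure_distr[OF em, of "e ` odometer_space G"] im_borel mu.prob_space
    by (simp add: pre_im)
  moreover have "inner_compact Y0"
    unfolding Y0_def by (intro inner_compact_polish mu.prob_space_distr em) simp
  ultimately have ic: "inner_compact (restrict_space Y0 (e ` odometer_space G))"
    using im_borel by (intro inner_compact_restrict) (auto simp: Y0_def)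
  define Y where "Y = restrict_space Y0 (e ` odometer_space G)"
  have spY: "space Y = e ` odometer_space G" by (auto simp: Y_def Y0_def space_restrict_space)
  have OS: "e ` odometer_space G \<inter> space Y0 \<in> sets Y0" using im_borel by (simp add: Y0_def)
  have setsY: "A \<in> sets Y \<longleftrightarrow> A \<subseteq> e ` odometer_space G \<and> A \<in> sets borel" for A
    using sets_restrict_space_iff[OF OS, of A] by (simp add: Y_def Y0_def)
  define g where "g = inv_into (odometer_space G) e"
  have ge: "g (e x) = x" if "x \<in> odometer_space G" for x
    using that inje by (simp add: g_def)
  have gm: "g \<in> measurable Y \<mu>"
  proof (rule measurable_into_mu)
    show "g y \<in> odometer_space G" if "y \<in> space Y" for y using that ge by (auto simp: spY)
    fix j c
    show "{y \<in> space Y. g y j = c} \<in> sets Y"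
    proof (cases "c \<in> range (zcoset (G j))")
      case True
      have "code j (x j) = code j c \<longleftrightarrow> x j = c" if "x \<in> odometer_space G" for x
        using inj_onD[OF inj[of j]] True odometer_coord[OF that, of j] by auto
      then have "{y \<in> space Y. g y j = c} = e ` odometer_space G \<inter> {y. y j = code j c}"
        using ge by (auto simp: spY e_def)
      moreover have "closed {y :: nat \<Rightarrow> real. y j = code j c}"
        using cl[of j "code j c" j "code j c"] by simp
      then have "e ` odometer_space G \<inter> {y. y j = code j c} \<in> sets borel"
        by (intro sets.Int im_borel borel_closed)
      ultimately show ?thesis unfolding setsY by simp
    next
      case False
      then have "g y j \<noteq> c" if "y \<in> space Y" for y
      proof -
        obtain x where x: "x \<in> odometer_space G" "y = e x" using \<open>y \<in> space Y\<close> spY by blast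
        then have "g y j \<in> range (zcoset (G j))" using ge[of x] odometer_coord[OF x(1), of j] by auto
        then show ?thesis using False by blast
      qed
      then have "{y \<in> space Y. g y j = c} = {}" by blast
      then show ?thesis by (simp only: sets.empty_sets)
    qed
  qed
  moreover have "distr Y \<mu> g = \<mu>"
  proof (rule measure_eqI)
    fix S assume "S \<in> sets (distr Y \<mu> g)"
    then have S: "S \<in> sets \<mu>" by simp
    have gS: "g -` S \<inter> space Y \<in> sets Y" by (rule measurable_sets[OF gm S])
    have "emeasure (distr Y \<mu> g) S = emeasure Y (g -` S \<inter> space Y)" by (rule emeasure_distr[OF gm S])
    also have "\<dots> = emeasure Y0 (g -` S \<inter> space Y)"
      unfolding Y_def by (rule emeasure_restrict_space[OF OS]) (auto simp: spY[unfolded Y_def])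
    also have "\<dots> = emeasure \<mu> (e -` (g -` S \<inter> space Y) \<inter> space \<mu>)"
      unfolding Y0_def by (rule emeasure_distr[OF em]) (use gS setsY in blast)
    also have "e -` (g -` S \<inter> space Y) \<inter> space \<mu> = S"
    proof -
      have "g (e x) \<in> S \<longleftrightarrow> x \<in> S" if "x \<in> odometer_space G" for x using ge[OF that] by simp
      then show ?thesis using sets.sets_into_space[OF S] by (auto simp: spY space_mu)
    qed
    finally show "emeasure (distr Y \<mu> g) S = emeasure \<mu> S" .
  qed simp
  ultimately have "compact_model \<mu> Y g" using ic by (simp add: compact_model_def Y_def)
  then show ?thesis by blast
qed

end

section \<open>Stacking towers\<close>

locale stacked_rank_one =
  fixes M :: "'a measure" and T :: "int ^ 'd::finite \<Rightarrow> 'a \<Rightarrow> 'a"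
    and F :: "nat \<Rightarrow> (int ^ 'd) set" and B :: "nat \<Rightarrow> 'a set"
  assumes action: "mp_action M T" and folner: "folner_sequence F" and zero_in_F: "\<And>n. 0 \<in> F n"
    and towers: "rank_one_towers M T F B" and stack: "stacking M T F B"
begin

lemma prob_space_M: "prob_space M"
  using action prob_space_uniform_count_measure
  unfolding mp_action_def nonatomic_lebesgue_space_def finite_uniform_space_def by metis

sublocale prob_space M by (rule prob_space_M)

abbreviation I where "I \<equiv> descendants T F B"

lemma T_meas [measurable]: "T v \<in> measurable M M"
  and T_distr: "distr M M (T v) = M"
  and T_add: "x \<in> space M \<Longrightarrow> T (v + w) x = T v (T w x)"
  and T_zero: "x \<in> space M \<Longrightarrow> T 0 x = x"
  using action by (auto simp: mp_action_def)

lemma T_space: "x \<in> space M \<Longrightarrow> T v x \<in> space M"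
  by (rule measurable_space[OF T_meas])

lemma T_minus: "x \<in> space M \<Longrightarrow> T (- v) (T v x) = x"
  using T_add[of x "- v" v] T_zero[of x] by simp

lemma T_minus': "x \<in> space M \<Longrightarrow> T v (T (- v) x) = x"
  using T_add[of x v "- v"] T_zero[of x] by simp

lemma T_image_eq: "A \<subseteq> space M \<Longrightarrow> T v ` A = {x \<in> space M. T (- v) x \<in> A}"
proof (intro equalityI subsetI)
  fix x assume "A \<subseteq> space M" "x \<in> {x \<in> space M. T (- v) x \<in> A}"
  then show "x \<in> T v ` A" by (intro image_eqI[of _ _ "T (- v) x"]) (auto simp: T_minus')
qed (auto simp: T_minus subset_iff T_space)

lemma T_image_sets: "A \<in> sets M \<Longrightarrow> T v ` A \<in> sets M"
  using sets.sets_into_space[of A M] measurable_sets[OF T_meas, of A "- v"]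
  by (simp add: T_image_eq vimage_def Int_def conj_commute)

lemma measure_T_image: "A \<in> sets M \<Longrightarrow> measure M (T v ` A) = measure M A"
  using sets.sets_into_space[of A M] measure_distr[OF T_meas, of A "- v"]
  by (simp add: T_image_eq T_distr vimage_def Int_def conj_commute)

lemma T_image_image: "A \<subseteq> space M \<Longrightarrow> T v ` (T w ` A) = T (v + w) ` A"
  by (force simp: image_iff T_add subset_iff)

lemma mem_T_image_iff: "A \<subseteq> space M \<Longrightarrow> x \<in> space M \<Longrightarrow> T v x \<in> T v ` A \<longleftrightarrow> x \<in> A"
  by (auto simp: T_image_eq T_minus T_space)

lemma finite_F: "finite (F n)"
  using folner by (simp add: folner_sequence_def)

lemma B_sets [measurable]: "B n \<in> sets M"
  and B_pos: "measure M (B n) > 0"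
  and levels_disjoint_family: "disjoint_family_on (\<lambda>v. T v ` B n) (F n)"
  using towers by (auto simp: rank_one_towers_def tower_def)

lemma B_space: "B n \<subseteq> space M"
  using B_sets by (rule sets.sets_into_space)

lemma level_sets [measurable]: "T v ` B n \<in> sets M"
  by (rule T_image_sets[OF B_sets])

lemma level_space: "T v ` B n \<subseteq> space M"
  using level_sets by (rule sets.sets_into_space)

lemma levels_disjoint: "v \<in> F n \<Longrightarrow> w \<in> F n \<Longrightarrow> v \<noteq> w \<Longrightarrow> T v ` B n \<inter> T w ` B n = {}"
  using levels_disjoint_family by (auto simp: disjoint_family_on_def)

lemma T_zero_image: "A \<subseteq> space M \<Longrightarrow> T 0 ` A = A"
  by (force simp: T_zero subset_iff image_iff)

lemma measure_levels: "V \<subseteq> F n \<Longrightarrow> measure M (\<Union>v\<in>V. T v ` B n) = card V * measure M (B n)"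
  using finite_subset[OF _ finite_F, of V n] levels_disjoint_family
  by (subst finite_measure_finite_Union) (auto simp: measure_T_image disjoint_family_on_def subset_iff)

lemma level_union_of_later_levels:
  assumes "m \<le> n" "v \<in> F m"
  shows "\<exists>V \<subseteq> F n. T v ` B m = (\<Union>w\<in>V. T w ` B n)"
  using assms(1)
proof (induction n rule: dec_induct)
  case base
  then show ?case using assms(2) by (intro exI[of _ "{v}"]) auto
next
  case (step n)
  then obtain V where V: "V \<subseteq> F n" "T v ` B m = (\<Union>w\<in>V. T w ` B n)" by blast
  have "\<forall>w\<in>F n. \<exists>W \<subseteq> F (Suc n). T w ` B n = (\<Union>u\<in>W. T u ` B (Suc n))"
    using stack by (auto simp: stacking_def union_of_levels_def)
  then obtain W where W: "\<And>w. w \<in> F n \<Longrightarrow> W w \<subseteq> F (Suc n)"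
     "\<And>w. w \<in> F n \<Longrightarrow> T w ` B n = (\<Union>u\<in>W w. T u ` B (Suc n))" by metis
  show ?case
    by (rule exI[of _ "\<Union>w\<in>V. W w"]) (use V W in \<open>auto simp: subset_iff\<close>)
qed

lemma I_subset: "I m n \<subseteq> F n" by (auto simp: descendants_def)

lemma finite_I: "finite (I m n)" using finite_subset[OF I_subset finite_F] .

lemma level_subset_B: "i \<in> I m n \<Longrightarrow> T i ` B n \<subseteq> B m" by (auto simp: descendants_def)

lemma B_nonempty: "B n \<noteq> {}" using B_pos[of n] by auto

text \<open>
  The base is level \<open>0\<close> of its own tower, so stacking applies to it. A level of the later tower
  that is not one of its parts is disjoint from all of them.
\<close>

lemma B_union_of_levels:
  assumes "m \<le> n"
  shows "B m = (\<Union>i\<in>I m n. T i ` B n)"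
    and "\<And>i. i \<in> F n \<Longrightarrow> i \<notin> I m n \<Longrightarrow> T i ` B n \<inter> B m = {}"
proof -
  obtain V where V: "V \<subseteq> F n" "T 0 ` B m = (\<Union>w\<in>V. T w ` B n)"
    using level_union_of_later_levels[OF assms zero_in_F] by blast
  then have BV: "B m = (\<Union>w\<in>V. T w ` B n)" using T_zero_image[OF B_space] by simp
  have disj: "T i ` B n \<inter> B m = {}" if "i \<in> F n" "i \<notin> V" for i
    unfolding BV using levels_disjoint[OF that(1)] that V(1) by blast
  have IV: "I m n = V"
  proof (intro equalityI subsetI)
    fix i assume i: "i \<in> I m n"
    then have "T i ` B n \<subseteq> B m" "i \<in> F n" using level_subset_B I_subset by blast+
    then show "i \<in> V" using disj[of i] B_nonempty[of n] by blast
  qed (use V(1) BV in \<open>auto simp: descendants_def\<close>)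
  show "B m = (\<Union>i\<in>I m n. T i ` B n)" using BV IV by simp
  show "T i ` B n \<inter> B m = {}" if "i \<in> F n" "i \<notin> I m n" for i using disj that IV by simp
qed

lemma measure_B: "m \<le> n \<Longrightarrow> measure M (B m) = card (I m n) * measure M (B n)"
  unfolding B_union_of_levels(1)[of m n] by (rule measure_levels[OF I_subset])

lemma card_I_pos: "m \<le> n \<Longrightarrow> card (I m n) > 0"
  using measure_B[of m n] B_pos[of m] by (auto intro: Nat.gr0I)

definition E :: "nat \<Rightarrow> 'a set" where "E n = tower_error M T (F n) (B n)"

lemma E_eq: "E n = space M - (\<Union>v\<in>F n. T v ` B n)"
  by (simp add: E_def tower_error_def)

lemma E_sets [measurable]: "E n \<in> sets M"
  unfolding E_eq using finite_F by (intro sets.Diff sets.finite_UN) auto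

lemma card_F_measure_B: "card (F n) * measure M (B n) = 1 - measure M (E n)"
proof -
  have "(\<Union>v\<in>F n. T v ` B n) \<in> sets M" using finite_F by (intro sets.finite_UN) auto
  then show ?thesis using prob_compl[of "\<Union>v\<in>F n. T v ` B n"] measure_levels[of "F n" n] by (simp add: E_eq)
qed

lemma E_tendsto: "(\<lambda>n. measure M (E n)) \<longlonglongrightarrow> 0"
proof -
  obtain L where L: "\<And>n. union_of_levels T (F n) (B n) (L n)"
    "(\<lambda>n. measure M (sym_diff (L n) (space M))) \<longlonglongrightarrow> 0"
    using towers sets.top[of M] unfolding rank_one_towers_def by blast
  show ?thesis
  proof (rule tendsto_sandwich[OF _ _ tendsto_const L(2)])
    show "\<forall>\<^sub>F n in sequentially. measure M (E n) \<le> measure M (sym_diff (L n) (space M))"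
    proof (rule always_eventually, rule allI, rule finite_measure_mono)
      fix n
      obtain V where V: "V \<subseteq> F n" "L n = (\<Union>v\<in>V. T v ` B n)" using L(1)[of n] by (auto simp: union_of_levels_def)
      show "E n \<subseteq> sym_diff (L n) (space M)" using V by (auto simp: E_eq)
      have "L n \<in> sets M" unfolding V(2) using finite_subset[OF V(1) finite_F] by (intro sets.finite_UN) auto
      then show "sym_diff (L n) (space M) \<in> sets M" by auto
    qed
  qed simp
qed

end

section \<open>Joinings with an odometer\<close>

text \<open>
  The common framework for conjugacies in both directions. A point of \<open>P\<close> has a position \<open>\<alpha>\<close> in
  \<open>M\<close> and a label \<open>\<pi> j\<close> modulo \<open>G j\<close>; here \<open>P\<close> is \<open>M\<close> itself if the factor map goes to the odometer,
  and the odometer if the factor map goes to \<open>M\<close>. Equivariance is recorded on the level of measures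
  only, which suffices because the argument counts measures of parts of levels.
\<close>

locale odometer_joining = stacked_rank_one M T F B + subgroup_chain G + P: prob_space P
  for M :: "'a measure" and T :: "int ^ 'd::finite \<Rightarrow> 'a \<Rightarrow> 'a"
    and F :: "nat \<Rightarrow> (int ^ 'd) set" and B :: "nat \<Rightarrow> 'a set"
    and G :: "nat \<Rightarrow> (int ^ 'd) set" and P :: "'p measure" +
  fixes \<alpha> :: "'p \<Rightarrow> 'a" and \<pi> :: "nat \<Rightarrow> 'p \<Rightarrow> (int ^ 'd) set"
  assumes \<alpha>_meas: "\<alpha> \<in> measurable P M" and \<alpha>_distr: "distr P M \<alpha> = M"
    and \<pi>_meas: "\<And>j c. {x \<in> space P. \<pi> j x = c} \<in> sets P"
    and \<pi>_coset: "\<And>j x. x \<in> space P \<Longrightarrow> \<pi> j x \<in> range (zcoset (G j))"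
    and equivariant: "\<And>A j u v. A \<in> sets M \<Longrightarrow>
       measure P {x \<in> space P. \<alpha> x \<in> T v ` A \<and> \<pi> j x = zcoset (G j) (u + v)} =
       measure P {x \<in> space P. \<alpha> x \<in> A \<and> \<pi> j x = zcoset (G j) u}"
    and coset_approx: "\<And>j c e. e > 0 \<Longrightarrow>
       \<exists>A\<in>sets M. measure P {x \<in> space P. \<not> (\<alpha> x \<in> A \<longleftrightarrow> \<pi> j x = c)} < e"
    and set_approx: "\<And>A e. A \<in> sets M \<Longrightarrow> e > 0 \<Longrightarrow>
       \<exists>k D. measure P {x \<in> space P. \<not> (\<alpha> x \<in> A \<longleftrightarrow> \<pi> k x \<in> D)} < e"
begin

lemma \<alpha>_sets: "A \<in> sets M \<Longrightarrow> {x \<in> space P. \<alpha> x \<in> A} \<in> sets P"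
  using measurable_sets[OF \<alpha>_meas, of A] by (simp add: vimage_def Int_def conj_commute)

lemma measure_\<alpha>: "A \<in> sets M \<Longrightarrow> measure P {x \<in> space P. \<alpha> x \<in> A} = measure M A"
  using measure_distr[OF \<alpha>_meas, of A] by (simp add: \<alpha>_distr vimage_def Int_def conj_commute)

lemma \<pi>_mem_sets: "{x \<in> space P. \<pi> j x \<in> D} \<in> sets P"
proof -
  have "{x \<in> space P. \<pi> j x \<in> D} = (\<Union>c\<in>D \<inter> range (zcoset (G j)). {x \<in> space P. \<pi> j x = c})"
    using \<pi>_coset by auto
  then show ?thesis using finite_cosets[of j] \<pi>_meas by (auto intro!: sets.finite_UN)
qed

lemma joint_sets:
  assumes "A \<in> sets M"
  shows "{x \<in> space P. \<alpha> x \<in> A \<and> \<pi> j x = c} \<in> sets P"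
    and "{x \<in> space P. \<alpha> x \<in> A \<and> \<pi> j x \<noteq> c} \<in> sets P"
    and "{x \<in> space P. \<not> (\<alpha> x \<in> A \<longleftrightarrow> \<pi> j x = c)} \<in> sets P"
    and "{x \<in> space P. \<not> (\<alpha> x \<in> A \<longleftrightarrow> \<pi> j x \<in> D)} \<in> sets P"
proof -
  have eq: "{x \<in> space P. \<alpha> x \<in> A \<and> \<pi> j x = c} = {x \<in> space P. \<alpha> x \<in> A} \<inter> {x \<in> space P. \<pi> j x = c}"
    "{x \<in> space P. \<alpha> x \<in> A \<and> \<pi> j x \<noteq> c} = {x \<in> space P. \<alpha> x \<in> A} - {x \<in> space P. \<pi> j x = c}"
    "{x \<in> space P. \<not> (\<alpha> x \<in> A \<longleftrightarrow> \<pi> j x = c)} = sym_diff {x \<in> space P. \<alpha> x \<in> A} {x \<in> space P. \<pi> j x = c}"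
    "{x \<in> space P. \<not> (\<alpha> x \<in> A \<longleftrightarrow> \<pi> j x \<in> D)} = sym_diff {x \<in> space P. \<alpha> x \<in> A} {x \<in> space P. \<pi> j x \<in> D}"
    by auto
  show "{x \<in> space P. \<alpha> x \<in> A \<and> \<pi> j x = c} \<in> sets P"
    "{x \<in> space P. \<alpha> x \<in> A \<and> \<pi> j x \<noteq> c} \<in> sets P"
    "{x \<in> space P. \<not> (\<alpha> x \<in> A \<longleftrightarrow> \<pi> j x = c)} \<in> sets P"
    "{x \<in> space P. \<not> (\<alpha> x \<in> A \<longleftrightarrow> \<pi> j x \<in> D)} \<in> sets P"
    unfolding eq using \<alpha>_sets[OF assms] \<pi>_meas \<pi>_mem_sets by auto
qed

definition mislabelled :: "'a set \<Rightarrow> nat \<Rightarrow> (int ^ 'd) set \<Rightarrow> real" where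
  "mislabelled A j c = measure P {x \<in> space P. \<alpha> x \<in> A \<and> \<pi> j x \<noteq> c}"

lemma mislabelled_eq:
  assumes "A \<in> sets M"
  shows "mislabelled A j c = measure M A - measure P {x \<in> space P. \<alpha> x \<in> A \<and> \<pi> j x = c}"
proof -
  have "{x \<in> space P. \<alpha> x \<in> A \<and> \<pi> j x \<noteq> c} = {x \<in> space P. \<alpha> x \<in> A} - {x \<in> space P. \<alpha> x \<in> A \<and> \<pi> j x = c}"
    by auto
  then show ?thesis unfolding mislabelled_def
    using P.finite_measure_Diff[OF \<alpha>_sets[OF assms] joint_sets(1)[OF assms, of j c]] measure_\<alpha>[OF assms] by auto
qed

lemma mislabelled_T: "A \<in> sets M \<Longrightarrow> mislabelled (T v ` A) j (zcoset (G j) (u + v)) = mislabelled A j (zcoset (G j) u)"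
  by (simp add: mislabelled_eq T_image_sets measure_T_image equivariant)

lemma measure_\<pi>_pos: "measure P {x \<in> space P. \<pi> j x = zcoset (G j) u} > 0"
proof -
  have "measure P {x \<in> space P. \<pi> j x = zcoset (G j) u} = 1 / card (range (zcoset (G j)))"
  proof (rule P.uniform_on_cosets[OF finite_cosets _ \<pi>_meas])
    show "AE x in P. \<pi> j x \<in> range (zcoset (G j))" by (rule AE_I2) (rule \<pi>_coset)
    fix u v
    have sp: "T v ` space M = space M" using T_image_eq[of "space M" v] T_space by auto
    have "{x \<in> space P. \<alpha> x \<in> space M \<and> \<pi> j x = c} = {x \<in> space P. \<pi> j x = c}" for c
      using measurable_space[OF \<alpha>_meas] by auto
    then show "measure P {x \<in> space P. \<pi> j x = zcoset (G j) (u + v)} = measure P {x \<in> space P. \<pi> j x = zcoset (G j) u}"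
      using equivariant[of "space M" v j u] by (simp add: sp)
  qed
  moreover have "card (range (zcoset (G j))) > 0" using finite_cosets[of j] by (simp add: card_gt_0_iff)
  ultimately show ?thesis by simp
qed

text \<open>
  A union \<open>L m\<close> of levels approximates the set with label \<open>c\<close>. If each of these levels were
  mislabelled on more than a proportion \<open>\<eta>\<close>, so would be \<open>L m\<close>. Some level is therefore almost
  entirely labelled \<open>c\<close>, and translating it back gives the label of the base.
\<close>

lemma base_concentrated:
  assumes "\<eta> > 0"
  shows "\<exists>N. \<forall>m\<ge>N. \<exists>u. mislabelled (B m) j (zcoset (G j) u) \<le> \<eta> * measure M (B m)"
proof -
  let ?c = "zcoset (G j) 0"
  define p where "p = measure P {x \<in> space P. \<pi> j x = ?c}"
  have p: "p > 0" unfolding p_def by (rule measure_\<pi>_pos)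
  \<comment> \<open>Small enough that \<open>2 * \<delta>\<close>, which bounds the mislabelled part of \<open>L m\<close>, is less
    than \<open>\<eta> * (p - 2 * \<delta>)\<close>, where \<open>p - 2 * \<delta>\<close> is a lower bound for the measure of \<open>L m\<close>.\<close>
  define \<delta> where "\<delta> = \<eta> * p / (4 * (1 + \<eta>))"
  have \<delta>: "\<delta> > 0" using p assms by (simp add: \<delta>_def)
  have "2 * \<delta> * (1 + \<eta>) = \<eta> * p / 2" using assms by (simp add: \<delta>_def field_simps)
  moreover have "\<eta> * p / 2 < \<eta> * p" using p assms by simp
  ultimately have \<delta>p: "2 * \<delta> * (1 + \<eta>) < \<eta> * p" by linarith
  obtain A where A: "A \<in> sets M" "measure P {x \<in> space P. \<not> (\<alpha> x \<in> A \<longleftrightarrow> \<pi> j x = ?c)} < \<delta>"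
    using coset_approx[OF \<delta>] by blast
  obtain L where L: "\<And>n. union_of_levels T (F n) (B n) (L n)"
    "(\<lambda>n. measure M (sym_diff (L n) A)) \<longlonglongrightarrow> 0"
    using towers A(1) unfolding rank_one_towers_def by blast
  have "\<forall>\<^sub>F n in sequentially. measure M (sym_diff (L n) A) < \<delta>"
    using order_tendstoD(2)[OF L(2) \<delta>] .
  then obtain N where N: "\<And>n. n \<ge> N \<Longrightarrow> measure M (sym_diff (L n) A) < \<delta>"
    by (auto simp: eventually_sequentially)
  have "\<exists>u. mislabelled (B m) j (zcoset (G j) u) \<le> \<eta> * measure M (B m)" if m: "m \<ge> N" for m
  proof (rule ccontr)
    assume neg: "\<not> ?thesis"
    obtain V where V: "V \<subseteq> F m" "L m = (\<Union>v\<in>V. T v ` B m)" using L(1)[of m] by (auto simp: union_of_levels_def)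
    have finV: "finite V" using finite_subset[OF V(1) finite_F] .
    have LS: "L m \<in> sets M" unfolding V(2) using finV by (intro sets.finite_UN) auto
    have SD: "sym_diff (L m) A \<in> sets M" using LS A(1) by auto
    have "mislabelled (T v ` B m) j ?c > \<eta> * measure M (B m)" for v
      using neg mislabelled_T[OF B_sets, of v m j "- v"] by (simp add: not_le) 
    then have "card V * (\<eta> * measure M (B m)) \<le> (\<Sum>v\<in>V. mislabelled (T v ` B m) j ?c)"
      using sum_bounded_below[of V "\<eta> * measure M (B m)" "\<lambda>v. mislabelled (T v ` B m) j ?c"] by (auto intro: less_imp_le)
    also have "\<dots> = measure P (\<Union>v\<in>V. {x \<in> space P. \<alpha> x \<in> T v ` B m \<and> \<pi> j x \<noteq> ?c})"
      unfolding mislabelled_def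
    proof (rule P.finite_measure_finite_Union[symmetric, OF finV])
      show "(\<lambda>v. {x \<in> space P. \<alpha> x \<in> T v ` B m \<and> \<pi> j x \<noteq> ?c}) ` V \<subseteq> sets P"
        using joint_sets(2)[OF level_sets] by blast
      show "disjoint_family_on (\<lambda>v. {x \<in> space P. \<alpha> x \<in> T v ` B m \<and> \<pi> j x \<noteq> ?c}) V"
        using levels_disjoint V(1) unfolding disjoint_family_on_def by blast
    qed
    also have "\<dots> \<le> measure P ({x \<in> space P. \<alpha> x \<in> sym_diff (L m) A} \<union> {x \<in> space P. \<not> (\<alpha> x \<in> A \<longleftrightarrow> \<pi> j x = ?c)})"
      by (rule P.finite_measure_mono) (use V(2) \<alpha>_sets[OF SD] joint_sets(3)[OF A(1), of j ?c] in auto)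
    also have "\<dots> \<le> measure M (sym_diff (L m) A) + measure P {x \<in> space P. \<not> (\<alpha> x \<in> A \<longleftrightarrow> \<pi> j x = ?c)}"
      using measure_Un_le[OF \<alpha>_sets[OF SD] joint_sets(3)[OF A(1), of j ?c]] measure_\<alpha>[OF SD] by simp
    also have "\<dots> < 2 * \<delta>" using N[OF m] A(2) by simp
    finally have small: "\<eta> * measure M (L m) < 2 * \<delta>"
      using measure_levels[OF V(1)] V(2) by (simp add: mult.commute mult.left_commute)
    have "p \<le> measure P ({x \<in> space P. \<alpha> x \<in> L m} \<union> ({x \<in> space P. \<alpha> x \<in> sym_diff (L m) A} \<union> {x \<in> space P. \<not> (\<alpha> x \<in> A \<longleftrightarrow> \<pi> j x = ?c)}))"
      unfolding p_def
      by (rule P.finite_measure_mono) (use \<alpha>_sets[OF LS] \<alpha>_sets[OF SD] joint_sets(3)[OF A(1), of j ?c] in auto)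
    also have "\<dots> \<le> measure M (L m) + (measure M (sym_diff (L m) A) + measure P {x \<in> space P. \<not> (\<alpha> x \<in> A \<longleftrightarrow> \<pi> j x = ?c)})"
      using measure_\<alpha>[OF SD] measure_\<alpha>[OF LS] \<alpha>_sets[OF LS] \<alpha>_sets[OF SD] joint_sets(3)[OF A(1), of j ?c]
      by (intro order_trans[OF measure_Un_le] add_mono order_trans[OF measure_Un_le]) auto
    finally have "p - 2 * \<delta> \<le> measure M (L m)" using N[OF m] A(2) by simp
    then have "\<eta> * (p - 2 * \<delta>) \<le> \<eta> * measure M (L m)" using assms by simp
    then show False using small \<delta>p by (simp add: algebra_simps)
  qed
  then show ?thesis by blast
qed

text \<open>
  Level \<open>i\<close> inherits from the base that it is labelled \<open>u + i\<close> up to a proportion \<open>\<eta>\<close>. These parts of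
  different levels are disjoint, so \<open>W\<close> has room for only so many of them.
\<close>

lemma levels_with_expected_label_measure:
  assumes u: "mislabelled (B n) j (zcoset (G j) u) \<le> \<eta> * measure M (B n)"
    and V: "V \<subseteq> F n" and W: "W \<in> sets P"
    and sub: "\<And>i. i \<in> V \<Longrightarrow> {x \<in> space P. \<alpha> x \<in> T i ` B n \<and> \<pi> j x = zcoset (G j) (u + i)} \<subseteq> W"
  shows "card V * ((1 - \<eta>) * measure M (B n)) \<le> measure P W"
proof -
  let ?S = "\<lambda>i. {x \<in> space P. \<alpha> x \<in> T i ` B n \<and> \<pi> j x = zcoset (G j) (u + i)}"
  have finV: "finite V" using finite_subset[OF V finite_F] .
  have "(1 - \<eta>) * measure M (B n) \<le> measure P (?S i)" for i
    using u equivariant[OF B_sets, of i n j u] by (simp add: mislabelled_eq algebra_simps)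
  then have "card V * ((1 - \<eta>) * measure M (B n)) \<le> (\<Sum>i\<in>V. measure P (?S i))"
    using sum_bounded_below[of V "(1 - \<eta>) * measure M (B n)" "\<lambda>i. measure P (?S i)"] by simp
  also have "\<dots> = measure P (\<Union>i\<in>V. ?S i)"
  proof (rule P.finite_measure_finite_Union[symmetric, OF finV])
    show "?S ` V \<subseteq> sets P" using joint_sets(1)[OF level_sets] by blast
    show "disjoint_family_on ?S V"
      using levels_disjoint V unfolding disjoint_family_on_def by blast
  qed
  also have "\<dots> \<le> measure P W"
    by (rule P.finite_measure_mono) (use sub W in auto)
  finally show ?thesis .
qed

text \<open>
  Let \<open>u\<close> and \<open>w\<close> be the dominant labels of \<open>B m\<close> and \<open>B n\<close>. A descendant \<open>i\<close> that is not congruent to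
  \<open>u - w\<close> puts most of a level into the mislabelled part of \<open>B m\<close>.
\<close>

lemma descendants_in_one_coset:
  assumes "\<epsilon> > (0::real)"
  shows "\<exists>N. \<forall>m n. n \<ge> m \<and> m \<ge> N \<longrightarrow>
      (\<exists>g. real (card {i \<in> I m n. i - g \<notin> G j}) / real (card (I m n)) < \<epsilon>)"
proof -
  \<comment> \<open>The exceptional proportion will be at most \<open>\<eta> / (1 - \<eta>)\<close>, which is at most \<open>2 * \<eta>\<close> for \<open>\<eta> \<le> 1/2\<close>.\<close>
  define \<eta> where "\<eta> = min (1/2) (\<epsilon> / 4)"
  have \<eta>: "\<eta> > 0" "\<eta> \<le> 1/2" "2 * \<eta> < \<epsilon>" using assms by (auto simp: \<eta>_def min_def)
  obtain N where N: "\<And>m. m \<ge> N \<Longrightarrow> \<exists>u. mislabelled (B m) j (zcoset (G j) u) \<le> \<eta> * measure M (B m)"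
    using base_concentrated[OF \<eta>(1)] by blast
  have "\<exists>g. real (card {i \<in> I m n. i - g \<notin> G j}) / real (card (I m n)) < \<epsilon>" if mn: "m \<le> n" "N \<le> m" for m n
  proof -
    obtain u where u: "mislabelled (B m) j (zcoset (G j) u) \<le> \<eta> * measure M (B m)" using N mn by blast
    obtain w where w: "mislabelled (B n) j (zcoset (G j) w) \<le> \<eta> * measure M (B n)" using N mn by (meson le_trans)
    let ?V = "{i \<in> I m n. i - (u - w) \<notin> G j}"
    have "card ?V * ((1 - \<eta>) * measure M (B n)) \<le> measure P {x \<in> space P. \<alpha> x \<in> B m \<and> \<pi> j x \<noteq> zcoset (G j) u}"
    proof (rule levels_with_expected_label_measure[OF w _ joint_sets(2)[OF B_sets]])
      show "?V \<subseteq> F n" using I_subset by blast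
      fix i assume i: "i \<in> ?V"
      then have "zcoset (G j) (w + i) \<noteq> zcoset (G j) u" by (simp add: zcoset_G_eq_iff algebra_simps)
      then show "{x \<in> space P. \<alpha> x \<in> T i ` B n \<and> \<pi> j x = zcoset (G j) (w + i)} \<subseteq>
         {x \<in> space P. \<alpha> x \<in> B m \<and> \<pi> j x \<noteq> zcoset (G j) u}"
        using level_subset_B[of i m n] i by auto
    qed
    also have "\<dots> \<le> \<eta> * (card (I m n) * measure M (B n))"
      using u measure_B[OF mn(1)] by (simp add: mislabelled_def)
    finally have "(card ?V * (1 - \<eta>)) * measure M (B n) \<le> (\<eta> * card (I m n)) * measure M (B n)"
      by (simp add: algebra_simps)
    then have "card ?V * (1 - \<eta>) \<le> \<eta> * card (I m n)" using B_pos[of n] by simp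
    moreover have "card ?V * (1/2) \<le> card ?V * (1 - \<eta>)" using \<eta>(2) by (intro mult_left_mono) auto
    ultimately have "card ?V \<le> 2 * \<eta> * card (I m n)" by linarith
    also have "\<dots> < \<epsilon> * card (I m n)" using \<eta>(3) card_I_pos[OF mn(1)] by simp
    finally have "card ?V / card (I m n) < \<epsilon>" using card_I_pos[OF mn(1)] by (simp add: divide_less_eq)
    then show ?thesis by blast
  qed
  then show ?thesis by blast
qed

text \<open>
  Approximate \<open>B l\<close> by the labels in \<open>D0\<close> and let \<open>u\<close> be the dominant label of \<open>B m\<close>. With \<open>D\<close> the
  translate of \<open>D0\<close> by \<open>-u\<close>, every \<open>i\<close> on which the two sets disagree puts half a level into the
  set where the approximation fails.
\<close>

lemma descendants_nearly_union_of_cosets: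
  assumes "\<epsilon> > (0::real)"
  shows "\<exists>k N. \<forall>m\<ge>N. m \<ge> l \<longrightarrow> (\<exists>D \<subseteq> carrier (Zgrp Mod G k).
        real (card (sym_diff (I l m) {i \<in> F m. zcoset (G k) i \<in> D})) / real (card (I l m)) < \<epsilon>)"
proof -
  define \<delta> where "\<delta> = \<epsilon> * measure M (B l) / 4"
  have \<delta>: "\<delta> > 0" using assms B_pos by (simp add: \<delta>_def)
  obtain k D0 where D0: "measure P {x \<in> space P. \<not> (\<alpha> x \<in> B l \<longleftrightarrow> \<pi> k x \<in> D0)} < \<delta>"
    using set_approx[OF B_sets \<delta>] by blast
  obtain N where N: "\<And>m. m \<ge> N \<Longrightarrow> \<exists>u. mislabelled (B m) k (zcoset (G k) u) \<le> (1/2) * measure M (B m)"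
    using base_concentrated[of "1/2" k] by auto
  have "\<exists>D \<subseteq> carrier (Zgrp Mod G k).
        real (card (sym_diff (I l m) {i \<in> F m. zcoset (G k) i \<in> D})) / real (card (I l m)) < \<epsilon>"
    if m: "N \<le> m" "l \<le> m" for m
  proof -
    obtain u where u: "mislabelled (B m) k (zcoset (G k) u) \<le> (1/2) * measure M (B m)" using N m by blast
    define D where "D = {zcoset (G k) v | v. zcoset (G k) (u + v) \<in> D0}"
    have D_iff: "zcoset (G k) i \<in> D \<longleftrightarrow> zcoset (G k) (u + i) \<in> D0" for i
    proof -
      have "zcoset (G k) (u + i) = zcoset (G k) (u + v)" if "zcoset (G k) i = zcoset (G k) v" for v
        using that by (simp add: zcoset_G_eq_iff)
      note shift = this
      show ?thesis
      proof
        assume "zcoset (G k) i \<in> D"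
        then obtain v where "zcoset (G k) i = zcoset (G k) v" "zcoset (G k) (u + v) \<in> D0"
          unfolding D_def mem_Collect_eq by (elim exE conjE)
        then show "zcoset (G k) (u + i) \<in> D0" using shift by simp
      next
        assume "zcoset (G k) (u + i) \<in> D0"
        then show "zcoset (G k) i \<in> D" unfolding D_def mem_Collect_eq by (intro exI[of _ i] conjI refl) assumption
      qed
    qed
    let ?V = "sym_diff (I l m) {i \<in> F m. zcoset (G k) i \<in> D}"
    have "card ?V * ((1 - 1/2) * measure M (B m)) \<le> measure P {x \<in> space P. \<not> (\<alpha> x \<in> B l \<longleftrightarrow> \<pi> k x \<in> D0)}"
    proof (rule levels_with_expected_label_measure[OF u _ joint_sets(4)[OF B_sets]])
      show "?V \<subseteq> F m" using I_subset[of l m] by blast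
      fix i assume i: "i \<in> ?V"
      show "{x \<in> space P. \<alpha> x \<in> T i ` B m \<and> \<pi> k x = zcoset (G k) (u + i)} \<subseteq>
         {x \<in> space P. \<not> (\<alpha> x \<in> B l \<longleftrightarrow> \<pi> k x \<in> D0)}"
      proof (cases "i \<in> I l m")
        case True
        then have "zcoset (G k) (u + i) \<notin> D0" using i I_subset[of l m] by (auto simp: D_iff)
        then show ?thesis using level_subset_B[OF True] by auto
      next
        case False
        then have "i \<in> F m" "zcoset (G k) (u + i) \<in> D0" using i by (auto simp: D_iff)
        then show ?thesis using B_union_of_levels(2)[OF m(2) _ False] by auto
      qed
    qed
    then have "card ?V * measure M (B m) < 2 * \<delta>" using D0 by simp
    also have "\<dots> \<le> \<epsilon> * measure M (B l)" using assms by (simp add: \<delta>_def)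
    also have "\<dots> = \<epsilon> * card (I l m) * measure M (B m)" using measure_B[OF m(2)] by simp
    finally have "card ?V < \<epsilon> * card (I l m)" using B_pos[of m] by simp
    then have "card ?V / card (I l m) < \<epsilon>" using card_I_pos[OF m(2)] by (simp add: divide_less_eq)
    moreover have "D \<subseteq> carrier (Zgrp Mod G k)" unfolding carrier_Zgrp_Mod D_def by blast
    ultimately show ?thesis by blast
  qed
  then show ?thesis by blast
qed

end

section \<open>From a conjugacy to the conditions on descendants\<close>

lemma (in subgroup_chain) odometer_coord_range:
  assumes "x \<in> odometer_space G" shows "x j \<in> range (zcoset (G j))"
proof -
  obtain v where "x j = zcoset (G j) v" using odometer_coord[OF assms] by blast
  then show ?thesis by (simp only: rangeI)
qed

lemma (in odometer_haar) coordinate_sets: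
  assumes "p \<in> measurable P \<mu>"
  shows "{x \<in> space P. p x j = c} \<in> sets P"
proof -
  have "{x \<in> space P. p x j = c} = p -` cyl j c \<inter> space P"
    using measurable_space[OF assms] by (auto simp: cyl_def space_mu)
  then show ?thesis using measurable_sets[OF assms cyl_sets] by simp
qed

text \<open>
  The coordinates of \<open>p\<close> are finite-valued and refine each other, and they separate points because
  \<open>p\<close> is injective.
\<close>

lemma (in odometer_haar) set_approx_by_cosets:
  fixes Y :: "'b::metric_space measure"
  assumes model: "compact_model P Y g" and p: "p \<in> measurable P \<mu>"
    and inj: "almost_surely_inj P p" and A: "A \<in> sets P" and e: "e > 0"
  shows "\<exists>k D. measure P {x \<in> space P. \<not> (x \<in> A \<longleftrightarrow> p x k \<in> D)} < e"
proof -
  obtain Z where Z: "Z \<in> null_sets P" "inj_on p (space P - Z)"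
    using inj by (auto simp: almost_surely_inj_def)
  have pO: "p x \<in> odometer_space G" if "x \<in> space P" for x
    using measurable_space[OF p that] by (simp add: space_mu)
  have "\<exists>n D. measure P (sym_diff A {x \<in> space P. (\<lambda>n x. p x n) n x \<in> D}) < e"
  proof (rule approx_by_separating_partitions_model[OF model A])
    show "finite ((\<lambda>n x. p x n) n ` space P)" for n
      by (rule finite_subset[OF _ finite_cosets[of n]]) (use odometer_coord_range[OF pO] in blast)
    show "{x \<in> space P. (\<lambda>n x. p x n) n x = c} \<in> sets P" for n c
      using coordinate_sets[OF p] by simp
    show "(\<lambda>n x. p x n) n x = (\<lambda>n x. p x n) n y"
      if xy: "x \<in> space P" "y \<in> space P" "(\<lambda>n x. p x n) (Suc n) x = (\<lambda>n x. p x n) (Suc n) y" for n x y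
    proof -
      obtain v where v: "p x (Suc n) = zcoset (G (Suc n)) v" using odometer_coord[OF pO[OF xy(1)]] by blast
      then show ?thesis
        using odometer_coord_le[OF pO[OF xy(1)], of n "Suc n" v] odometer_coord_le[OF pO[OF xy(2)], of n "Suc n" v] xy(3)
        by simp
    qed
    show "y \<in> A" if xy: "x \<in> space P - Z" "y \<in> space P - Z" "\<And>n. (\<lambda>n x. p x n) n x = (\<lambda>n x. p x n) n y" "x \<in> A" for x y
    proof -
      have "p x = p y" using xy(3) by auto
      then have "x = y" using inj_onD[OF Z(2)] xy(1,2) by blast
      then show ?thesis using xy(4) by simp
    qed
  qed (use Z e in auto)
  then obtain n D where nD: "measure P (sym_diff A {x \<in> space P. p x n \<in> D}) < e" by auto
  have "sym_diff A {x \<in> space P. p x n \<in> D} = {x \<in> space P. \<not> (x \<in> A \<longleftrightarrow> p x n \<in> D)}"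
    using sets.sets_into_space[OF A] by auto
  then show ?thesis using nD by auto
qed

lemma code_sets:
  assumes "\<And>i. S i \<in> sets N"
  shows "{x \<in> space N. {i. i \<le> n \<and> x \<in> S i} = c} \<in> sets N"
    and "{x \<in> space N. {i. i \<le> (n::nat) \<and> x \<in> S i} \<in> D} \<in> sets N"
proof -
  have *: "{x \<in> space N. {i. i \<le> n \<and> x \<in> S i} = c} \<in> sets N" for c
  proof -
    have "{x \<in> space N. \<forall>i. (i \<le> n \<and> x \<in> S i) \<longleftrightarrow> i \<in> c} \<in> sets N"
    proof (rule sets.sets_Collect_countable_All)
      fix i
      have "{x \<in> space N. x \<in> S i} = S i" "{x \<in> space N. x \<notin> S i} = space N - S i"
        using sets.sets_into_space[OF assms[of i]] by auto
      then show "{x \<in> space N. (i \<le> n \<and> x \<in> S i) \<longleftrightarrow> i \<in> c} \<in> sets N"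
        using assms[of i] by (cases "i \<le> n"; cases "i \<in> c") auto
    qed
    moreover have "{x \<in> space N. \<forall>i. (i \<le> n \<and> x \<in> S i) \<longleftrightarrow> i \<in> c} = {x \<in> space N. {i. i \<le> n \<and> x \<in> S i} = c}"
      by blast
    ultimately show ?thesis by simp
  qed
  then show "{x \<in> space N. {i. i \<le> n \<and> x \<in> S i} = c} \<in> sets N" .
  have "{x \<in> space N. {i. i \<le> n \<and> x \<in> S i} \<in> D} =
     (\<Union>c\<in>D \<inter> Pow {..n}. {x \<in> space N. {i. i \<le> n \<and> x \<in> S i} = c})" by blast
  then show "{x \<in> space N. {i. i \<le> n \<and> x \<in> S i} \<in> D} \<in> sets N"
    using * by (auto intro!: sets.finite_UN)
qed

text \<open>
  The partitions record which of the first \<open>n\<close> sets of a separating family contain \<open>f x\<close>. They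
  are pulled back from \<open>M\<close>, and injectivity of \<open>f\<close> makes them separate the points of \<open>P\<close>.
\<close>

lemma measurable_approx_by_inj_preimages:
  fixes Y :: "'b::metric_space measure"
  assumes model: "compact_model P Y g" and f: "f \<in> measurable P M" and d: "distr P M f = M"
    and inj: "almost_surely_inj P f" and sep: "countably_separated M"
    and C: "C \<in> sets P" and e: "e > 0"
  shows "\<exists>A\<in>sets M. measure P {x \<in> space P. \<not> (f x \<in> A \<longleftrightarrow> x \<in> C)} < e"
proof -
  obtain Z where Z: "Z \<in> null_sets P" "inj_on f (space P - Z)"
    using inj by (auto simp: almost_surely_inj_def)
  obtain S :: "nat \<Rightarrow> _" and Z' where Z': "Z' \<in> null_sets M" and S: "range S \<subseteq> sets M"
    and S_sep: "\<forall>x\<in>space M - Z'. \<forall>y\<in>space M - Z'. (\<forall>n. x \<in> S n \<longleftrightarrow> y \<in> S n) \<longrightarrow> x = y"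
    using sep unfolding countably_separated_def by blast
  have SM: "S i \<in> sets M" for i using S by auto
  have fS: "f x \<in> space M" if "x \<in> space P" for x using measurable_space[OF f that] .
  define h where "h n x = {i. i \<le> n \<and> x \<in> f -` S i \<inter> space P}" for n :: nat and x
  have h_eq: "h n x = {i. i \<le> n \<and> f x \<in> S i}" if "x \<in> space P" for n x using that by (auto simp: h_def)
  have fZ': "f -` Z' \<inter> space P \<in> null_sets P"
    using Z' d null_sets_distr_iff[OF f, of Z'] by auto
  have "\<exists>n D. measure P (sym_diff C {x \<in> space P. h n x \<in> D}) < e"
  proof (rule approx_by_separating_partitions_model[OF model C])
    show "finite (h n ` space P)" for n
      by (rule finite_subset[of _ "Pow {..n}"]) (auto simp: h_def)
    show "{x \<in> space P. h n x = c} \<in> sets P" for n c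
      unfolding h_def by (rule code_sets(1)) (rule measurable_sets[OF f SM])
    show "h n x = h n y" if "h (Suc n) x = h (Suc n) y" for n x y
    proof -
      have "h n z = h (Suc n) z \<inter> {..n}" for z by (auto simp: h_def)
      then show ?thesis using that by simp
    qed
    show "Z \<union> (f -` Z' \<inter> space P) \<in> null_sets P" using Z(1) fZ' by (rule null_sets.Un)
    show "y \<in> C" if xy: "x \<in> space P - (Z \<union> (f -` Z' \<inter> space P))" "y \<in> space P - (Z \<union> (f -` Z' \<inter> space P))"
      "\<And>n. h n x = h n y" "x \<in> C" for x y
    proof -
      have "f x \<in> S n \<longleftrightarrow> f y \<in> S n" for n
      proof -
        have "n \<in> h n x \<longleftrightarrow> n \<in> h n y" using xy(3) by simp
        then show ?thesis using xy(1,2) by (simp add: h_def)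
      qed
      then have "f x = f y" using S_sep xy(1,2) fS by blast
      then have "x = y" using inj_onD[OF Z(2)] xy(1,2) by blast
      then show ?thesis using xy(4) by simp
    qed
  qed (use e in auto)
  then obtain n D where nD: "measure P (sym_diff C {x \<in> space P. h n x \<in> D}) < e" by blast
  define A where "A = {y \<in> space M. {i. i \<le> n \<and> y \<in> S i} \<in> D}"
  have "A \<in> sets M" unfolding A_def by (rule code_sets(2)[OF SM])
  moreover have "{x \<in> space P. \<not> (f x \<in> A \<longleftrightarrow> x \<in> C)} = sym_diff C {x \<in> space P. h n x \<in> D}"
    using sets.sets_into_space[OF C] fS h_eq by (auto simp: A_def)
  ultimately show ?thesis using nD by (intro bexI[of _ A]) simp_all
qed

locale rank_one_and_odometer =
  stacked_rank_one M T F B + odometer_haar G \<mu>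
  for M :: "'a measure" and T :: "int ^ 'd::finite \<Rightarrow> 'a \<Rightarrow> 'a"
    and F :: "nat \<Rightarrow> (int ^ 'd) set" and B :: "nat \<Rightarrow> 'a set"
    and G :: "nat \<Rightarrow> (int ^ 'd) set" and \<mu> :: "(nat \<Rightarrow> (int ^ 'd) set) measure"
begin

lemma base_space_regular: "nonatomic_lebesgue_space M \<or> finite_uniform_space M"
  using action by (simp add: mp_action_def)

text \<open>
  As \<open>U\<close> preserves \<open>P\<close>, the set on the left may be replaced by its preimage under \<open>U\<close>.
\<close>

lemma joint_equivariant:
  assumes P: "prob_space P" and U: "U \<in> measurable P P" and UP: "distr P P U = P"
    and \<alpha>: "\<alpha> \<in> measurable P M" and p: "p \<in> measurable P \<mu>"
    and \<alpha>U: "AE x in P. \<alpha> (U x) = T v (\<alpha> x)"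
    and pU: "AE x in P. p (U x) = odometer_action G v (p x)"
    and A: "A \<in> sets M"
  shows "measure P {x \<in> space P. \<alpha> x \<in> T v ` A \<and> p x j = zcoset (G j) (u + v)} =
         measure P {x \<in> space P. \<alpha> x \<in> A \<and> p x j = zcoset (G j) u}"
proof -
  interpret P: prob_space P by (rule P)
  have sets: "{x \<in> space P. \<alpha> x \<in> C \<and> p x j = c} \<in> sets P" if "C \<in> sets M" for C c
  proof -
    have "{x \<in> space P. \<alpha> x \<in> C \<and> p x j = c} = (\<alpha> -` C \<inter> space P) \<inter> {x \<in> space P. p x j = c}" by auto
    then show ?thesis using measurable_sets[OF \<alpha> that] coordinate_sets[OF p] by simp
  qed
  let ?S = "{x \<in> space P. \<alpha> x \<in> T v ` A \<and> p x j = zcoset (G j) (u + v)}"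
  have S: "?S \<in> sets P" by (rule sets[OF T_image_sets[OF A]])
  have "measure P ?S = measure P (U -` ?S \<inter> space P)"
    using measure_distr[OF U S] UP by simp
  also have "\<dots> = measure P {x \<in> space P. \<alpha> x \<in> A \<and> p x j = zcoset (G j) u}"
  proof (rule measure_eq_AE)
    show "AE x in P. x \<in> U -` ?S \<inter> space P \<longleftrightarrow> x \<in> {x \<in> space P. \<alpha> x \<in> A \<and> p x j = zcoset (G j) u}"
      using \<alpha>U pU AE_space
    proof eventually_elim
      case (elim x)
      have x: "x \<in> space P" "U x \<in> space P" using elim measurable_space[OF U] by auto
      have \<alpha>x: "\<alpha> x \<in> space M" using measurable_space[OF \<alpha> x(1)] .
      have px: "p x \<in> odometer_space G" using measurable_space[OF p x(1)] by (simp add: space_mu)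
      obtain w where w: "p x j = zcoset (G j) w" using odometer_coord[OF px] by blast
      have "T v (\<alpha> x) \<in> T v ` A \<longleftrightarrow> \<alpha> x \<in> A"
        using mem_T_image_iff[OF sets.sets_into_space[OF A] \<alpha>x] .
      moreover have "odometer_action G v (p x) j = zcoset (G j) (u + v) \<longleftrightarrow> p x j = zcoset (G j) u"
        using odometer_action_coord[of "p x" j w v, OF w] w by (simp add: zcoset_G_eq_iff)
      ultimately show ?case using elim x by simp
    qed
    show "U -` ?S \<inter> space P \<in> sets P" by (rule measurable_sets[OF U S])
    show "{x \<in> space P. \<alpha> x \<in> A \<and> p x j = zcoset (G j) u} \<in> sets P" by (rule sets[OF A])
  qed
  finally show ?thesis .
qed

text \<open>
  Label sets are themselves sets of \<open>M\<close>; injectivity is used to approximate sets of \<open>M\<close> by labels.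
\<close>

lemma factor_onto_odometer_joining:
  assumes \<phi>: "factor_map M T \<mu> (odometer_action G) \<phi>" and inj: "almost_surely_inj M \<phi>"
  shows "odometer_joining M T F B G M (\<lambda>x. x) (\<lambda>j x. \<phi> x j)"
proof -
  have m: "\<phi> \<in> measurable M \<mu>" and eq: "AE x in M. \<forall>v. \<phi> (T v x) = odometer_action G v (\<phi> x)"
    using \<phi> by (auto simp: factor_map_def)
  obtain Y and g :: "real \<Rightarrow> 'a" where model: "compact_model M Y g"
    using lebesgue_or_finite_model(1)[OF base_space_regular] by blast
  show ?thesis
  proof unfold_locales
    show "(\<lambda>x. x) \<in> measurable M M" by simp
    show "distr M M (\<lambda>x. x) = M" by (rule distr_id)
    show "{x \<in> space M. \<phi> x j = c} \<in> sets M" for j c by (rule coordinate_sets[OF m])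
    show "\<phi> x j \<in> range (zcoset (G j))" if "x \<in> space M" for j x
      using odometer_coord_range[of "\<phi> x" j] measurable_space[OF m that] by (simp only: space_mu)
    show "measure M {x \<in> space M. x \<in> T v ` A \<and> \<phi> x j = zcoset (G j) (u + v)} =
       measure M {x \<in> space M. x \<in> A \<and> \<phi> x j = zcoset (G j) u}" if "A \<in> sets M" for A j u v
      by (rule joint_equivariant[OF prob_space_M T_meas[of v] T_distr _ m _ _ that]) (use eq in auto)
    show "\<exists>A\<in>sets M. measure M {x \<in> space M. \<not> (x \<in> A \<longleftrightarrow> \<phi> x j = c)} < e" if "e > 0" for j c and e :: real
    proof (rule bexI)
      show "{x \<in> space M. \<phi> x j = c} \<in> sets M" by (rule coordinate_sets[OF m])
      have "{x \<in> space M. \<not> (x \<in> {x \<in> space M. \<phi> x j = c} \<longleftrightarrow> \<phi> x j = c)} = {}" by auto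
      then show "measure M {x \<in> space M. \<not> (x \<in> {x \<in> space M. \<phi> x j = c} \<longleftrightarrow> \<phi> x j = c)} < e"
        using that by (simp only: measure_empty)
    qed
    show "\<exists>k D. measure M {x \<in> space M. \<not> (x \<in> A \<longleftrightarrow> \<phi> x k \<in> D)} < e" if "A \<in> sets M" "e > 0" for A e
      by (rule set_approx_by_cosets[OF model m inj that])
  qed
qed

text \<open>
  Here every measurable set of the odometer is approximated by labels, as for the identity map,
  and injectivity is used to approximate labels by sets coming from \<open>M\<close>.
\<close>

lemma factor_of_odometer_joining:
  assumes \<psi>: "factor_map \<mu> (odometer_action G) M T \<psi>" and inj: "almost_surely_inj \<mu> \<psi>"
  shows "odometer_joining M T F B G \<mu> \<psi> (\<lambda>j x. x j)"
proof -
  have m: "\<psi> \<in> measurable \<mu> M" and d: "distr \<mu> M \<psi> = M"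
    and eq: "AE x in \<mu>. \<forall>v. \<psi> (odometer_action G v x) = T v (\<psi> x)"
    using \<psi> by (auto simp: factor_map_def)
  obtain Y and g :: "(nat \<Rightarrow> real) \<Rightarrow> _" where model: "compact_model \<mu> Y g"
    using mu_model by blast
  have id: "(\<lambda>x. x) \<in> measurable \<mu> \<mu>" by simp
  have id_inj: "almost_surely_inj \<mu> (\<lambda>x. x)"
    unfolding almost_surely_inj_def by (intro bexI[of _ "{}"]) auto
  show ?thesis
  proof unfold_locales
    show "\<psi> \<in> measurable \<mu> M" by (rule m)
    show "distr \<mu> M \<psi> = M" by (rule d)
    show "{x \<in> space \<mu>. x j = c} \<in> sets \<mu>" for j c by (rule coordinate_sets[OF id])
    show "x j \<in> range (zcoset (G j))" if "x \<in> space \<mu>" for j x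
      using odometer_coord_range[of x j] that by (simp only: space_mu)
    show "measure \<mu> {x \<in> space \<mu>. \<psi> x \<in> T v ` A \<and> x j = zcoset (G j) (u + v)} =
       measure \<mu> {x \<in> space \<mu>. \<psi> x \<in> A \<and> x j = zcoset (G j) u}" if "A \<in> sets M" for A j u v
      by (rule joint_equivariant[OF mu.prob_space_axioms measurable_odometer_action distr_odometer_action m id _ _ that])
         (use eq in auto)
    show "\<exists>A\<in>sets M. measure \<mu> {x \<in> space \<mu>. \<not> (\<psi> x \<in> A \<longleftrightarrow> x j = c)} < e" if "e > 0" for j c and e :: real
    proof -
      have "{x \<in> space \<mu>. \<not> (\<psi> x \<in> A \<longleftrightarrow> x \<in> cyl j c)} = {x \<in> space \<mu>. \<not> (\<psi> x \<in> A \<longleftrightarrow> x j = c)}" for A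
        by (auto simp: cyl_def space_mu)
      then show ?thesis
        using measurable_approx_by_inj_preimages[OF model m d inj lebesgue_or_finite_model(2)[OF base_space_regular] cyl_sets that, of j c]
        by simp
    qed
    show "\<exists>k D. measure \<mu> {x \<in> space \<mu>. \<not> (\<psi> x \<in> A \<longleftrightarrow> x k \<in> D)} < e" if A: "A \<in> sets M" and e: "e > 0" for A e
    proof -
      obtain k D where "measure \<mu> {x \<in> space \<mu>. \<not> (x \<in> \<psi> -` A \<inter> space \<mu> \<longleftrightarrow> x k \<in> D)} < e"
        using set_approx_by_cosets[OF model id id_inj measurable_sets[OF m A] e] by blast
      moreover have "{x \<in> space \<mu>. \<not> (x \<in> \<psi> -` A \<inter> space \<mu> \<longleftrightarrow> x k \<in> D)} = {x \<in> space \<mu>. \<not> (\<psi> x \<in> A \<longleftrightarrow> x k \<in> D)}"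
        by auto
      ultimately show ?thesis by auto
    qed
  qed
qed

lemma conjugate_imp_conditions:
  assumes "conjugate M T \<mu> (odometer_action G)"
  shows "(\<forall>l. \<forall>\<epsilon>::real. \<epsilon> > 0 \<longrightarrow> (\<exists>k N. \<forall>m\<ge>N. m \<ge> l \<longrightarrow>
      (\<exists>D \<subseteq> carrier (Zgrp Mod G k).
        real (card (sym_diff (I l m) {i \<in> F m. G k #>\<^bsub>Zgrp\<^esub> i \<in> D})) / real (card (I l m)) < \<epsilon>))) \<and>
    (\<forall>j. \<forall>\<epsilon>::real. \<epsilon> > 0 \<longrightarrow> (\<exists>N. \<forall>m n. n \<ge> m \<and> m \<ge> N \<longrightarrow>
      (\<exists>g. real (card {i \<in> I m n. i - g \<notin> G j}) / real (card (I m n)) < \<epsilon>)))"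
  using assms unfolding conjugate_def
proof (elim disjE exE conjE)
  fix \<phi> assume "factor_map M T \<mu> (odometer_action G) \<phi>" "almost_surely_inj M \<phi>"
  then interpret odometer_joining M T F B G M "\<lambda>x. x" "\<lambda>j x. \<phi> x j"
    by (rule factor_onto_odometer_joining)
  show ?thesis
    by (intro conjI allI impI descendants_nearly_union_of_cosets descendants_in_one_coset)
next
  fix \<psi> assume "factor_map \<mu> (odometer_action G) M T \<psi>" "almost_surely_inj \<mu> \<psi>"
  then interpret odometer_joining M T F B G \<mu> \<psi> "\<lambda>j x. x j"
    by (rule factor_of_odometer_joining)
  show ?thesis
    by (intro conjI allI impI descendants_nearly_union_of_cosets descendants_in_one_coset)
qed

end

section \<open>From the conditions on descendants to a conjugacy\<close>

lemma (in prob_space) AE_frequently_notin: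
  assumes N: "\<And>n::nat. N n \<in> sets M" and lim: "(\<lambda>n. measure M (N n)) \<longlonglongrightarrow> 0"
  shows "AE x in M. \<forall>j. \<exists>n\<ge>j. x \<notin> N n"
proof -
  have "AE x in M. \<exists>n\<ge>j. x \<notin> N n" for j
  proof (rule AE_I)
    show "{x \<in> space M. \<not> (\<exists>n\<ge>j. x \<notin> N n)} \<subseteq> (\<Inter>n\<in>{j..}. N n)" by auto
    show S: "(\<Inter>n\<in>{j..}. N n) \<in> sets M" using N by (intro sets.countable_INT') auto
    have "measure M (\<Inter>n\<in>{j..}. N n) \<le> 0"
    proof (rule LIMSEQ_le_const[OF lim], intro exI allI impI)
      fix n assume "j \<le> n"
      then show "measure M (\<Inter>n\<in>{j..}. N n) \<le> measure M (N n)"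
        using N by (intro finite_measure_mono) auto
    qed
    then show "emeasure M (\<Inter>n\<in>{j..}. N n) = 0"
      by (simp add: emeasure_eq_measure measure_le_0_iff)
  qed
  then show ?thesis by (simp add: AE_all_countable)
qed

text \<open>
  By Borel and Cantelli, the lower limit of approximations with summable errors is exact.
\<close>

lemma (in prob_space) exact_preimage_of_approx:
  assumes f: "f \<in> measurable M N" and A: "A \<in> sets M"
    and approx: "\<And>e::real. e > 0 \<Longrightarrow> \<exists>C\<in>sets N. measure M {x \<in> space M. \<not> (x \<in> A \<longleftrightarrow> f x \<in> C)} < e"
  shows "\<exists>C\<in>sets N. AE x in M. x \<in> A \<longleftrightarrow> f x \<in> C"
proof -
  have "\<forall>n::nat. \<exists>C. C \<in> sets N \<and> measure M {x \<in> space M. \<not> (x \<in> A \<longleftrightarrow> f x \<in> C)} < (1/2)^n"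
    using approx by (intro allI) (auto simp: Bex_def)
  from choice[OF this] obtain C :: "nat \<Rightarrow> _" where C: "\<forall>n. C n \<in> sets N \<and>
      measure M {x \<in> space M. \<not> (x \<in> A \<longleftrightarrow> f x \<in> C n)} < (1/2)^n" ..
  have CN: "C n \<in> sets N" for n using C by blast
  let ?X = "\<lambda>n. {x \<in> space M. \<not> (x \<in> A \<longleftrightarrow> f x \<in> C n)}"
  have XS: "?X n \<in> sets M" for n
  proof -
    have "?X n = sym_diff A (f -` C n \<inter> space M)" using sets.sets_into_space[OF A] by auto
    then show ?thesis using A measurable_sets[OF f CN, of n] by auto
  qed
  have "AE x in M. eventually (\<lambda>n. x \<in> space M - ?X n) sequentially"
  proof (rule borel_cantelli_AE1)
    show "summable (\<lambda>n. measure M (?X n))"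
    proof (rule summable_comparison_test'[of "\<lambda>n. (1/2::real)^n" 0])
      show "norm (measure M (?X n)) \<le> (1/2)^n" for n using C by (auto intro: less_imp_le)
    qed simp
  qed (use XS in \<open>auto simp: emeasure_eq_measure\<close>)
  then have ev: "AE x in M. eventually (\<lambda>n. x \<in> A \<longleftrightarrow> f x \<in> C n) sequentially"
    by (rule AE_mp) (auto intro!: AE_I2 elim: eventually_mono)
  define D where "D = (\<Union>m. \<Inter>n\<in>{m..}. C n)"
  have "D \<in> sets N" unfolding D_def by (intro sets.countable_UN' sets.countable_INT') (use CN in auto)
  moreover have "AE x in M. x \<in> A \<longleftrightarrow> f x \<in> D"
    using ev
  proof eventually_elim
    case (elim x)
    then obtain m where m: "\<And>n. n \<ge> m \<Longrightarrow> x \<in> A \<longleftrightarrow> f x \<in> C n" by (auto simp: eventually_sequentially)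
    show ?case
    proof
      assume "x \<in> A"
      then have "f x \<in> (\<Inter>n\<in>{m..}. C n)" using m by simp
      then show "f x \<in> D" unfolding D_def by blast
    next
      assume "f x \<in> D"
      then obtain k where k: "\<And>n. n \<ge> k \<Longrightarrow> f x \<in> C n" by (auto simp: D_def)
      then show "x \<in> A" using m[of "max m k"] k[of "max m k"] by simp
    qed
  qed
  ultimately show ?thesis by blast
qed

context stacked_rank_one
begin

lemma folner_boundary: "(\<lambda>n. real (card {k \<in> F n. v + k \<notin> F n}) / real (card (F n))) \<longlonglongrightarrow> 0"
proof (rule tendsto_sandwich[OF _ _ tendsto_const])
  show "(\<lambda>n. real (card (sym_diff (F n) ((\<lambda>i. i + v) ` F n))) / real (card (F n))) \<longlonglongrightarrow> 0"
    using folner by (auto simp: folner_sequence_def)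
  have "card {k \<in> F n. v + k \<notin> F n} \<le> card (sym_diff (F n) ((\<lambda>i. i + v) ` F n))" for n
  proof (rule card_inj_on_le)
    show "inj_on (\<lambda>i. i + v) {k \<in> F n. v + k \<notin> F n}" by (auto simp: inj_on_def)
    show "(\<lambda>i. i + v) ` {k \<in> F n. v + k \<notin> F n} \<subseteq> sym_diff (F n) ((\<lambda>i. i + v) ` F n)"
      by (auto simp: add.commute)
    show "finite (sym_diff (F n) ((\<lambda>i. i + v) ` F n))" using finite_F by auto
  qed
  then show "\<forall>\<^sub>F n in sequentially. real (card {k \<in> F n. v + k \<notin> F n}) / real (card (F n)) \<le>
      real (card (sym_diff (F n) ((\<lambda>i. i + v) ` F n))) / real (card (F n))"
    by (intro always_eventually allI divide_right_mono) auto
qed simp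

lemma card_F_measure_B_le: "card (F n) * measure M (B n) \<le> 1"
  using card_F_measure_B[of n] by simp

end

text \<open>
  The towers \<open>r s\<close>, with label \<open>i + c s\<close> on level \<open>i\<close>. The difference \<open>c s - c (Suc s)\<close> is the residue
  of most descendants of the tower \<open>r s\<close> in the next one, so that a point in the part \<open>k\<close> of level
  \<open>i\<close> has label \<open>i + c s\<close> in the former and the congruent label \<open>i + k + c (Suc s)\<close> in the latter.
\<close>

locale labelled_towers = rank_one_and_odometer M T F B G \<mu>
  for M :: "'a measure" and T :: "int ^ 'd::finite \<Rightarrow> 'a \<Rightarrow> 'a"
    and F :: "nat \<Rightarrow> (int ^ 'd) set" and B :: "nat \<Rightarrow> 'a set"
    and G :: "nat \<Rightarrow> (int ^ 'd) set" and \<mu> :: "(nat \<Rightarrow> (int ^ 'd) set) measure" +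
  fixes r :: "nat \<Rightarrow> nat" and c :: "nat \<Rightarrow> int ^ 'd"
  assumes r_mono: "strict_mono r"
    and E_small: "\<And>s. measure M (E (r s)) \<le> (1/2)^s"
    and label_step: "\<And>s. real (card {k \<in> I (r s) (r (Suc s)). k - (c s - c (Suc s)) \<notin> G s})
                         \<le> (1/2)^s * card (I (r s) (r (Suc s)))"
    and folner_step: "\<And>s. (\<Sum>i\<in>F (r s). real (card {k \<in> F (r (Suc s)). i + k \<notin> F (r (Suc s))}) / card (F (r (Suc s))))
                         \<le> (1/2)^s"
begin

definition pos :: "nat \<Rightarrow> 'a \<Rightarrow> int ^ 'd" where
  "pos s x = (THE i. i \<in> F (r s) \<and> x \<in> T i ` B (r s))"

lemma pos_eq: "i \<in> F (r s) \<Longrightarrow> x \<in> T i ` B (r s) \<Longrightarrow> pos s x = i"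
  unfolding pos_def using levels_disjoint by (intro the_equality) blast+

lemma level_of_point: "x \<in> space M \<Longrightarrow> x \<notin> E (r s) \<Longrightarrow> \<exists>i\<in>F (r s). x \<in> T i ` B (r s)"
  by (auto simp: E_eq)

definition label :: "nat \<Rightarrow> 'a \<Rightarrow> int ^ 'd" where "label s x = pos s x + c s"

text \<open>
  The parts \<open>k\<close> of level \<open>i\<close> on which the labels for \<open>s\<close> and \<open>Suc s\<close> may be incongruent. The first case
  occurs because level \<open>i\<close> is the union of the sets \<open>T (i + k) ` B (r (Suc s))\<close>, but \<open>i + k\<close> need not
  be a position in the later tower.
\<close>

definition stray :: "nat \<Rightarrow> int ^ 'd \<Rightarrow> (int ^ 'd) set" where
  "stray s i = {k \<in> I (r s) (r (Suc s)). i + k \<notin> F (r (Suc s)) \<or> k - (c s - c (Suc s)) \<notin> G s}"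

definition bad :: "nat \<Rightarrow> 'a set" where
  "bad s = E (r s) \<union> (\<Union>i\<in>F (r s). \<Union>k\<in>stray s i. T (i + k) ` B (r (Suc s)))"

lemma finite_stray: "finite (stray s i)"
  unfolding stray_def using finite_I by simp

lemma bad_sets: "bad s \<in> sets M"
  unfolding bad_def using finite_F finite_stray by (intro sets.Un sets.finite_UN E_sets level_sets) auto

lemma r_le: "r s \<le> r (Suc s)" using strict_monoD[OF r_mono, of s "Suc s"] by simp

text \<open>
  The error set, the descendants with the wrong residue and the descendants that are translated
  out of the later tower contribute at most \<open>(1/2)^s\<close> each.
\<close>

lemma measure_bad: "measure M (bad s) \<le> 3 * (1/2)^s"
proof -
  let ?n = "r (Suc s)" and ?m = "r s"
  let ?b = "measure M (B (r (Suc s)))"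
  have stray_le: "card (stray s i) \<le> card {k \<in> I ?m ?n. k - (c s - c (Suc s)) \<notin> G s} + card {k \<in> F ?n. i + k \<notin> F ?n}" for i
  proof -
    have "card (stray s i) \<le> card ({k \<in> I ?m ?n. k - (c s - c (Suc s)) \<notin> G s} \<union> {k \<in> F ?n. i + k \<notin> F ?n})"
      by (rule card_mono) (use finite_I finite_F I_subset[of ?m ?n] in \<open>auto simp: stray_def\<close>)
    also have "\<dots> \<le> card {k \<in> I ?m ?n. k - (c s - c (Suc s)) \<notin> G s} + card {k \<in> F ?n. i + k \<notin> F ?n}"
      by (rule card_Un_le)
    finally show ?thesis .
  qed
  have bF: "?b \<le> 1 / card (F ?n)"
  proof -
    have "card (F ?n) > 0" using zero_in_F finite_F by (auto simp: card_gt_0_iff)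
    then show ?thesis using card_F_measure_B_le[of ?n] by (simp add: field_simps)
  qed
  have level_strays: "measure M (\<Union>k\<in>stray s i. T (i + k) ` B ?n) \<le>
      (1/2)^s * measure M (B ?m) + card {k \<in> F ?n. i + k \<notin> F ?n} / card (F ?n)" for i
  proof -
    have "measure M (\<Union>k\<in>stray s i. T (i + k) ` B ?n) \<le> (\<Sum>k\<in>stray s i. measure M (T (i + k) ` B ?n))"
      using finite_stray by (intro finite_measure_subadditive_finite) auto
    also have "\<dots> = card (stray s i) * ?b" by (simp add: measure_T_image)
    also have "\<dots> \<le> (real (card {k \<in> I ?m ?n. k - (c s - c (Suc s)) \<notin> G s}) + real (card {k \<in> F ?n. i + k \<notin> F ?n})) * ?b"
      using stray_le[of i] by (intro mult_right_mono) auto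
    also have "\<dots> \<le> ((1/2)^s * card (I ?m ?n)) * ?b + card {k \<in> F ?n. i + k \<notin> F ?n} * (1 / card (F ?n))"
      unfolding distrib_right using label_step[of s] bF by (intro add_mono mult_right_mono mult_left_mono) auto
    also have "\<dots> = (1/2)^s * measure M (B ?m) + card {k \<in> F ?n. i + k \<notin> F ?n} / card (F ?n)"
      using measure_B[OF r_le, of s] by simp
    finally show ?thesis .
  qed
  have US: "(\<Union>k\<in>stray s i. T (i + k) ` B ?n) \<in> sets M" for i
    using finite_stray by (intro sets.finite_UN) auto
  have "measure M (bad s) \<le> measure M (E ?m) + measure M (\<Union>i\<in>F ?m. \<Union>k\<in>stray s i. T (i + k) ` B ?n)"
    unfolding bad_def by (rule measure_Un_le) (use US finite_F in \<open>auto intro!: sets.finite_UN\<close>)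
  also have "\<dots> \<le> (1/2)^s + (\<Sum>i\<in>F ?m. measure M (\<Union>k\<in>stray s i. T (i + k) ` B ?n))"
    using E_small US finite_F by (intro add_mono finite_measure_subadditive_finite) auto
  also have "\<dots> \<le> (1/2)^s + (\<Sum>i\<in>F ?m. (1/2)^s * measure M (B ?m) + card {k \<in> F ?n. i + k \<notin> F ?n} / card (F ?n))"
    by (intro add_mono order_refl sum_mono level_strays)
  also have "\<dots> = (1/2)^s + ((1/2)^s * (card (F ?m) * measure M (B ?m)) + (\<Sum>i\<in>F ?m. card {k \<in> F ?n. i + k \<notin> F ?n} / card (F ?n)))"
    by (simp add: sum.distrib)
  also have "\<dots> \<le> (1/2)^s + ((1/2)^s * 1 + (1/2)^s)"
    using card_F_measure_B_le[of ?m] folner_step[of s] by (intro add_mono mult_left_mono order_refl) auto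
  finally show ?thesis by simp
qed

lemma label_step_good:
  assumes x: "x \<in> space M" "x \<notin> bad s"
  shows "label (Suc s) x - label s x \<in> G s"
proof -
  have "x \<notin> E (r s)" using x(2) by (simp add: bad_def)
  then obtain i where i: "i \<in> F (r s)" "x \<in> T i ` B (r s)" using level_of_point x(1) by blast
  have "x \<in> T i ` (\<Union>k\<in>I (r s) (r (Suc s)). T k ` B (r (Suc s)))"
    using i(2) B_union_of_levels(1)[OF r_le, of s] by simp
  then obtain k where k: "k \<in> I (r s) (r (Suc s))" "x \<in> T i ` (T k ` B (r (Suc s)))" by blast
  then have xk: "x \<in> T (i + k) ` B (r (Suc s))" using T_image_image[OF B_space] by simp
  then have "k \<notin> stray s i" using x(2) i(1) by (auto simp: bad_def)
  then have "i + k \<in> F (r (Suc s))" "k - (c s - c (Suc s)) \<in> G s" using k(1) by (auto simp: stray_def)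
  then show ?thesis
    using pos_eq[OF i] pos_eq[OF _ xk] by (simp add: label_def algebra_simps)
qed

definition tail :: "nat \<Rightarrow> 'a set" where "tail s = (\<Union>t. bad (t + s))"

lemma tail_sets [measurable]: "tail s \<in> sets M"
  unfolding tail_def using bad_sets by auto

lemma bad_subset_tail: "s \<le> t \<Longrightarrow> bad t \<subseteq> tail s"
  unfolding tail_def by (rule subset_trans[OF _ UN_upper[of "t - s"]]) auto

lemma tail_antimono: "s \<le> t \<Longrightarrow> tail t \<subseteq> tail s"
  unfolding tail_def[of t] by (intro UN_least bad_subset_tail) simp

lemma notin_tail_level: "x \<in> space M \<Longrightarrow> x \<notin> tail s \<Longrightarrow> \<exists>i\<in>F (r s). x \<in> T i ` B (r s)"
  using bad_subset_tail[of s s] by (intro level_of_point) (auto simp: bad_def)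

lemma measure_tail: "measure M (tail s) \<le> 6 * (1/2)^s"
proof -
  have sm: "summable (\<lambda>t. 3 * (1/2::real)^(t + s))"
    by (simp add: power_add summable_mult summable_mult2)
  have sb: "summable (\<lambda>t. measure M (bad (t + s)))"
    by (rule summable_comparison_test'[OF sm, of 0]) (use measure_bad in simp)
  have "measure M (tail s) \<le> suminf (\<lambda>t. measure M (bad (t + s)))"
    unfolding tail_def using bad_sets by (intro finite_measure_subadditive_countably sb) auto
  also have "\<dots> \<le> suminf (\<lambda>t. 3 * (1/2)^(t + s))"
    by (rule suminf_le[OF measure_bad sb sm])
  also have "\<dots> = suminf (\<lambda>t. (3 * (1/2)^s) * (1/2::real)^t)" by (simp add: power_add mult_ac)
  also have "\<dots> = (3 * (1/2)^s) * 2" by (subst suminf_mult) (simp_all add: suminf_geometric)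
  finally show ?thesis by simp
qed

lemma tail_tendsto: "(\<lambda>s. measure M (tail s)) \<longlonglongrightarrow> 0"
proof (rule tendsto_sandwich[OF _ _ tendsto_const])
  show "(\<lambda>s. 6 * (1/2::real)^s) \<longlonglongrightarrow> 0" by (intro tendsto_mult_right_zero LIMSEQ_power_zero) simp
qed (use measure_tail in auto)

lemma label_stable:
  assumes x: "x \<in> space M" "x \<notin> tail s" and "s \<le> t"
  shows "label t x - label s x \<in> G s"
  using assms(3)
proof (induction t rule: dec_induct)
  case base
  show ?case using subgroup_Zgrp_zero[OF subG] by simp
next
  case (step t)
  have "label (Suc t) x - label t x \<in> G t"
    using bad_subset_tail[of s t] step.hyps x by (intro label_step_good) auto
  then have "label (Suc t) x - label t x \<in> G s" using decseqD[OF decG, of s t] step.hyps by auto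
  from subgroup_Zgrp_add[OF subG this step.IH] show ?case by simp
qed

text \<open>
  The label is read off at a stage from which on it is stable; taking it at stage \<open>j\<close> or later
  ensures stability modulo \<open>G j\<close>. On the null set of points that are bad at infinitely many
  stages, the value is the identity of the odometer, so that \<open>coord\<close> maps all of \<open>M\<close> into the odometer.
\<close>

definition coord :: "'a \<Rightarrow> nat \<Rightarrow> (int ^ 'd) set" where
  "coord x j = zcoset (G j) (if x \<in> (\<Inter>s. tail s) then 0 else label (max j (LEAST s. x \<notin> tail s)) x)"

lemma coord_eq:
  assumes x: "x \<in> space M" "x \<notin> tail s" and j: "j \<le> s"
  shows "coord x j = zcoset (G j) (label s x)"
proof -
  define s0 where "s0 = (LEAST s. x \<notin> tail s)"
  have s0: "x \<notin> tail s0" "s0 \<le> s" unfolding s0_def using x(2) by (rule LeastI, rule Least_le)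
  have "x \<notin> tail (max j s0)" using tail_antimono[of s0 "max j s0"] s0 by auto
  then have "label s x - label (max j s0) x \<in> G (max j s0)"
    using label_stable[OF x(1), of "max j s0" s] j s0(2) by simp
  then have "label s x - label (max j s0) x \<in> G j" using decseqD[OF decG, of j "max j s0"] by auto
  then have "zcoset (G j) (label s x) = zcoset (G j) (label (max j s0) x)" by (simp add: zcoset_G_eq_iff)
  then show ?thesis using x(2) by (auto simp: coord_def s0_def)
qed

lemma coord_in_odometer:
  assumes x: "x \<in> space M"
  shows "coord x \<in> odometer_space G"
proof (cases "x \<in> (\<Inter>s. tail s)")
  case True
  then have "coord x = (\<lambda>j. zcoset (G j) 0)" by (intro ext) (simp add: coord_def)
  then show ?thesis using diagonal_in_odometer_space by simp
next
  case False
  then obtain s where s: "x \<notin> tail s" by blast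
  show ?thesis unfolding odometer_space_iff
  proof
    fix j
    have "x \<notin> tail (max s (Suc j))" using tail_antimono[of s "max s (Suc j)"] s by auto
    from coord_eq[OF x this, of j] coord_eq[OF x this, of "Suc j"]
    show "\<exists>v. coord x j = zcoset (G j) v \<and> coord x (Suc j) = zcoset (G (Suc j)) v" by auto
  qed
qed

lemma coord_measurable: "coord \<in> measurable M \<mu>"
proof (rule measurable_into_mu[OF coord_in_odometer])
  fix j d
  define R where "R s = (\<Union>i\<in>{i \<in> F (r s). zcoset (G j) (i + c s) = d}. T i ` B (r s)) - tail s" for s
  have RS: "R s \<in> sets M" for s
    unfolding R_def using finite_F by (intro sets.Diff sets.finite_UN) auto
  have R_iff: "coord x j = d \<longleftrightarrow> x \<in> R s" if x: "x \<in> space M" "x \<notin> tail s" "j \<le> s" for x s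
  proof -
    obtain i where i: "i \<in> F (r s)" "x \<in> T i ` B (r s)" using notin_tail_level x by blast
    have "coord x j = zcoset (G j) (i + c s)" using coord_eq[OF x] pos_eq[OF i] by (simp add: label_def)
    moreover have "x \<in> R s \<longleftrightarrow> zcoset (G j) (i + c s) = d"
    proof
      assume "x \<in> R s"
      then obtain k where "k \<in> F (r s)" "zcoset (G j) (k + c s) = d" "x \<in> T k ` B (r s)" by (auto simp: R_def)
      then show "zcoset (G j) (i + c s) = d" using pos_eq[OF i] pos_eq[of k s x] by simp
    next
      assume "zcoset (G j) (i + c s) = d"
      then show "x \<in> R s" using i x(2) unfolding R_def by blast
    qed
    ultimately show ?thesis by simp
  qed
  have Rj: "x \<in> space M \<and> x \<notin> tail s" if "x \<in> R s" for x s using that level_space by (auto simp: R_def)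
  have "{x \<in> space M. coord x j = d} =
     (if zcoset (G j) 0 = d then (\<Inter>s. tail s) else {}) \<union> (\<Union>s\<in>{j..}. R s)"
  proof (intro Set.set_eqI)
    fix x
    show "x \<in> {x \<in> space M. coord x j = d} \<longleftrightarrow>
       x \<in> (if zcoset (G j) 0 = d then (\<Inter>s. tail s) else {}) \<union> (\<Union>s\<in>{j..}. R s)"
    proof (cases "x \<in> (\<Inter>s. tail s)")
      case True
      then have "x \<in> space M" using sets.sets_into_space[OF tail_sets[of 0]] by auto
      moreover have "coord x j = zcoset (G j) 0" using True by (simp add: coord_def)
      moreover have "x \<notin> (\<Union>s\<in>{j..}. R s)" using True Rj by blast
      ultimately show ?thesis using True by simp
    next
      case False
      then obtain s where s: "x \<notin> tail s" by blast
      then have s': "x \<notin> tail (max s j)" using tail_antimono[of s "max s j"] by auto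
      show ?thesis
      proof
        assume "x \<in> {x \<in> space M. coord x j = d}"
        then have "x \<in> R (max s j)" using R_iff[OF _ s'] by simp
        then show "x \<in> (if zcoset (G j) 0 = d then (\<Inter>s. tail s) else {}) \<union> (\<Union>s\<in>{j..}. R s)"
          by (intro UnI2 UN_I[of "max s j"]) auto
      next
        assume "x \<in> (if zcoset (G j) 0 = d then (\<Inter>s. tail s) else {}) \<union> (\<Union>s\<in>{j..}. R s)"
        then obtain t where t: "j \<le> t" "x \<in> R t" using False by (auto split: if_splits)
        then show "x \<in> {x \<in> space M. coord x j = d}" using R_iff[of x t] Rj[OF t(2)] by simp
      qed
    qed
  qed
  also have "\<dots> \<in> sets M"
    using RS by (intro sets.Un sets.countable_UN') (auto intro!: sets.countable_INT')
  finally show "{x \<in> space M. coord x j = d} \<in> sets M" .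
qed

text \<open>
  Translation by \<open>v\<close> adds \<open>v\<close> to the label, except near the boundary of the tower. The exceptional
  sets \<open>N s\<close> have measure tending to \<open>0\<close> by the Folner property, so almost every point avoids them
  for arbitrarily large \<open>s\<close>, and one such \<open>s \<ge> j\<close> decides coordinate \<open>j\<close>.
\<close>

lemma coord_equivariant_AE: "AE x in M. \<forall>v. coord (T v x) = odometer_action G v (coord x)"
  unfolding AE_all_countable
proof
  fix v
  define W where "W s = (\<Union>i\<in>{i \<in> F (r s). v + i \<notin> F (r s)}. T i ` B (r s))" for s
  define N where "N s = tail s \<union> (T (- v) ` tail s \<union> W s)" for s
  have WS: "W s \<in> sets M" for s unfolding W_def using finite_F by (intro sets.finite_UN) auto
  have NS: "N s \<in> sets M" for s unfolding N_def using WS T_image_sets[OF tail_sets] by auto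
  have W_le: "measure M (W s) \<le> card {i \<in> F (r s). v + i \<notin> F (r s)} / card (F (r s))" for s
  proof -
    have "card (F (r s)) > 0" using zero_in_F finite_F by (auto simp: card_gt_0_iff)
    then have "measure M (B (r s)) \<le> 1 / card (F (r s))"
      using card_F_measure_B_le[of "r s"] by (simp add: field_simps)
    then have "card {i \<in> F (r s). v + i \<notin> F (r s)} * measure M (B (r s)) \<le>
        card {i \<in> F (r s). v + i \<notin> F (r s)} * (1 / card (F (r s)))" by (intro mult_left_mono) auto
    moreover have "measure M (W s) = card {i \<in> F (r s). v + i \<notin> F (r s)} * measure M (B (r s))"
      unfolding W_def by (rule measure_levels) auto
    ultimately show ?thesis by simp
  qed
  have "(\<lambda>s. measure M (N s)) \<longlonglongrightarrow> 0"
  proof (rule tendsto_sandwich[OF _ _ tendsto_const])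
    have "(\<lambda>s. card {i \<in> F (r s). v + i \<notin> F (r s)} / card (F (r s))) \<longlonglongrightarrow> 0"
      using LIMSEQ_subseq_LIMSEQ[OF folner_boundary[of v] r_mono] by (simp add: o_def)
    from tendsto_add[OF tail_tendsto tendsto_add[OF tail_tendsto this]]
    show "(\<lambda>s. measure M (tail s) + (measure M (tail s) + card {i \<in> F (r s). v + i \<notin> F (r s)} / card (F (r s)))) \<longlonglongrightarrow> 0"
      by simp
    have "measure M (N s) \<le> measure M (tail s) + (measure M (tail s) + card {i \<in> F (r s). v + i \<notin> F (r s)} / card (F (r s)))" for s
    proof -
      have "measure M (N s) \<le> measure M (tail s) + measure M (T (- v) ` tail s \<union> W s)"
        unfolding N_def using WS T_image_sets[OF tail_sets] by (intro measure_Un_le) auto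
      moreover have "measure M (T (- v) ` tail s \<union> W s) \<le> measure M (T (- v) ` tail s) + measure M (W s)"
        using WS T_image_sets[OF tail_sets] by (intro measure_Un_le) auto
      ultimately show ?thesis using W_le[of s] measure_T_image[OF tail_sets, of "- v" s] by linarith
    qed
    then show "\<forall>\<^sub>F s in sequentially. measure M (N s) \<le>
        measure M (tail s) + (measure M (tail s) + card {i \<in> F (r s). v + i \<notin> F (r s)} / card (F (r s)))"
      by (intro always_eventually allI)
  qed simp
  from AE_frequently_notin[OF NS this] AE_space
  show "AE x in M. coord (T v x) = odometer_action G v (coord x)"
  proof eventually_elim
    case (elim x)
    show ?case
    proof
      fix j
      obtain s where s: "j \<le> s" "x \<notin> N s" using elim(1) by blast
      have x: "x \<in> space M" "x \<notin> tail s" using elim s by (auto simp: N_def)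
      have "T v x \<notin> tail s"
      proof
        assume "T v x \<in> tail s"
        then have "T (- v) (T v x) \<in> T (- v) ` tail s" by (rule imageI)
        then show False using s T_minus[OF x(1)] by (simp add: N_def)
      qed
      note Tx = T_space[OF x(1), of v] this
      obtain i where i: "i \<in> F (r s)" "x \<in> T i ` B (r s)" using notin_tail_level[OF x] by blast
      have vi: "v + i \<in> F (r s)" using s(2) i by (auto simp: N_def W_def)
      have "T v x \<in> T (v + i) ` B (r s)" using i(2) T_image_image[OF B_space, of v i] by blast
      then have "label s (T v x) = label s x + v" using pos_eq[OF i] pos_eq[OF vi] by (simp add: label_def)
      then show "coord (T v x) j = odometer_action G v (coord x) j"
        using coord_eq[OF Tx s(1)] odometer_action_coord[of "coord x" j "label s x" v, OF coord_eq[OF x s(1)]] by simp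
    qed
  qed
qed

lemma coord_distr: "distr M \<mu> coord = \<mu>"
proof (rule distr_eq_mu[OF prob_space_M coord_measurable])
  fix j u v
  have "measure M {x \<in> space M. x \<in> T v ` space M \<and> coord x j = zcoset (G j) (u + v)} =
     measure M {x \<in> space M. x \<in> space M \<and> coord x j = zcoset (G j) u}"
    by (rule joint_equivariant[OF prob_space_M T_meas[of v] T_distr _ coord_measurable])
       (use coord_equivariant_AE in auto)
  moreover have "T v ` space M = space M" using T_image_eq[of "space M" v] T_space by auto
  ultimately show "measure M {x \<in> space M. coord x j = zcoset (G j) (u + v)} =
     measure M {x \<in> space M. coord x j = zcoset (G j) u}" by simp
qed

lemma coord_factor_map: "factor_map M T \<mu> (odometer_action G) coord"
  unfolding factor_map_def using coord_measurable coord_distr coord_equivariant_AE by blast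

definition determined :: "'a set \<Rightarrow> bool" where
  "determined A \<longleftrightarrow> (\<exists>C\<in>sets \<mu>. AE x in M. x \<in> A \<longleftrightarrow> coord x \<in> C)"

lemma determined_of_approx:
  assumes "A \<in> sets M"
    and "\<And>e::real. e > 0 \<Longrightarrow> \<exists>C\<in>sets \<mu>. measure M {x \<in> space M. \<not> (x \<in> A \<longleftrightarrow> coord x \<in> C)} < e"
  shows "determined A"
  unfolding determined_def by (rule exact_preimage_of_approx[OF coord_measurable assms])

lemma determined_UN:
  assumes "finite V" "\<And>v. v \<in> V \<Longrightarrow> determined (A v)"
  shows "determined (\<Union>v\<in>V. A v)"
proof -
  have "\<forall>v\<in>V. \<exists>C. C \<in> sets \<mu> \<and> (AE x in M. x \<in> A v \<longleftrightarrow> coord x \<in> C)"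
    using assms(2) by (auto simp: determined_def)
  from bchoice[OF this] obtain C where C: "\<forall>v\<in>V. C v \<in> sets \<mu> \<and> (AE x in M. x \<in> A v \<longleftrightarrow> coord x \<in> C v)" ..
  have "AE x in M. \<forall>v\<in>V. x \<in> A v \<longleftrightarrow> coord x \<in> C v"
    using C assms(1) by (subst AE_finite_all) auto
  then have "AE x in M. x \<in> (\<Union>v\<in>V. A v) \<longleftrightarrow> coord x \<in> (\<Union>v\<in>V. C v)" by eventually_elim blast
  moreover have "(\<Union>v\<in>V. C v) \<in> sets \<mu>" using C assms(1) by (intro sets.finite_UN) auto
  ultimately show ?thesis unfolding determined_def by blast
qed

lemma determined_T:
  assumes "determined A" and A: "A \<subseteq> space M"
  shows "determined (T v ` A)"
proof -
  obtain C where C: "C \<in> sets \<mu>" "AE x in M. x \<in> A \<longleftrightarrow> coord x \<in> C"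
    using assms(1) by (auto simp: determined_def)
  have "AE x in distr M M (T (- v)). x \<in> A \<longleftrightarrow> coord x \<in> C" using C(2) by (simp only: T_distr)
  then have "AE x in M. T (- v) x \<in> A \<longleftrightarrow> coord (T (- v) x) \<in> C" by (rule AE_distrD[OF T_meas])
  then have "AE x in M. x \<in> T v ` A \<longleftrightarrow> coord x \<in> odometer_action G (- v) -` C \<inter> space \<mu>"
    using coord_equivariant_AE AE_space
  proof eventually_elim
    case (elim x)
    then show ?case using measurable_space[OF coord_measurable] by (simp add: T_image_eq[OF A])
  qed
  moreover have "odometer_action G (- v) -` C \<inter> space \<mu> \<in> sets \<mu>"
    by (rule measurable_sets[OF measurable_odometer_action C(1)])
  ultimately show ?thesis unfolding determined_def by blast
qed

text \<open>
  At a late stage \<open>s\<close>, a point outside \<open>tail s\<close> on level \<open>i\<close> is in \<open>B l\<close> exactly when \<open>i\<close> is a descendant,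
  and its coordinate \<open>k\<close> is the coset of \<open>i + c s\<close>. The first condition of the theorem compares the
  two, after shifting \<open>D\<close> by \<open>c s\<close>.
\<close>

lemma determined_B:
  assumes a: "\<forall>\<epsilon>::real. \<epsilon> > 0 \<longrightarrow> (\<exists>k N. \<forall>m\<ge>N. m \<ge> l \<longrightarrow>
      (\<exists>D \<subseteq> carrier (Zgrp Mod G k).
        real (card (sym_diff (I l m) {i \<in> F m. zcoset (G k) i \<in> D})) / real (card (I l m)) < \<epsilon>))"
  shows "determined (B l)"
proof (rule determined_of_approx[OF B_sets])
  fix e :: real assume e: "e > 0"
  then have "e / 2 > 0" by simp
  then obtain k N where kN: "\<And>m. m \<ge> N \<Longrightarrow> m \<ge> l \<Longrightarrow> \<exists>D \<subseteq> carrier (Zgrp Mod G k).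
        real (card (sym_diff (I l m) {i \<in> F m. zcoset (G k) i \<in> D})) / real (card (I l m)) < e / 2"
    using a by blast
  have "\<forall>\<^sub>F s in sequentially. measure M (tail s) < e / 2"
    using order_tendstoD(2)[OF tail_tendsto \<open>e / 2 > 0\<close>] .
  then obtain s0 where s0: "\<And>s. s \<ge> s0 \<Longrightarrow> measure M (tail s) < e / 2" by (auto simp: eventually_sequentially)
  define s where "s = Max {s0, k, N, l}"
  have s: "s0 \<le> s" "k \<le> s" "N \<le> r s" "l \<le> r s"
  proof -
    have "s \<le> r s" using r_mono by (rule strict_mono_imp_increasing)
    moreover have "s0 \<le> s" "k \<le> s" "N \<le> s" "l \<le> s" by (auto simp: s_def)
    ultimately show "s0 \<le> s" "k \<le> s" "N \<le> r s" "l \<le> r s" by auto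
  qed
  let ?m = "r s"
  obtain D where D: "real (card (sym_diff (I l ?m) {i \<in> F ?m. zcoset (G k) i \<in> D})) / real (card (I l ?m)) < e / 2"
    using kN[OF s(3,4)] by blast
  let ?V = "sym_diff (I l ?m) {i \<in> F ?m. zcoset (G k) i \<in> D}"
  have VF: "?V \<subseteq> F ?m" using I_subset[of l ?m] by blast
  define D' where "D' = {d \<in> range (zcoset (G k)). \<exists>i. d = zcoset (G k) (i + c s) \<and> zcoset (G k) i \<in> D}"
  have D'_iff: "zcoset (G k) (i + c s) \<in> D' \<longleftrightarrow> zcoset (G k) i \<in> D" for i
  proof
    assume "zcoset (G k) (i + c s) \<in> D'"
    then obtain i' where "zcoset (G k) (i + c s) = zcoset (G k) (i' + c s)" "zcoset (G k) i' \<in> D"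
      unfolding D'_def mem_Collect_eq by (elim exE conjE)
    moreover from this(1) have "zcoset (G k) i = zcoset (G k) i'" by (simp add: zcoset_G_eq_iff)
    ultimately show "zcoset (G k) i \<in> D" by simp
  next
    assume "zcoset (G k) i \<in> D"
    then show "zcoset (G k) (i + c s) \<in> D'"
      unfolding D'_def mem_Collect_eq by (intro exI[of _ i] conjI rangeI refl) assumption
  qed
  define C where "C = (\<Union>d\<in>D'. cyl k d)"
  have "finite D'" by (rule finite_subset[OF _ finite_cosets[of k]]) (auto simp: D'_def)
  then have CS: "C \<in> sets \<mu>" unfolding C_def by (intro sets.finite_UN) auto
  have C_iff: "coord x \<in> C \<longleftrightarrow> coord x k \<in> D'" if "x \<in> space M" for x
    using coord_in_odometer[OF that] by (auto simp: C_def cyl_def)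
  have sub: "{x \<in> space M. \<not> (x \<in> B l \<longleftrightarrow> coord x \<in> C)} \<subseteq> tail s \<union> (\<Union>i\<in>?V. T i ` B ?m)"
  proof (rule subsetI, rule ccontr)
    fix x assume x: "x \<in> {x \<in> space M. \<not> (x \<in> B l \<longleftrightarrow> coord x \<in> C)}"
      and nx: "x \<notin> tail s \<union> (\<Union>i\<in>?V. T i ` B ?m)"
    then have x1: "x \<in> space M" "x \<notin> tail s" by auto
    obtain i where i: "i \<in> F ?m" "x \<in> T i ` B ?m" using notin_tail_level[OF x1] by blast
    have "i \<notin> ?V" using nx i(2) by blast
    moreover have "x \<in> B l \<longleftrightarrow> i \<in> I l ?m"
      using B_union_of_levels(2)[OF s(4) i(1)] level_subset_B[of i l ?m] i(2) by blast
    moreover have "coord x \<in> C \<longleftrightarrow> zcoset (G k) i \<in> D"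
      using coord_eq[OF x1 s(2)] pos_eq[OF i] by (simp add: C_iff[OF x1(1)] label_def D'_iff)
    ultimately show False using x i(1) by blast
  qed
  have US: "(\<Union>i\<in>?V. T i ` B ?m) \<in> sets M"
    using finite_subset[OF VF finite_F] by (intro sets.finite_UN) auto
  have "measure M {x \<in> space M. \<not> (x \<in> B l \<longleftrightarrow> coord x \<in> C)} \<le> measure M (tail s \<union> (\<Union>i\<in>?V. T i ` B ?m))"
    by (rule finite_measure_mono[OF sub]) (use US in auto)
  also have "\<dots> \<le> measure M (tail s) + card ?V * measure M (B ?m)"
    using measure_Un_le[OF tail_sets US, of s] measure_levels[OF VF] by simp
  also have "card ?V * measure M (B ?m) \<le> e / 2 * card (I l ?m) * measure M (B ?m)"
    using D card_I_pos[OF s(4)] by (intro mult_right_mono) (auto simp: divide_less_eq)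
  also have "e / 2 * card (I l ?m) * measure M (B ?m) = e / 2 * measure M (B l)"
    using measure_B[OF s(4)] by simp
  also have "\<dots> \<le> e / 2" using e by (simp add: mult_left_le)
  finally have "measure M {x \<in> space M. \<not> (x \<in> B l \<longleftrightarrow> coord x \<in> C)} < e" using s0[OF s(1)] by linarith
  then show "\<exists>C\<in>sets \<mu>. measure M {x \<in> space M. \<not> (x \<in> B l \<longleftrightarrow> coord x \<in> C)} < e" using CS by blast
qed

text \<open>
  Levels are translates of the sets \<open>B l\<close>, and their finite unions approximate \<open>A\<close>.
\<close>

lemma determined_all:
  assumes B: "\<And>l. determined (B l)" and A: "A \<in> sets M"
  shows "determined A"
proof (rule determined_of_approx[OF A])
  fix e :: real assume e: "e > 0"
  obtain L where L: "\<And>n. union_of_levels T (F n) (B n) (L n)"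
    "(\<lambda>n. measure M (sym_diff (L n) A)) \<longlonglongrightarrow> 0"
    using towers A unfolding rank_one_towers_def by blast
  have "\<forall>\<^sub>F n in sequentially. measure M (sym_diff (L n) A) < e" using order_tendstoD(2)[OF L(2) e] .
  then obtain n where n: "measure M (sym_diff (L n) A) < e" by (auto simp: eventually_sequentially)
  obtain V where V: "V \<subseteq> F n" "L n = (\<Union>v\<in>V. T v ` B n)" using L(1)[of n] by (auto simp: union_of_levels_def)
  have finV: "finite V" using finite_subset[OF V(1) finite_F] .
  have LS: "L n \<in> sets M" unfolding V(2) using finV by (intro sets.finite_UN) auto
  have "determined (L n)" unfolding V(2) by (intro determined_UN finV determined_T B B_space)
  then obtain C where C: "C \<in> sets \<mu>" "AE x in M. x \<in> L n \<longleftrightarrow> coord x \<in> C"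
    by (auto simp: determined_def)
  have "measure M {x \<in> space M. \<not> (x \<in> A \<longleftrightarrow> coord x \<in> C)} = measure M (sym_diff (L n) A)"
  proof (rule measure_eq_AE)
    show "AE x in M. x \<in> {x \<in> space M. \<not> (x \<in> A \<longleftrightarrow> coord x \<in> C)} \<longleftrightarrow> x \<in> sym_diff (L n) A"
      using C(2) AE_space by eventually_elim auto
    have "{x \<in> space M. \<not> (x \<in> A \<longleftrightarrow> coord x \<in> C)} = sym_diff A (coord -` C \<inter> space M)"
      using sets.sets_into_space[OF A] by auto
    then show "{x \<in> space M. \<not> (x \<in> A \<longleftrightarrow> coord x \<in> C)} \<in> sets M"
      using A measurable_sets[OF coord_measurable C(1)] by auto
  qed (use LS A in auto)
  then show "\<exists>C\<in>sets \<mu>. measure M {x \<in> space M. \<not> (x \<in> A \<longleftrightarrow> coord x \<in> C)} < e" using C(1) n by (intro bexI[of _ C]) simp_all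
qed

text \<open>
  Off a null set, the image under \<open>coord\<close> decides membership in each set of a separating family.
\<close>

lemma coord_almost_surely_inj:
  assumes "\<And>A. A \<in> sets M \<Longrightarrow> determined A"
  shows "almost_surely_inj M coord"
proof -
  obtain S :: "nat \<Rightarrow> _" and Z where Z: "Z \<in> null_sets M" and S: "range S \<subseteq> sets M"
    and S_sep: "\<forall>x\<in>space M - Z. \<forall>y\<in>space M - Z. (\<forall>n. x \<in> S n \<longleftrightarrow> y \<in> S n) \<longrightarrow> x = y"
    using lebesgue_or_finite_model(2)[OF base_space_regular] unfolding countably_separated_def by blast
  have "\<forall>n. \<exists>C. C \<in> sets \<mu> \<and> (AE x in M. x \<in> S n \<longleftrightarrow> coord x \<in> C)"
  proof
    fix n
    have "determined (S n)" using assms S by auto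
    then show "\<exists>C. C \<in> sets \<mu> \<and> (AE x in M. x \<in> S n \<longleftrightarrow> coord x \<in> C)" by (auto simp: determined_def)
  qed
  from choice[OF this] obtain C where C: "\<forall>n. C n \<in> sets \<mu> \<and> (AE x in M. x \<in> S n \<longleftrightarrow> coord x \<in> C n)" ..
  then have "AE x in M. \<forall>n. x \<in> S n \<longleftrightarrow> coord x \<in> C n" by (simp add: AE_all_countable)
  then obtain Z' where Z': "Z' \<in> null_sets M" "{x \<in> space M. \<not> (\<forall>n. x \<in> S n \<longleftrightarrow> coord x \<in> C n)} \<subseteq> Z'"
    unfolding eventually_ae_filter by blast
  have "inj_on coord (space M - (Z \<union> Z'))"
  proof (rule inj_onI)
    fix x y assume x: "x \<in> space M - (Z \<union> Z')" and y: "y \<in> space M - (Z \<union> Z')" and eq: "coord x = coord y"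
    have "x \<in> S n \<longleftrightarrow> coord x \<in> C n" "y \<in> S n \<longleftrightarrow> coord y \<in> C n" for n using x y Z'(2) by blast+
    then have "\<forall>n. x \<in> S n \<longleftrightarrow> y \<in> S n" using eq by simp
    then show "x = y" using S_sep x y by blast
  qed
  then show ?thesis unfolding almost_surely_inj_def using null_sets.Un[OF Z Z'(1)] by blast
qed

end

context rank_one_and_odometer
begin

text \<open>
  Choose \<open>r (Suc s)\<close> after \<open>r s\<close>, so late that the tower \<open>r (Suc s)\<close> is nearly invariant under the finitely
  many translations in \<open>F (r s)\<close>. The second condition is used at stage \<open>s\<close> for the subgroup \<open>G s\<close>;
  as \<open>G\<close> is decreasing, a single sequence then serves all subgroups.
\<close>

lemma labelled_towers_exist:
  assumes b: "\<forall>j. \<forall>\<epsilon>::real. \<epsilon> > 0 \<longrightarrow> (\<exists>N. \<forall>m n. n \<ge> m \<and> m \<ge> N \<longrightarrow>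
      (\<exists>g. real (card {i \<in> I m n. i - g \<notin> G j}) / real (card (I m n)) < \<epsilon>))"
  shows "\<exists>r c. labelled_towers M T F B G \<mu> r c"
proof -
  have "\<forall>s. \<exists>N. \<forall>m n. n \<ge> m \<and> m \<ge> N \<longrightarrow>
      (\<exists>g. real (card {i \<in> I m n. i - g \<notin> G s}) / real (card (I m n)) < (1/2)^s)"
    by (rule allI, rule b[THEN spec, THEN spec, THEN mp]) simp
  from choice[OF this] obtain N where N: "\<forall>s. \<forall>m n. n \<ge> m \<and> m \<ge> N s \<longrightarrow>
      (\<exists>g. real (card {i \<in> I m n. i - g \<notin> G s}) / real (card (I m n)) < (1/2)^s)" ..
  define fol where "fol m n = (\<Sum>i\<in>F m. real (card {k \<in> F n. i + k \<notin> F n}) / card (F n))" for m n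
  have fol_lim: "(\<lambda>n. fol m n) \<longlonglongrightarrow> 0" for m
    unfolding fol_def by (rule tendsto_null_sum) (rule folner_boundary)
  have evE: "\<forall>\<^sub>F n in sequentially. measure M (E n) \<le> (1/2)^s" for s
    using order_tendstoD(2)[OF E_tendsto, of "(1/2)^s"] by (auto elim: eventually_mono)
  have evF: "\<forall>\<^sub>F n in sequentially. fol m n \<le> (1/2)^s" for m s
    using order_tendstoD(2)[OF fol_lim[of m], of "(1/2)^s"] by (auto elim: eventually_mono)
  have "\<exists>r. \<forall>s. (N s \<le> r s \<and> measure M (E (r s)) \<le> (1/2)^s) \<and> (r s < r (Suc s) \<and> fol (r s) (r (Suc s)) \<le> (1/2)^s)"
  proof (rule dependent_nat_choice)
    show "\<exists>n. N 0 \<le> n \<and> measure M (E n) \<le> (1/2)^0"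
      using eventually_happens[OF eventually_conj[OF eventually_ge_at_top[of "N 0"] evE[of 0]]] by auto
    show "\<exists>n. (N (Suc s) \<le> n \<and> measure M (E n) \<le> (1/2)^(Suc s)) \<and> (m < n \<and> fol m n \<le> (1/2)^s)" for m s
      using eventually_happens[OF eventually_conj[OF eventually_conj[OF eventually_ge_at_top[of "N (Suc s)"] evE[of "Suc s"]]
         eventually_conj[OF eventually_gt_at_top[of m] evF[of m s]]]] by auto
  qed
  then obtain r where r: "\<And>s. N s \<le> r s" "\<And>s. measure M (E (r s)) \<le> (1/2)^s" "\<And>s. r s < r (Suc s)"
     "\<And>s. fol (r s) (r (Suc s)) \<le> (1/2)^s" by blast
  have "\<forall>s. \<exists>g. real (card {i \<in> I (r s) (r (Suc s)). i - g \<notin> G s}) / real (card (I (r s) (r (Suc s)))) < (1/2)^s"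
    using N r(1) less_imp_le[OF r(3)] by blast
  from choice[OF this] obtain g where g:
    "\<forall>s. real (card {i \<in> I (r s) (r (Suc s)). i - g s \<notin> G s}) / real (card (I (r s) (r (Suc s)))) < (1/2)^s" ..
  \<comment> \<open>Chosen so that \<open>c s - c (Suc s) = g s\<close>.\<close>
  define c where "c s = - (\<Sum>t<s. g t)" for s
  have c: "c s - c (Suc s) = g s" for s by (simp add: c_def)
  have "labelled_towers M T F B G \<mu> r c"
  proof unfold_locales
    show "strict_mono r" using r(3) by (simp add: strict_mono_Suc_iff)
    show "measure M (E (r s)) \<le> (1/2)^s" for s by (rule r(2))
    show "real (card {k \<in> I (r s) (r (Suc s)). k - (c s - c (Suc s)) \<notin> G s}) \<le> (1/2)^s * card (I (r s) (r (Suc s)))" for s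
      using g[rule_format, of s] card_I_pos[OF less_imp_le[OF r(3)], of s] unfolding c
      by (simp add: divide_less_eq less_imp_le)
    show "(\<Sum>i\<in>F (r s). real (card {k \<in> F (r (Suc s)). i + k \<notin> F (r (Suc s))}) / card (F (r (Suc s)))) \<le> (1/2)^s" for s
      using r(4)[of s] by (simp add: fol_def)
  qed
  then show ?thesis by blast
qed

lemma conditions_imp_conjugate:
  assumes a: "\<forall>l. \<forall>\<epsilon>::real. \<epsilon> > 0 \<longrightarrow> (\<exists>k N. \<forall>m\<ge>N. m \<ge> l \<longrightarrow>
      (\<exists>D \<subseteq> carrier (Zgrp Mod G k).
        real (card (sym_diff (I l m) {i \<in> F m. zcoset (G k) i \<in> D})) / real (card (I l m)) < \<epsilon>))"
    and b: "\<forall>j. \<forall>\<epsilon>::real. \<epsilon> > 0 \<longrightarrow> (\<exists>N. \<forall>m n. n \<ge> m \<and> m \<ge> N \<longrightarrow>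
      (\<exists>g. real (card {i \<in> I m n. i - g \<notin> G j}) / real (card (I m n)) < \<epsilon>))"
  shows "conjugate M T \<mu> (odometer_action G)"
proof -
  obtain r c where "labelled_towers M T F B G \<mu> r c" using labelled_towers_exist[OF b] by blast
  then interpret labelled_towers M T F B G \<mu> r c .
  have "determined A" if "A \<in> sets M" for A
    by (rule determined_all[OF determined_B that]) (rule spec[OF a])
  then have "almost_surely_inj M coord" by (rule coord_almost_surely_inj)
  then show ?thesis using coord_factor_map unfolding conjugate_def by blast
qed

end

theorem theorem5p1:
  fixes M :: "'a measure"
    and T :: "int ^ 'd::finite \<Rightarrow> 'a \<Rightarrow> 'a"
    and F :: "nat \<Rightarrow> (int ^ 'd) set"
    and B :: "nat \<Rightarrow> 'a set"
    and G :: "nat \<Rightarrow> (int ^ 'd) set"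
    and \<mu> :: "(nat \<Rightarrow> (int ^ 'd) set) measure"
  assumes "mp_action M T"
    and "folner_rank_one M T"
    and "folner_sequence F" and "\<And>n. 0 \<in> F n"
    and "rank_one_towers M T F B" and "stacking M T F B"
    and "\<And>j. finite_index_subgroup (G j)" and "decseq G"
    and "odometer_haar_measure G \<mu>"
  defines "I \<equiv> descendants T F B"
  shows "conjugate M T \<mu> (odometer_action G) \<longleftrightarrow>
    (\<forall>l. \<forall>\<epsilon>::real. \<epsilon> > 0 \<longrightarrow> (\<exists>k N. \<forall>m\<ge>N. m \<ge> l \<longrightarrow>
      (\<exists>D \<subseteq> carrier (Zgrp Mod G k).
        real (card (sym_diff (I l m) {i \<in> F m. G k #>\<^bsub>Zgrp\<^esub> i \<in> D})) / real (card (I l m))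
          < \<epsilon>))) \<and>
    (\<forall>j. \<forall>\<epsilon>::real. \<epsilon> > 0 \<longrightarrow> (\<exists>N. \<forall>m n. n \<ge> m \<and> m \<ge> N \<longrightarrow>
      (\<exists>g. real (card {i \<in> I m n. i - g \<notin> G j}) / real (card (I m n)) < \<epsilon>)))"
proof -
  interpret rank_one_and_odometer M T F B G \<mu>
    by unfold_locales (use assms in auto)
  show ?thesis
    unfolding I_def
    by (rule iffI, erule conjugate_imp_conditions, erule conjE, erule (1) conditions_imp_conjugate)
qed

end
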